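(* Fix $1\le p<2$. There exist constants $c_p,C_p>0$ depending only on $p$ such that for all integers $d\ge 2$ and $n\ge1$ there is a distribution over $r\times n$ real matrices $\Pi$ with $r\le C_p d^2$, every matrix in whose support has at most two non-zero entries per column, such that for every fixed $A\in\mathbb{R}^{n\times d}$, with probability at least $0.99$, simultaneously for all $x\in\mathbb{R}^d$, $$c_p\|Ax\|_p\le\|\Pi Ax\|_p\le C_p (d\log d)^{1/p}\|Ax\|_p.$$
   Context: $\|y\|_p=(\sum_i|y_i|^p)^{1/p}$. The distribution depends only on $n,d$ (and $p$), not on $A$. *)

theory Defs
  imports "HOL-Probability.Probability"
begin

text \<open>Vectors of length m are functions nat => real, only indices i < m matter.
  Matrices with m rows and k columns are functions nat => nat => real,
  only entries (i,j) with i < m, j < k matter.\<close>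

definition lp_norm :: "real \<Rightarrow> nat \<Rightarrow> (nat \<Rightarrow> real) \<Rightarrow> real" where
  "lp_norm p m y = (\<Sum>i<m. \<bar>y i\<bar> powr p) powr (1 / p)"

definition mat_vec :: "nat \<Rightarrow> (nat \<Rightarrow> nat \<Rightarrow> real) \<Rightarrow> (nat \<Rightarrow> real) \<Rightarrow> (nat \<Rightarrow> real)" where
  "mat_vec k A x = (\<lambda>i. \<Sum>j<k. A i j * x j)"

definition two_sparse_cols :: "nat \<Rightarrow> nat \<Rightarrow> (nat \<Rightarrow> nat \<Rightarrow> real) \<Rightarrow> bool" where
  "two_sparse_cols r n P \<longleftrightarrow> (\<forall>j<n. card {i. i < r \<and> P i j \<noteq> 0} \<le> 2)"

end

theory Submission
  imports Defs
begin

text \<open>Write \<open>\<parallel>y\<parallel>\<close> for the \<open>p\<close>-norm and \<open>\<bar>y\<bar>\<close> for the Euclidean norm. The matrix stacks two blocks with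
  one non-zero entry per column: a CountSketch \<open>\<alpha> S\<close> with \<open>O(d\<^sup>2)\<close> rows and
  \<open>\<alpha> \<approx> (d log d) powr (1 / p - 1 / 2)\<close>, and a CountSketch \<open>T\<close> with \<open>O(d log d)\<close> rows whose columns are
  multiplied by independent weights with tail \<open>P(X > t) \<approx> t powr (- p)\<close>.

  Dilation. A Lewis basis of the column space gives \<open>y = V z\<close> with \<open>\<bar>z\<bar> \<le> 2 \<parallel>y\<parallel>\<close>, where the
  Euclidean norms of the rows of \<open>V\<close> have \<open>p\<close>-th powers summing to at most \<open>2 d\<close>. Truncating the
  weights and using second moments below a lower threshold, the expected sum over the buckets of the
  \<open>p\<close>-th powers of the norms of the sketched rows is \<open>O(d log d)\<close>: only the logarithm of the ratio of
  the two thresholds enters, not \<open>n\<close>. For \<open>S\<close> it suffices that \<open>\<parallel>S y\<parallel> \<le> O(sqrt d) \<parallel>y\<parallel>\<close>.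

  Contraction. \<open>S\<close> preserves the Euclidean norm on the subspace and \<open>p < 2\<close>, so \<open>\<alpha> S\<close> handles all \<open>y\<close>
  with \<open>\<bar>y\<bar> \<ge> \<parallel>y\<parallel> / \<alpha>\<close>. For the other \<open>y\<close> most of the mass sits in coordinates of size at most
  \<open>(d log d) powr (- 1 / p)\<close> relative to \<open>\<parallel>y\<parallel>\<close>; a fixed such \<open>y\<close> is contracted by \<open>T\<close> with probability
  only \<open>exp (- \<Omega>(d log d))\<close>, which beats the size of a polynomially fine net for \<open>z\<close>.\<close>

text \<open>Neither block suffices alone. A vector with its mass on a few coordinates can be
  cancelled by collisions in T with a probability that is not exponentially small in d, so no net
  argument covers it; its Euclidean norm is large relative to \<parallel>y\<parallel>, and it is
  left to S. Scaling S by \<alpha> is paid for in the dilation. The net has exp(O(d log d)) points,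
  which forces about d log d rows in T; this fixes the Euclidean threshold and hence \<alpha>, and
  then \<open>\<alpha> powr p * d powr (p / 2)\<close> is again of order d log d, the cost of T
  itself. The dilation of T needs no net: the norms of the sketched rows of V bound \<parallel>T V
  z\<parallel> for all z at once. The same bound controls T on rounding errors, which is why a
  polynomially fine net is enough for the contraction. All randomness is uniform on finite products:
  the weights are \<open>(N / u) powr (1 / p)\<close> up to sign, with u uniform in {1..N} and N =
  n, so probabilities are counts and independence is an iterated average. Estimates are made for
  p-th powers, and roots are taken once, at the end.\<close>

section \<open>Inequalities for powers and p-norms\<close>

text \<open>Below v monotonicity suffices; above v the factor \<open>t powr (\<theta> - 1)\<close>
  is at most its value at v. The free v makes this a substitute for concavity: taking v as the mean
  gives Jensen up to a factor 2, and \<open>v = \<tau> powr q\<close> linearises the small part of a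
  bucket.\<close>

lemma powr_le_linear_split:
  fixes t v \<theta> :: real
  assumes "0 \<le> t" "0 < v" "0 < \<theta>" "\<theta> \<le> 1"
  shows "t powr \<theta> \<le> t * v powr (\<theta> - 1) + v powr \<theta>"
proof (cases "t \<le> v")
  case True
  then have "t powr \<theta> \<le> v powr \<theta>" using assms by (intro powr_mono2) auto
  then show ?thesis using assms by (smt (verit) mult_nonneg_nonneg powr_ge_zero)
next
  case False
  then have t: "t > 0" using assms by linarith
  have "t powr \<theta> = t * t powr (\<theta> - 1)" using t by (simp add: powr_diff)
  also have "\<dots> \<le> t * v powr (\<theta> - 1)"
    using assms False t by (intro mult_left_mono powr_mono2') auto
  finally show ?thesis by (smt (verit) powr_ge_zero)
qed

lemma powr_add_subadditive:
  fixes a b \<theta> :: real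
  assumes "0 \<le> a" "0 \<le> b" "0 < \<theta>" "\<theta> \<le> 1"
  shows "(a + b) powr \<theta> \<le> a powr \<theta> + b powr \<theta>"
proof (cases "a = 0 \<or> b = 0")
  case True
  then show ?thesis by auto
next
  case False
  then have ab: "a > 0" "b > 0" using assms by auto
  have "(a + b) powr \<theta> = a * (a + b) powr (\<theta> - 1) + b * (a + b) powr (\<theta> - 1)"
    using ab by (simp add: powr_diff add_divide_distrib[symmetric] flip: distrib_right)
  also have "\<dots> \<le> a * a powr (\<theta> - 1) + b * b powr (\<theta> - 1)"
    using ab assms by (intro add_mono mult_left_mono powr_mono2') auto
  also have "\<dots> = a powr \<theta> + b powr \<theta>" using ab by (simp add: powr_diff)
  finally show ?thesis .
qed

lemma powr_sum_subadditive:
  fixes f :: "'a \<Rightarrow> real"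
  assumes "finite S" "\<And>i. i \<in> S \<Longrightarrow> 0 \<le> f i" "0 < \<theta>" "\<theta> \<le> 1"
  shows "(\<Sum>i\<in>S. f i) powr \<theta> \<le> (\<Sum>i\<in>S. f i powr \<theta>)"
  using assms(1,2)
proof (induction S rule: finite_induct)
  case (insert x F)
  have "(f x + sum f F) powr \<theta> \<le> f x powr \<theta> + sum f F powr \<theta>"
    using insert assms by (intro powr_add_subadditive sum_nonneg) auto
  with insert show ?case by fastforce
qed simp

text \<open>Stands in for Minkowski at the level of p-th powers; 4 bounds \<open>2 powr p\<close>
  for all p up to 2.\<close>

lemma abs_add_powr_le:
  fixes a b p :: real
  assumes "1 \<le> p" "p \<le> 2"
  shows "\<bar>a + b\<bar> powr p \<le> 4 * (\<bar>a\<bar> powr p + \<bar>b\<bar> powr p)"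
proof -
  let ?m = "max \<bar>a\<bar> \<bar>b\<bar>"
  have "\<bar>a + b\<bar> powr p \<le> (2 * ?m) powr p"
    using assms by (intro powr_mono2) auto
  also have "\<dots> = 2 powr p * ?m powr p" by (simp add: powr_mult)
  also have "\<dots> \<le> 4 * (\<bar>a\<bar> powr p + \<bar>b\<bar> powr p)"
  proof (intro mult_mono)
    have "(2::real) powr p \<le> 2 powr 2" using assms by (intro powr_mono) auto
    then show "(2::real) powr p \<le> 4" by simp
  qed (auto simp: max_def)
  finally show ?thesis .
qed

lemma power2_powr_half: "(x\<^sup>2) powr (p / 2) = \<bar>x\<bar> powr p" for x p :: real
proof -
  have "x\<^sup>2 = \<bar>x\<bar> powr 2" by simp
  then show ?thesis by (simp only: powr_powr) simp
qed

text \<open>The p-th power of \<open>lp_norm\<close>. Unlike the norm it is additive over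
  coordinates, buckets and the two blocks of the matrix.\<close>

definition npow :: "real \<Rightarrow> nat \<Rightarrow> (nat \<Rightarrow> real) \<Rightarrow> real" where
  "npow p m y = (\<Sum>i<m. \<bar>y i\<bar> powr p)"

lemma npow_nonneg [simp]: "0 \<le> npow p m y"
  unfolding npow_def by (intro sum_nonneg) auto

lemma npow_cong: "(\<And>i. i < m \<Longrightarrow> y i = y' i) \<Longrightarrow> npow p m y = npow p m y'"
  unfolding npow_def by (intro sum.cong) auto

lemma npow_add_le:
  assumes "1 \<le> p" "p \<le> 2"
  shows "npow p m (\<lambda>i. y i + y' i) \<le> 4 * (npow p m y + npow p m y')"
  unfolding npow_def sum.distrib[symmetric] sum_distrib_left
  using assms by (intro sum_mono abs_add_powr_le)

lemma npow_scale: "npow p m (\<lambda>i. t * y i) = \<bar>t\<bar> powr p * npow p m y"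
  unfolding npow_def by (simp add: abs_mult powr_mult sum_distrib_left)

lemma npow_coord_le: "i < m \<Longrightarrow> \<bar>y i\<bar> powr p \<le> npow p m y"
  unfolding npow_def by (intro member_le_sum) auto

lemma sum_squares_le_npow:
  assumes "0 < p" "p \<le> 2"
  shows "(\<Sum>i<m. (y i)\<^sup>2) \<le> npow p m y powr (2 / p)"
proof -
  have "(\<Sum>i<m. (y i)\<^sup>2) powr (p / 2) \<le> (\<Sum>i<m. (y i)\<^sup>2 powr (p / 2))"
    using assms by (intro powr_sum_subadditive) auto
  also have "\<dots> = npow p m y"
    unfolding npow_def
    by (simp add: power2_powr_half)
  finally have "((\<Sum>i<m. (y i)\<^sup>2) powr (p / 2)) powr (2 / p) \<le> npow p m y powr (2 / p)"
    using assms by (intro powr_mono2) auto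
  then show ?thesis using assms by (simp add: powr_powr sum_nonneg)
qed

section \<open>Weighted Gram--Schmidt\<close>

text \<open>Columns are normalised one after another, but a column dependent on earlier ones becomes
  zero; hence the norms in {0, 1}, and A may have any rank. The weights may vanish only on zero rows
  of A, which makes the weighted form definite on the column space. W records that V stays in the
  column space, and the last clause is the orthogonal expansion of A in V.\<close>

lemma gram_schmidt:
  fixes c :: "nat \<Rightarrow> real" and A :: "nat \<Rightarrow> nat \<Rightarrow> real"
  assumes c0: "\<forall>i<n. 0 \<le> c i"
    and c1: "\<forall>i<n. \<forall>j<d. A i j \<noteq> 0 \<longrightarrow> 0 < c i"
  shows "\<exists>V W. (\<forall>i<n. \<forall>j<d. V i j = (\<Sum>k<d. A i k * W k j))
     \<and> (\<forall>j<d. \<forall>k<d. j \<noteq> k \<longrightarrow> (\<Sum>i<n. c i * V i j * V i k) = 0)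
     \<and> (\<forall>j<d. (\<Sum>i<n. c i * V i j * V i j) \<in> {0, 1})
     \<and> (\<forall>i<n. \<forall>k<d. A i k = (\<Sum>j<d. (\<Sum>l<n. c l * A l k * V l j) * V i j))"
  using c1
proof (induction d)
  case 0
  then show ?case by simp
next
  case (Suc d)
  define ip where "ip f g = (\<Sum>i<n. c i * f i * g i)" for f g :: "nat \<Rightarrow> real"
  have ip_commute: "ip f g = ip g f" for f g
    unfolding ip_def by (intro sum.cong) (auto simp: ac_simps)
  have ip_diff: "ip (\<lambda>i. f i - g i) h = ip f h - ip g h" for f g h
    unfolding ip_def by (simp add: algebra_simps sum_subtractf)
  have ip_scale: "ip (\<lambda>i. f i / t) h = ip f h / t" for f h t
    unfolding ip_def by (simp add: sum_divide_distrib)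
  have ip_sum: "ip (\<lambda>i. \<Sum>j<d. e j * F i j) h = (\<Sum>j<d. e j * ip (\<lambda>i. F i j) h)" for e F h
    unfolding ip_def sum_distrib_left sum_distrib_right
    by (subst sum.swap) (intro sum.cong refl, simp add: ac_simps)
  have ip_cong: "ip f h = ip g h" if "\<And>i. i < n \<Longrightarrow> f i = g i" for f g h
    unfolding ip_def using that by (intro sum.cong) auto
  have "\<exists>V W. (\<forall>i<n. \<forall>j<d. V i j = (\<Sum>k<d. A i k * W k j))
     \<and> (\<forall>j<d. \<forall>k<d. j \<noteq> k \<longrightarrow> ip (\<lambda>i. V i j) (\<lambda>i. V i k) = 0)
     \<and> (\<forall>j<d. ip (\<lambda>i. V i j) (\<lambda>i. V i j) \<in> {0, 1})
     \<and> (\<forall>i<n. \<forall>k<d. A i k = (\<Sum>j<d. ip (\<lambda>i. A i k) (\<lambda>i. V i j) * V i j))"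
    unfolding ip_def by (rule Suc.IH) (use Suc.prems less_SucI in metis)
  then obtain V W where *:
    "\<forall>i<n. \<forall>j<d. V i j = (\<Sum>k<d. A i k * W k j)"
    "\<forall>j<d. \<forall>k<d. j \<noteq> k \<longrightarrow> ip (\<lambda>i. V i j) (\<lambda>i. V i k) = 0"
    "\<forall>j<d. ip (\<lambda>i. V i j) (\<lambda>i. V i j) \<in> {0, 1}"
    "\<forall>i<n. \<forall>k<d. A i k = (\<Sum>j<d. ip (\<lambda>i. A i k) (\<lambda>i. V i j) * V i j)"
    by (elim exE conjE) (rule that)
  have VW: "V i j = (\<Sum>k<d. A i k * W k j)" if "i < n" "j < d" for i j
    by (rule *(1)[rule_format, OF that])
  have orth: "ip (\<lambda>i. V i j) (\<lambda>i. V i k) = 0" if "j < d" "k < d" "j \<noteq> k" for j k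
    using *(2) that by blast
  have nrm: "ip (\<lambda>i. V i j) (\<lambda>i. V i j) \<in> {0, 1}" if "j < d" for j
    using *(3) that by blast
  have rep: "A i k = (\<Sum>j<d. ip (\<lambda>i. A i k) (\<lambda>i. V i j) * V i j)" if "i < n" "k < d" for i k
    by (rule *(4)[rule_format, OF that])
  define e where "e j = ip (\<lambda>i. A i d) (\<lambda>i. V i j)" for j
  define w where "w i = A i d - (\<Sum>j<d. e j * V i j)" for i
  define s where "s = sqrt (ip w w)"
  have ww0: "0 \<le> ip w w" unfolding ip_def using c0 by (intro sum_nonneg) (auto simp: mult.assoc)
  have ss: "s * s = ip w w" unfolding s_def using ww0 by simp
  \<comment> \<open>For s = 0 division by zero makes the new column zero, as wanted:
    \<open>w0\<close> shows that w vanishes then.\<close>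
  define V' where "V' i j = (if j < d then V i j else w i / s)" for i j
  define W' where "W' k j = (if j < d then (if k < d then W k j else 0)
      else ((if k < d then 0 else 1) - (\<Sum>j<d. e j * (if k < d then W k j else 0))) / s)" for k j
  \<comment> \<open>A row of weight zero is zero in A, hence in V through \<open>VW\<close>, hence
    in w.\<close>
  have w0: "w i = 0" if "i < n" "s = 0" for i
  proof (cases "c i = 0")
    case True
    then have A0: "A i k = 0" if "k < Suc d" for k
      using Suc.prems \<open>i < n\<close> that by auto
    have "V i j = 0" if "j < d" for j
      using VW[OF \<open>i < n\<close> that] A0 by simp
    then show ?thesis unfolding w_def using A0[of d] by simp
  next
    case False
    have "ip w w = 0" using ss that by simp
    then have "c i * w i * w i = 0"
      unfolding ip_def using c0 that
      by (subst (asm) sum_nonneg_eq_0_iff) (auto simp: mult.assoc)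
    then show ?thesis using False by simp
  qed
  have wV: "ip w (\<lambda>i. V i k) = 0" if "k < d" for k
  proof -
    \<comment> \<open>A column of norm 0 has vanishing weighted entries, so e k is 0 as well; norms
      0 and 1 can then be treated alike.\<close>
    have vv: "e k * ip (\<lambda>i. V i k) (\<lambda>i. V i k) = e k"
    proof -
      have "e k = 0" if "ip (\<lambda>i. V i k) (\<lambda>i. V i k) = 0"
      proof -
        have "\<forall>i<n. c i * (V i k * V i k) = 0"
          using that c0 unfolding ip_def
          by (subst (asm) sum_nonneg_eq_0_iff) (auto simp: mult.assoc)
        then show ?thesis unfolding e_def ip_def by (intro sum.neutral) auto
      qed
      then show ?thesis using nrm[OF \<open>k < d\<close>] by auto
    qed
    have "ip w (\<lambda>i. V i k) = e k - (\<Sum>j<d. e j * ip (\<lambda>i. V i j) (\<lambda>i. V i k))"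
      unfolding w_def ip_diff ip_sum by (simp add: e_def)
    also have "(\<Sum>j<d. e j * ip (\<lambda>i. V i j) (\<lambda>i. V i k)) = (\<Sum>j<d. if j = k then e k else 0)"
      by (intro sum.cong) (use orth that vv in auto)
    finally show ?thesis using that by simp
  qed
  have Vw: "ip (\<lambda>i. V i k) w = 0" if "k < d" for k
    using wV[OF that] by (subst ip_commute)
  have wA: "s * V' i d = w i" if "i < n" for i
    unfolding V'_def using w0 that by (cases "s = 0") auto
  have "(\<forall>i<n. \<forall>j<Suc d. V' i j = (\<Sum>k<Suc d. A i k * W' k j))
     \<and> (\<forall>j<Suc d. \<forall>k<Suc d. j \<noteq> k \<longrightarrow> ip (\<lambda>i. V' i j) (\<lambda>i. V' i k) = 0)
     \<and> (\<forall>j<Suc d. ip (\<lambda>i. V' i j) (\<lambda>i. V' i j) \<in> {0, 1})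
     \<and> (\<forall>i<n. \<forall>k<Suc d. A i k = (\<Sum>j<Suc d. ip (\<lambda>i. A i k) (\<lambda>i. V' i j) * V' i j))"
  proof (intro conjI allI impI)
    fix i j assume "i < n" "j < Suc d"
    show "V' i j = (\<Sum>k<Suc d. A i k * W' k j)"
    proof (cases "j < d")
      case True
      then have "(\<Sum>k<d. A i k * W' k j) = (\<Sum>k<d. A i k * W k j)" "W' d j = 0"
        by (auto simp: W'_def intro!: sum.cong)
      then show ?thesis using True VW[OF \<open>i < n\<close> True] by (simp add: V'_def)
    next
      case False
      have "(\<Sum>j<d. e j * V i j) = (\<Sum>k<d. A i k * (\<Sum>j<d. e j * W k j))"
      proof -
        have "(\<Sum>j<d. e j * V i j) = (\<Sum>j<d. \<Sum>k<d. A i k * (e j * W k j))"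
          using VW[OF \<open>i < n\<close>] by (intro sum.cong refl) (simp add: sum_distrib_left ac_simps)
        then show ?thesis by (subst (asm) sum.swap) (simp add: sum_distrib_left)
      qed
      then have "V' i j = (A i d - (\<Sum>k<d. A i k * (\<Sum>j<d. e j * W k j))) / s"
        using False by (simp add: V'_def w_def)
      also have "\<dots> = (\<Sum>k<d. A i k * (- (\<Sum>j<d. e j * W k j) / s)) + A i d * (1 / s)"
        by (simp add: diff_divide_distrib sum_divide_distrib[symmetric] sum_negf)
      also have "\<dots> = (\<Sum>k<d. A i k * W' k j) + A i d * W' d j"
        using False by (simp add: W'_def)
      finally show ?thesis by simp
    qed
  next
    fix j k assume jk: "j < Suc d" "k < Suc d" "j \<noteq> k"
    have Vd: "ip (\<lambda>i. V' i d) (\<lambda>i. V' i k) = 0" if "k < d" for k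
      using wV[OF that] that by (simp add: V'_def ip_scale)
    show "ip (\<lambda>i. V' i j) (\<lambda>i. V' i k) = 0"
    proof (cases "j = d")
      case True
      then show ?thesis using Vd jk by auto
    next
      case jd: False
      show ?thesis
      proof (cases "k = d")
        case True
        then show ?thesis using Vd[of j] jk jd
          by (subst ip_commute) simp
      next
        case False
        then show ?thesis using orth[of j k] jk jd by (simp add: V'_def)
      qed
    qed
  next
    fix j assume j: "j < Suc d"
    show "ip (\<lambda>i. V' i j) (\<lambda>i. V' i j) \<in> {0, 1}"
    proof (cases "j < d")
      case True
      then show ?thesis using nrm by (simp add: V'_def)
    next
      case False
      have "ip (\<lambda>i. w i / s) (\<lambda>i. w i / s) = ip w w / (s * s)"
        unfolding ip_scale by (subst ip_commute) (simp add: ip_scale)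
      then show ?thesis using False ss by (simp add: V'_def)
    qed
  next
    fix i k assume ik: "i < n" "k < Suc d"
    show "A i k = (\<Sum>j<Suc d. ip (\<lambda>i. A i k) (\<lambda>i. V' i j) * V' i j)"
    proof (cases "k < d")
      case True
      have "ip (\<lambda>i. A i k) w = ip (\<lambda>i. \<Sum>j<d. ip (\<lambda>i. A i k) (\<lambda>i. V i j) * V i j) w"
        using rep True by (intro ip_cong) auto
      also have "\<dots> = 0" unfolding ip_sum by (intro sum.neutral) (simp add: Vw)
      finally have "ip (\<lambda>i. A i k) (\<lambda>i. V' i d) = 0"
        by (subst ip_commute, subst (asm) ip_commute) (simp add: V'_def ip_scale)
      then show ?thesis using rep[of i k] ik True by (simp add: V'_def)
    next
      case False
      then have k: "k = d" using ik by simp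
      have "ip (\<lambda>i. A i d) w = ip w w"
      proof -
        have "ip w w = ip (\<lambda>i. A i d) w - ip (\<lambda>i. \<Sum>j<d. e j * V i j) w"
          by (subst ip_diff[symmetric], rule ip_cong) (simp add: w_def)
        also have "ip (\<lambda>i. \<Sum>j<d. e j * V i j) w = 0"
          unfolding ip_sum by (intro sum.neutral) (simp add: Vw)
        finally show ?thesis by simp
      qed
      moreover have "ip (\<lambda>i. A i d) (\<lambda>i. V' i d) = ip (\<lambda>i. A i d) w / s"
        by (subst (1 2) ip_commute) (simp add: V'_def ip_scale)
      ultimately have *: "ip (\<lambda>i. A i d) (\<lambda>i. V' i d) = s"
        using ss by (cases "s = 0") (auto, metis nonzero_mult_div_cancel_left)
      have "(\<Sum>j<d. ip (\<lambda>i. A i d) (\<lambda>i. V' i j) * V' i j) = (\<Sum>j<d. e j * V i j)"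
        by (intro sum.cong) (auto simp: V'_def e_def)
      then show ?thesis using wA[of i] ik k * by (simp add: w_def)
    qed
  qed
  then show ?case unfolding ip_def by (intro exI[of _ V'] exI[of _ W'])
qed

section \<open>Lewis bases\<close>

definition row_norm :: "nat \<Rightarrow> (nat \<Rightarrow> nat \<Rightarrow> real) \<Rightarrow> nat \<Rightarrow> real" where
  "row_norm d V i = sqrt (\<Sum>j<d. (V i j)\<^sup>2)"

lemma row_norm_nonneg [simp]: "0 \<le> row_norm d V i"
  unfolding row_norm_def by (simp add: sum_nonneg)

lemma row_norm_power2: "(row_norm d V i)\<^sup>2 = (\<Sum>j<d. (V i j)\<^sup>2)"
  unfolding row_norm_def by (simp add: sum_nonneg)

lemma abs_mat_vec_le: "\<bar>mat_vec d V z i\<bar> \<le> row_norm d V i * sqrt (\<Sum>j<d. (z j)\<^sup>2)"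
proof -
  have "(mat_vec d V z i)\<^sup>2 \<le> (\<Sum>j<d. (V i j)\<^sup>2) * (\<Sum>j<d. (z j)\<^sup>2)"
    unfolding mat_vec_def by (rule Cauchy_Schwarz_ineq_sum)
  then have "sqrt ((mat_vec d V z i)\<^sup>2) \<le> sqrt ((\<Sum>j<d. (V i j)\<^sup>2) * (\<Sum>j<d. (z j)\<^sup>2))"
    by (rule real_sqrt_le_mono)
  then show ?thesis unfolding row_norm_def by (simp add: real_sqrt_mult)
qed

text \<open>The coefficients z are the weighted inner products of A x with the columns of V. For
  this choice Parseval holds even though some columns of V may be zero.\<close>

lemma orthonormal_basis:
  fixes c :: "nat \<Rightarrow> real" and A :: "nat \<Rightarrow> nat \<Rightarrow> real"
  assumes c0: "\<forall>i<n. 0 \<le> c i"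
    and c1: "\<forall>i<n. \<forall>j<d. A i j \<noteq> 0 \<longrightarrow> 0 < c i"
  obtains V W where
    "\<And>x i. i < n \<Longrightarrow> mat_vec d V x i = mat_vec d A (mat_vec d W x) i"
    "\<And>j k. j < d \<Longrightarrow> k < d \<Longrightarrow> j \<noteq> k \<Longrightarrow> (\<Sum>i<n. c i * V i j * V i k) = 0"
    "\<And>j. j < d \<Longrightarrow> (\<Sum>i<n. c i * V i j * V i j) \<in> {0, 1}"
    "\<And>x. \<exists>z. (\<forall>i<n. mat_vec d A x i = mat_vec d V z i) \<and>
        (\<Sum>j<d. (z j)\<^sup>2) = (\<Sum>i<n. c i * (mat_vec d A x i)\<^sup>2)"
proof -
  from gram_schmidt[of n c d A, OF c0 c1] obtain V W where *:
    "\<forall>i<n. \<forall>j<d. V i j = (\<Sum>k<d. A i k * W k j)"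
    "\<forall>j<d. \<forall>k<d. j \<noteq> k \<longrightarrow> (\<Sum>i<n. c i * V i j * V i k) = 0"
    "\<forall>j<d. (\<Sum>i<n. c i * V i j * V i j) \<in> {0, 1}"
    "\<forall>i<n. \<forall>k<d. A i k = (\<Sum>j<d. (\<Sum>l<n. c l * A l k * V l j) * V i j)"
    by (elim exE conjE) (rule that)
  show thesis
  proof (rule that[of V W])
    fix x i assume i: "i < n"
    have "mat_vec d V x i = (\<Sum>j<d. \<Sum>k<d. A i k * W k j * x j)"
      unfolding mat_vec_def using *(1) i by (simp add: sum_distrib_right)
    also have "\<dots> = mat_vec d A (mat_vec d W x) i"
      unfolding mat_vec_def by (subst sum.swap) (simp add: sum_distrib_left mult.assoc)
    finally show "mat_vec d V x i = mat_vec d A (mat_vec d W x) i" .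
  next
    fix x
    define y where "y = mat_vec d A x"
    define z where "z j = (\<Sum>l<n. c l * y l * V l j)" for j
    have rep: "y i = mat_vec d V z i" if i: "i < n" for i
    proof -
      have "y i = (\<Sum>k<d. (\<Sum>j<d. (\<Sum>l<n. c l * A l k * V l j) * V i j) * x k)"
        unfolding y_def mat_vec_def
        by (intro sum.cong refl arg_cong2[where f = "(*)"] *(4)[rule_format]) (use i in auto)
      also have "\<dots> = (\<Sum>k<d. \<Sum>j<d. \<Sum>l<n. V i j * (c l * (A l k * x k) * V l j))"
        by (simp add: sum_distrib_right sum_distrib_left ac_simps)
      also have "\<dots> = (\<Sum>j<d. \<Sum>k<d. \<Sum>l<n. V i j * (c l * (A l k * x k) * V l j))"
        by (rule sum.swap)
      also have "\<dots> = (\<Sum>j<d. \<Sum>l<n. \<Sum>k<d. V i j * (c l * (A l k * x k) * V l j))"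
        by (intro sum.cong refl sum.swap)
      also have "\<dots> = mat_vec d V z i"
        unfolding mat_vec_def z_def y_def
        by (simp add: sum_distrib_right sum_distrib_left)
      finally show ?thesis .
    qed
    have "(\<Sum>i<n. c i * (y i)\<^sup>2) = (\<Sum>i<n. c i * y i * mat_vec d V z i)"
      using rep by (intro sum.cong refl) (simp add: power2_eq_square)
    also have "\<dots> = (\<Sum>j<d. \<Sum>i<n. c i * y i * (V i j * z j))"
      unfolding mat_vec_def sum_distrib_left by (rule sum.swap)
    also have "\<dots> = (\<Sum>j<d. z j * z j)"
      by (intro sum.cong refl, subst (2) z_def) (simp add: sum_distrib_left ac_simps)
    finally show "\<exists>z. (\<forall>i<n. mat_vec d A x i = mat_vec d V z i) \<and>
        (\<Sum>j<d. (z j)\<^sup>2) = (\<Sum>i<n. c i * (mat_vec d A x i)\<^sup>2)"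
      using rep unfolding y_def by (intro exI[of _ z]) (auto simp: power2_eq_square)
  qed (use *(2,3) in auto)
qed

text \<open>\<open>leverage n d A c \<rho>\<close>: the i-th coordinate functional on the column space of \<open>A\<close> has norm
  \<open>\<rho> i\<close> with respect to the Euclidean norm with weights \<open>c\<close>.\<close>

definition leverage ::
    "nat \<Rightarrow> nat \<Rightarrow> (nat \<Rightarrow> nat \<Rightarrow> real) \<Rightarrow> (nat \<Rightarrow> real) \<Rightarrow> (nat \<Rightarrow> real) \<Rightarrow> bool" where
  "leverage n d A c \<rho> \<longleftrightarrow>
     (\<forall>i<n. 0 \<le> \<rho> i) \<and>
     (\<forall>x. \<forall>i<n. \<bar>mat_vec d A x i\<bar> \<le> \<rho> i * sqrt (\<Sum>k<n. c k * (mat_vec d A x k)\<^sup>2)) \<and>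
     (\<forall>i<n. \<exists>x. (\<Sum>k<n. c k * (mat_vec d A x k)\<^sup>2) \<le> 1 \<and> mat_vec d A x i = \<rho> i)"

text \<open>Cauchy--Schwarz bounds the i-th coordinate functional by the norm of the i-th row of V,
  and the normalised row attains the bound. The weighted squares of the row norms add up to the
  number of non-zero columns of V, so to at most d.\<close>

lemma leverage_exists:
  fixes c :: "nat \<Rightarrow> real" and A :: "nat \<Rightarrow> nat \<Rightarrow> real"
  assumes c0: "\<forall>i<n. 0 \<le> c i"
    and c1: "\<forall>i<n. \<forall>j<d. A i j \<noteq> 0 \<longrightarrow> 0 < c i"
  obtains V where "leverage n d A c (row_norm d V)"
    "(\<Sum>i<n. c i * (row_norm d V i)\<^sup>2) \<le> real d"
    "\<And>x. \<exists>z. (\<forall>i<n. mat_vec d A x i = mat_vec d V z i) \<and>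
        (\<Sum>j<d. (z j)\<^sup>2) = (\<Sum>i<n. c i * (mat_vec d A x i)\<^sup>2)"
proof -
  obtain V W where
    VW: "\<And>x i. i < n \<Longrightarrow> mat_vec d V x i = mat_vec d A (mat_vec d W x) i"
    and orth: "\<And>j k. j < d \<Longrightarrow> k < d \<Longrightarrow> j \<noteq> k \<Longrightarrow> (\<Sum>i<n. c i * V i j * V i k) = 0"
    and nrm: "\<And>j. j < d \<Longrightarrow> (\<Sum>i<n. c i * V i j * V i j) \<in> {0, 1}"
    and rep: "\<And>x. \<exists>z. (\<forall>i<n. mat_vec d A x i = mat_vec d V z i) \<and>
        (\<Sum>j<d. (z j)\<^sup>2) = (\<Sum>i<n. c i * (mat_vec d A x i)\<^sup>2)"
    apply (rule orthonormal_basis[of n c d A, OF c0 c1])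
    subgoal for V W by (rule that[of V W]; blast)
    done
  have norm_V: "(\<Sum>k<n. c k * (mat_vec d V z k)\<^sup>2) \<le> (\<Sum>j<d. (z j)\<^sup>2)" for z
  proof -
    have "(\<Sum>k<n. c k * (mat_vec d V z k)\<^sup>2) =
        (\<Sum>k<n. \<Sum>j<d. \<Sum>l<d. z j * z l * (c k * V k j * V k l))"
    proof (intro sum.cong refl)
      fix k
      have "(mat_vec d V z k)\<^sup>2 = (\<Sum>j<d. \<Sum>l<d. z j * z l * (V k j * V k l))"
        unfolding mat_vec_def power2_eq_square sum_product
        by (intro sum.cong refl) (simp add: ac_simps)
      then show "c k * (mat_vec d V z k)\<^sup>2 = (\<Sum>j<d. \<Sum>l<d. z j * z l * (c k * V k j * V k l))"
        by (simp add: sum_distrib_left ac_simps)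
    qed
    also have "\<dots> = (\<Sum>j<d. \<Sum>l<d. \<Sum>k<n. z j * z l * (c k * V k j * V k l))"
      by (rule trans[OF sum.swap]) (intro sum.cong refl sum.swap)
    also have "\<dots> = (\<Sum>j<d. \<Sum>l<d. z j * z l * (\<Sum>k<n. c k * V k j * V k l))"
      by (simp add: sum_distrib_left)
    also have "\<dots> = (\<Sum>j<d. \<Sum>l<d. if l = j then z j * z j * (\<Sum>k<n. c k * V k j * V k j) else 0)"
      by (intro sum.cong refl) (use orth in auto)
    also have "\<dots> = (\<Sum>j<d. z j * z j * (\<Sum>k<n. c k * V k j * V k j))"
      by simp
    also have "\<dots> \<le> (\<Sum>j<d. (z j)\<^sup>2)"
    proof (intro sum_mono)
      fix j assume "j \<in> {..<d}"
      then show "z j * z j * (\<Sum>k<n. c k * V k j * V k j) \<le> (z j)\<^sup>2"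
        using nrm[of j] by (auto simp: power2_eq_square)
    qed
    finally show ?thesis .
  qed
  show thesis
  proof (rule that[of V])
    show "leverage n d A c (row_norm d V)"
      unfolding leverage_def
    proof (intro conjI allI impI)
      fix x i assume i: "i < n"
      obtain z where z: "\<forall>i<n. mat_vec d A x i = mat_vec d V z i"
        "(\<Sum>j<d. (z j)\<^sup>2) = (\<Sum>i<n. c i * (mat_vec d A x i)\<^sup>2)" using rep by blast
      show "\<bar>mat_vec d A x i\<bar> \<le> row_norm d V i * sqrt (\<Sum>k<n. c k * (mat_vec d A x k)\<^sup>2)"
        using abs_mat_vec_le[of d V z i] z i by simp
    next
      fix i assume i: "i < n"
      \<comment> \<open>Extremal vector of Cauchy--Schwarz; it is zero when the row is, by division
        by zero.\<close>
      define z where "z j = V i j / row_norm d V i" for j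
      have "(\<Sum>j<d. (z j)\<^sup>2) = (row_norm d V i)\<^sup>2 / (row_norm d V i)\<^sup>2"
        unfolding z_def by (simp add: power_divide row_norm_power2 flip: sum_divide_distrib)
      also have "\<dots> \<le> 1" by simp
      finally have z1: "(\<Sum>j<d. (z j)\<^sup>2) \<le> 1" .
      have "mat_vec d V z i = (row_norm d V i)\<^sup>2 / row_norm d V i"
        unfolding z_def row_norm_power2 mat_vec_def by (simp add: power2_eq_square sum_divide_distrib)
      also have "\<dots> = row_norm d V i" by (simp add: power2_eq_square)
      finally have z2: "mat_vec d V z i = row_norm d V i" .
      show "\<exists>x. (\<Sum>k<n. c k * (mat_vec d A x k)\<^sup>2) \<le> 1 \<and> mat_vec d A x i = row_norm d V i"
        using norm_V[of z] z1 z2 VW[of _ z] i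
        by (intro exI[of _ "mat_vec d W z"]) auto
    qed auto
    have "(\<Sum>i<n. c i * (row_norm d V i)\<^sup>2) = (\<Sum>i<n. \<Sum>j<d. c i * V i j * V i j)"
      unfolding row_norm_power2 by (simp add: sum_distrib_left power2_eq_square ac_simps)
    also have "\<dots> = (\<Sum>j<d. \<Sum>i<n. c i * V i j * V i j)" by (rule sum.swap)
    also have "\<dots> \<le> (\<Sum>j<d. 1)" by (intro sum_mono) (use nrm in force)
    finally show "(\<Sum>i<n. c i * (row_norm d V i)\<^sup>2) \<le> real d" by simp
  qed (rule rep)
qed

text \<open>Larger weights shrink the unit ball and with it the norm of each coordinate functional.
  The square root supplies the factor 1/2 in the contraction exponent 1 - p / 2 of the iteration
  below.\<close>

lemma leverage_mono:
  assumes \<rho>: "leverage n d A c \<rho>" and \<rho>': "leverage n d A c' \<rho>'"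
    and cc': "\<And>i. i < n \<Longrightarrow> c i \<le> s * c' i" and s: "0 \<le> s" and i: "i < n"
  shows "\<rho>' i \<le> sqrt s * \<rho> i"
proof -
  obtain x where x: "(\<Sum>k<n. c' k * (mat_vec d A x k)\<^sup>2) \<le> 1" "mat_vec d A x i = \<rho>' i"
    using \<rho>' i unfolding leverage_def by blast
  have "(\<Sum>k<n. c k * (mat_vec d A x k)\<^sup>2) \<le> (\<Sum>k<n. s * (c' k * (mat_vec d A x k)\<^sup>2))"
    unfolding mult.assoc[symmetric] by (intro sum_mono mult_right_mono) (use cc' in auto)
  also have "\<dots> = s * (\<Sum>k<n. c' k * (mat_vec d A x k)\<^sup>2)" by (simp add: sum_distrib_left)
  also have "\<dots> \<le> s * 1" using x s by (intro mult_left_mono)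
  finally have le: "sqrt (\<Sum>k<n. c k * (mat_vec d A x k)\<^sup>2) \<le> sqrt s" by simp
  have "\<rho>' i \<le> \<bar>mat_vec d A x i\<bar>" using x by simp
  also have "\<dots> \<le> \<rho> i * sqrt (\<Sum>k<n. c k * (mat_vec d A x k)\<^sup>2)"
    using \<rho> i unfolding leverage_def by blast
  also have "\<dots> \<le> \<rho> i * sqrt s"
    using le \<rho> i unfolding leverage_def by (intro mult_left_mono) auto
  finally show ?thesis by (simp add: mult.commute)
qed

text \<open>The zero pattern of the scores depends on A only, so it stays fixed along the
  iteration.\<close>

lemma leverage_pos_iff:
  assumes \<rho>: "leverage n d A c \<rho>" and i: "i < n"
  shows "0 < \<rho> i \<longleftrightarrow> (\<exists>j<d. A i j \<noteq> 0)"
proof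
  assume "0 < \<rho> i"
  moreover obtain x where "mat_vec d A x i = \<rho> i" using \<rho> i unfolding leverage_def by blast
  ultimately have "(\<Sum>j<d. A i j * x j) \<noteq> 0" by (simp add: mat_vec_def)
  then show "\<exists>j<d. A i j \<noteq> 0" using sum.neutral[of "{..<d}" "\<lambda>j. A i j * x j"] by fastforce
next
  assume "\<exists>j<d. A i j \<noteq> 0"
  then obtain j where j: "j < d" "A i j \<noteq> 0" by blast
  have "mat_vec d A (\<lambda>k. if k = j then 1 else 0) i = A i j"
    unfolding mat_vec_def using j by (simp add: if_distrib cong: if_cong)
  then have "\<bar>A i j\<bar> \<le> \<rho> i * sqrt (\<Sum>k<n. c k * (mat_vec d A (\<lambda>k. if k = j then 1 else 0) k)\<^sup>2)"
    using \<rho> i unfolding leverage_def by metis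
  then have "\<rho> i \<noteq> 0" using j by auto
  moreover have "0 \<le> \<rho> i" using \<rho> i unfolding leverage_def by blast
  ultimately show "0 < \<rho> i" by simp
qed

lemma powr_le_of_ratio:
  fixes a b s e :: real
  assumes "a \<le> s * b" "0 < a" "0 < b" "0 < s" "e \<le> 0"
  shows "b powr e \<le> s powr (- e) * a powr e"
proof -
  have "(s * b) powr e \<le> a powr e" using assms by (intro powr_mono2') auto
  then have "s powr e * b powr e \<le> a powr e" using assms by (simp add: powr_mult)
  then show ?thesis using assms by (simp add: powr_minus field_simps)
qed

text \<open>The map from the weights \<open>\<tau> powr (p - 2)\<close> to their leverage scores contracts multiplicative
  distances by the factor \<open>1 - p / 2\<close>, so iterating it produces an almost fixed point.\<close>

lemma leverage_almost_fixed_point: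
  fixes p :: real
  assumes p: "1 \<le> p" "p < 2"
  obtains \<tau> V where "leverage n d A (\<lambda>i. \<tau> i powr (p - 2)) (row_norm d V)"
    "(\<Sum>i<n. \<tau> i powr (p - 2) * (row_norm d V i)\<^sup>2) \<le> real d"
    "\<And>x. \<exists>z. (\<forall>i<n. mat_vec d A x i = mat_vec d V z i) \<and>
        (\<Sum>j<d. (z j)\<^sup>2) = (\<Sum>i<n. \<tau> i powr (p - 2) * (mat_vec d A x i)\<^sup>2)"
    "\<And>i. i < n \<Longrightarrow> 0 \<le> \<tau> i" "\<And>i. i < n \<Longrightarrow> 0 < \<tau> i \<longleftrightarrow> (\<exists>j<d. A i j \<noteq> 0)"
    "\<And>i. i < n \<Longrightarrow> \<tau> i \<le> 2 * row_norm d V i" "\<And>i. i < n \<Longrightarrow> row_norm d V i \<le> 2 * \<tau> i"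
proof -
  define pos where "pos \<tau> \<longleftrightarrow> (\<forall>i<n. 0 \<le> \<tau> i \<and> (0 < \<tau> i \<longleftrightarrow> (\<exists>j<d. A i j \<noteq> 0)))" for \<tau> :: "nat \<Rightarrow> real"
  \<comment> \<open>For \<tau> i = 0 the weight is 0, since \<open>0 powr x = 0\<close>. Under
    \<open>pos \<tau>\<close> this happens only on zero rows, as \<open>leverage_exists\<close>
    demands.\<close>
  define w where "w \<tau> i = \<tau> i powr (p - 2)" for \<tau> :: "nat \<Rightarrow> real" and i
  define close where "close s \<tau> \<tau>' \<longleftrightarrow> (\<forall>i<n. \<tau> i \<le> s * \<tau>' i \<and> \<tau>' i \<le> s * \<tau> i)"
    for s and \<tau> \<tau>' :: "nat \<Rightarrow> real"
  \<comment> \<open>The exponent p - 2 scales logarithmic distances by 2 - p, and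
    \<open>leverage_mono\<close> halves them.\<close>
  define \<theta> where "\<theta> = 1 - p / 2"
  have w_ex: "\<exists>V. leverage n d A (w \<tau>) (row_norm d V) \<and>
      (\<Sum>i<n. w \<tau> i * (row_norm d V i)\<^sup>2) \<le> real d \<and>
      (\<forall>x. \<exists>z. (\<forall>i<n. mat_vec d A x i = mat_vec d V z i) \<and>
        (\<Sum>j<d. (z j)\<^sup>2) = (\<Sum>i<n. w \<tau> i * (mat_vec d A x i)\<^sup>2))" if "pos \<tau>" for \<tau>
  proof -
    have 1: "\<forall>i<n. 0 \<le> w \<tau> i" by (simp add: w_def)
    have 2: "\<forall>i<n. \<forall>j<d. A i j \<noteq> 0 \<longrightarrow> 0 < w \<tau> i" using that by (auto simp: w_def pos_def)
    show ?thesis by (rule leverage_exists[OF 1 2]) blast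
  qed
  have lev_pos: "pos \<rho>" if "leverage n d A c \<rho>" for c \<rho>
    unfolding pos_def using that leverage_pos_iff[OF that] by (auto simp: leverage_def)
  define \<tau>\<^sub>0 :: "nat \<Rightarrow> real" where "\<tau>\<^sub>0 i = (if \<exists>j<d. A i j \<noteq> 0 then 1 else 0)" for i
  have pos0: "pos \<tau>\<^sub>0" by (simp add: pos_def \<tau>\<^sub>0_def)
  obtain V\<^sub>0 where V0: "leverage n d A (w \<tau>\<^sub>0) (row_norm d V\<^sub>0)" using w_ex[OF pos0] by blast
  define s where "s = 1 + (\<Sum>i<n. row_norm d V\<^sub>0 i + 1 / row_norm d V\<^sub>0 i)"
  have s1: "1 \<le> s" unfolding s_def by (simp add: sum_nonneg)
  have close0: "close s \<tau>\<^sub>0 (row_norm d V\<^sub>0)"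
    unfolding close_def
  proof (intro allI impI)
    fix i assume i: "i < n"
    let ?r = "row_norm d V\<^sub>0 i"
    have "?r + 1 / ?r \<le> (\<Sum>i<n. row_norm d V\<^sub>0 i + 1 / row_norm d V\<^sub>0 i)"
      using i by (intro member_le_sum[of i _ "\<lambda>i. row_norm d V\<^sub>0 i + 1 / row_norm d V\<^sub>0 i"]) auto
    then have *: "?r + 1 / ?r \<le> s" unfolding s_def by simp
    have pr: "0 < ?r \<longleftrightarrow> 0 < \<tau>\<^sub>0 i" using lev_pos[OF V0] pos0 i unfolding pos_def by blast
    show "\<tau>\<^sub>0 i \<le> s * ?r \<and> ?r \<le> s * \<tau>\<^sub>0 i"
    proof (cases "0 < ?r")
      case True
      then have t1: "\<tau>\<^sub>0 i = 1" using pr by (auto simp: \<tau>\<^sub>0_def split: if_splits)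
      have "1 / ?r \<le> s" "?r \<le> s" using * True by (smt (verit) zero_le_divide_1_iff)+
      then show ?thesis using True t1 by (simp add: field_simps)
    next
      case False
      then have "?r = 0" "\<tau>\<^sub>0 i = 0"
        using pr row_norm_nonneg[of d V\<^sub>0 i] by (auto simp: \<tau>\<^sub>0_def split: if_splits)
      then show ?thesis by simp
    qed
  qed
  have iter: "\<exists>\<tau> V. pos \<tau> \<and> leverage n d A (w \<tau>) (row_norm d V) \<and> close (s powr (\<theta> ^ k)) \<tau> (row_norm d V)" for k
  proof (induction k)
    case 0
    then show ?case using pos0 V0 close0 s1 by auto
  next
    case (Suc k)
    then obtain \<tau> V where \<tau>: "pos \<tau>" "leverage n d A (w \<tau>) (row_norm d V)"
      "close (s powr (\<theta> ^ k)) \<tau> (row_norm d V)" by blast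
    let ?\<rho> = "row_norm d V" and ?s = "s powr (\<theta> ^ k)"
    have pos': "pos ?\<rho>" using lev_pos[OF \<tau>(2)] .
    obtain V' where V': "leverage n d A (w ?\<rho>) (row_norm d V')" using w_ex[OF pos'] by blast
    have ww: "w \<tau> i \<le> ?s powr (2 - p) * w ?\<rho> i \<and> w ?\<rho> i \<le> ?s powr (2 - p) * w \<tau> i" if i: "i < n" for i
    proof (cases "0 < \<tau> i")
      case True
      then have "0 < ?\<rho> i" using \<tau>(1) pos' i unfolding pos_def by blast
      then show ?thesis
        using True \<tau>(3) i p s1 powr_le_of_ratio[of "?\<rho> i" ?s "\<tau> i" "p - 2"]
          powr_le_of_ratio[of "\<tau> i" ?s "?\<rho> i" "p - 2"]
        by (auto simp: w_def close_def)
    next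
      case False
      moreover have "0 \<le> \<tau> i" "0 < ?\<rho> i \<longleftrightarrow> 0 < \<tau> i"
        using \<tau>(1) pos' i unfolding pos_def by blast+
      ultimately have "\<tau> i = 0" "?\<rho> i = 0" using row_norm_nonneg[of d V i] by linarith+
      then show ?thesis by (simp add: w_def)
    qed
    have sq: "sqrt (?s powr (2 - p)) = s powr (\<theta> ^ Suc k)"
      using s1 by (simp add: powr_half_sqrt[symmetric] powr_powr \<theta>_def algebra_simps)
    have "close (s powr (\<theta> ^ Suc k)) ?\<rho> (row_norm d V')"
      unfolding close_def sq[symmetric]
      using leverage_mono[OF \<tau>(2) V', of "?s powr (2 - p)"] leverage_mono[OF V' \<tau>(2), of "?s powr (2 - p)"] ww
      by auto
    then show ?case using pos' V' by blast
  qed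
  have "(\<lambda>k. s powr (\<theta> ^ k)) \<longlonglongrightarrow> s powr 0"
    using s1 p by (intro tendsto_intros LIMSEQ_power_zero) (auto simp: \<theta>_def abs_if)
  then have "eventually (\<lambda>k. s powr (\<theta> ^ k) < 2) sequentially"
    by (rule order_tendstoD) (use s1 in auto)
  then obtain k where k: "s powr (\<theta> ^ k) < 2" by (auto simp: eventually_sequentially)
  obtain \<tau> V where \<tau>: "pos \<tau>" "leverage n d A (w \<tau>) (row_norm d V)"
    "close (s powr (\<theta> ^ k)) \<tau> (row_norm d V)" using iter by blast
  obtain V' where V': "leverage n d A (w \<tau>) (row_norm d V')"
      "(\<Sum>i<n. w \<tau> i * (row_norm d V' i)\<^sup>2) \<le> real d"
      "\<forall>x. \<exists>z. (\<forall>i<n. mat_vec d A x i = mat_vec d V' z i) \<and>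
        (\<Sum>j<d. (z j)\<^sup>2) = (\<Sum>i<n. w \<tau> i * (mat_vec d A x i)\<^sup>2)"
    using w_ex[OF \<tau>(1)] by blast
  \<comment> \<open>Equal weights have equal scores, whichever basis represents them. So V', which
    comes with the trace bound and the representation, inherits the closeness proved for V.\<close>
  have same: "row_norm d V' i = row_norm d V i" if "i < n" for i
    using leverage_mono[OF \<tau>(2) V'(1), of 1 i] leverage_mono[OF V'(1) \<tau>(2), of 1 i] that by force
  have le2: "\<tau> i \<le> 2 * row_norm d V' i" "row_norm d V' i \<le> 2 * \<tau> i" if i: "i < n" for i
  proof -
    have "\<tau> i \<le> s powr (\<theta> ^ k) * row_norm d V i" "row_norm d V i \<le> s powr (\<theta> ^ k) * \<tau> i"
      using \<tau>(3) i by (auto simp: close_def)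
    moreover have "s powr (\<theta> ^ k) * row_norm d V i \<le> 2 * row_norm d V i"
      "s powr (\<theta> ^ k) * \<tau> i \<le> 2 * \<tau> i"
      using k \<tau>(1) i by (auto simp: pos_def intro!: mult_right_mono)
    ultimately show "\<tau> i \<le> 2 * row_norm d V' i" "row_norm d V' i \<le> 2 * \<tau> i"
      using same[OF i] by auto
  qed
  show thesis
  proof (rule that[of \<tau> V'])
    show "0 \<le> \<tau> i" "0 < \<tau> i \<longleftrightarrow> (\<exists>j<d. A i j \<noteq> 0)" if "i < n" for i
      using \<tau>(1) that unfolding pos_def by blast+
  qed (use V' le2 in \<open>simp_all add: w_def[abs_def]\<close>)
qed

text \<open>At an exact fixed point \<tau> = \<rho>, the square of N = \<bar>z\<bar> is the sum of
  \<open>\<rho> i powr (p - 2) * (y i)\<^sup>2\<close>. Since |y i| \<le> \<rho> i * N, splitting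
  the square into \<open>\<bar>y i\<bar> powr (2 - p) * \<bar>y i\<bar> powr p\<close> cancels
  \<rho> and leaves \<open>N\<^sup>2 \<le> N powr (2 - p) * npow p n y\<close>. Closeness of \<tau>
  and \<rho> up to a factor 2 costs only \<open>2 powr (2 - p) \<le> 2\<close>.\<close>

lemma lewis_basis:
  fixes p :: real
  assumes p: "1 \<le> p" "p < 2"
  obtains V where
    "\<And>x. \<exists>z. (\<forall>i<n. mat_vec d A x i = mat_vec d V z i) \<and>
        sqrt (\<Sum>j<d. (z j)\<^sup>2) powr p \<le> 2 * npow p n (mat_vec d A x)"
    "(\<Sum>i<n. row_norm d V i powr p) \<le> 2 * real d"
proof -
  obtain \<tau> V where V: "leverage n d A (\<lambda>i. \<tau> i powr (p - 2)) (row_norm d V)"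
    "(\<Sum>i<n. \<tau> i powr (p - 2) * (row_norm d V i)\<^sup>2) \<le> real d"
    "\<And>x. \<exists>z. (\<forall>i<n. mat_vec d A x i = mat_vec d V z i) \<and>
        (\<Sum>j<d. (z j)\<^sup>2) = (\<Sum>i<n. \<tau> i powr (p - 2) * (mat_vec d A x i)\<^sup>2)"
    "\<And>i. i < n \<Longrightarrow> 0 \<le> \<tau> i" "\<And>i. i < n \<Longrightarrow> 0 < \<tau> i \<longleftrightarrow> (\<exists>j<d. A i j \<noteq> 0)"
    "\<And>i. i < n \<Longrightarrow> \<tau> i \<le> 2 * row_norm d V i" "\<And>i. i < n \<Longrightarrow> row_norm d V i \<le> 2 * \<tau> i"
    apply (rule leverage_almost_fixed_point[OF p, of n d A])
    subgoal for \<tau> V by (rule that[of \<tau> V]; blast)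
    done
  let ?\<rho> = "row_norm d V"
  have two: "(2::real) powr (- (p - 2)) \<le> 2"
    using powr_mono[of "- (p - 2)" 1 "2::real"] p by simp
  have w1: "?\<rho> i powr (p - 2) \<le> 2 * \<tau> i powr (p - 2)" if "i < n" for i
  proof (cases "0 < ?\<rho> i")
    case True
    then have "0 < \<tau> i" using V(7)[OF that] by linarith
    then have "?\<rho> i powr (p - 2) \<le> 2 powr (- (p - 2)) * \<tau> i powr (p - 2)"
      using True V(6)[OF that] p by (intro powr_le_of_ratio) auto
    also have "\<dots> \<le> 2 * \<tau> i powr (p - 2)" using two by (intro mult_right_mono) auto
    finally show ?thesis .
  next
    case False
    then have "?\<rho> i = 0" using row_norm_nonneg[of d V i] by linarith
    then show ?thesis by simp
  qed
  have w2: "\<tau> i powr (p - 2) \<le> 2 * ?\<rho> i powr (p - 2)" if "i < n" for i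
  proof (cases "0 < \<tau> i")
    case True
    then have "0 < ?\<rho> i" using V(6)[OF that] by linarith
    then have "\<tau> i powr (p - 2) \<le> 2 powr (- (p - 2)) * ?\<rho> i powr (p - 2)"
      using True V(7)[OF that] p by (intro powr_le_of_ratio) auto
    also have "\<dots> \<le> 2 * ?\<rho> i powr (p - 2)" using two by (intro mult_right_mono) auto
    finally show ?thesis .
  next
    case False
    then have "\<tau> i = 0" using V(4)[OF that] by linarith
    then show ?thesis by simp
  qed
  have sq: "t powr (p - 2) * t\<^sup>2 = t powr p" if "0 \<le> t" for t :: real
    using that by (cases "t = 0") (auto simp: powr_diff)
  show thesis
  proof (rule that[of V])
    have "(\<Sum>i<n. ?\<rho> i powr p) = (\<Sum>i<n. ?\<rho> i powr (p - 2) * (?\<rho> i)\<^sup>2)"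
      by (simp add: sq)
    also have "\<dots> \<le> (\<Sum>i<n. 2 * \<tau> i powr (p - 2) * (?\<rho> i)\<^sup>2)"
      by (intro sum_mono mult_right_mono) (use w1 in auto)
    also have "\<dots> = 2 * (\<Sum>i<n. \<tau> i powr (p - 2) * (?\<rho> i)\<^sup>2)"
      by (simp add: sum_distrib_left mult.assoc)
    finally show "(\<Sum>i<n. ?\<rho> i powr p) \<le> 2 * real d" using V(2) by linarith
  next
    fix x
    let ?y = "mat_vec d A x"
    obtain z where z: "\<forall>i<n. ?y i = mat_vec d V z i"
        "(\<Sum>j<d. (z j)\<^sup>2) = (\<Sum>i<n. \<tau> i powr (p - 2) * (?y i)\<^sup>2)" using V(3) by blast
    define N where "N = sqrt (\<Sum>j<d. (z j)\<^sup>2)"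
    have N0: "0 \<le> N" unfolding N_def by (simp add: sum_nonneg)
    have N2: "N\<^sup>2 = (\<Sum>i<n. \<tau> i powr (p - 2) * (?y i)\<^sup>2)"
      unfolding N_def z(2)[symmetric] by (simp add: sum_nonneg)
    have coord: "\<tau> i powr (p - 2) * (?y i)\<^sup>2 \<le> 2 * N powr (2 - p) * \<bar>?y i\<bar> powr p" if i: "i < n" for i
    proof (cases "?y i = 0")
      case False
      have yi: "\<bar>?y i\<bar> \<le> ?\<rho> i * N"
        using abs_mat_vec_le[of d V z i] z(1) i by (simp add: N_def)
      then have "0 < ?\<rho> i * N" using False by linarith
      then have pos: "0 < ?\<rho> i" using row_norm_nonneg[of d V i] by (smt (verit) mult_eq_0_iff)
      have "\<tau> i powr (p - 2) * (?y i)\<^sup>2 = \<tau> i powr (p - 2) * (\<bar>?y i\<bar> powr (2 - p) * \<bar>?y i\<bar> powr p)"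
        using False by (simp flip: powr_add)
      also have "\<dots> \<le> (2 * ?\<rho> i powr (p - 2)) * ((?\<rho> i * N) powr (2 - p) * \<bar>?y i\<bar> powr p)"
        using p yi by (intro mult_mono w2 i powr_mono2) auto
      also have "\<dots> = 2 * N powr (2 - p) * \<bar>?y i\<bar> powr p * (?\<rho> i powr (p - 2) * ?\<rho> i powr (2 - p))"
        using pos N0 by (simp add: powr_mult ac_simps)
      also have "?\<rho> i powr (p - 2) * ?\<rho> i powr (2 - p) = 1"
        using pos by (simp flip: powr_add)
      finally show ?thesis by simp
    qed simp
    have main: "N\<^sup>2 \<le> N powr (2 - p) * (2 * npow p n ?y)"
    proof -
      have "N\<^sup>2 \<le> (\<Sum>i<n. 2 * N powr (2 - p) * \<bar>?y i\<bar> powr p)"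
        unfolding N2 by (intro sum_mono) (use coord in auto)
      also have "\<dots> = N powr (2 - p) * (2 * npow p n ?y)"
        unfolding npow_def by (simp add: sum_distrib_left ac_simps)
      finally show ?thesis .
    qed
    have "N powr p \<le> 2 * npow p n ?y"
    proof (cases "N = 0")
      case False
      then have "N powr (2 - p) * N powr p \<le> N powr (2 - p) * (2 * npow p n ?y)"
        using main N0 by (simp flip: powr_add)
      then show ?thesis using False N0 by simp
    qed simp
    then show "\<exists>z. (\<forall>i<n. ?y i = mat_vec d V z i) \<and>
        sqrt (\<Sum>j<d. (z j)\<^sup>2) powr p \<le> 2 * npow p n ?y"
      using z(1) unfolding N_def by blast
  qed
qed

section \<open>Averages over finite sets\<close>

text \<open>Expectation under the uniform distribution on a finite set; probabilities are averages
  of \<open>of_bool\<close>. Independence appears as nested averages or as products over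
  \<open>PiE\<close>.\<close>

definition avg :: "'a set \<Rightarrow> ('a \<Rightarrow> real) \<Rightarrow> real" where
  "avg S f = sum f S / real (card S)"

lemma avg_const [simp]: "finite S \<Longrightarrow> S \<noteq> {} \<Longrightarrow> avg S (\<lambda>_. c) = c"
  by (simp add: avg_def)

lemma avg_add: "avg S (\<lambda>s. f s + g s) = avg S f + avg S g"
  by (simp add: avg_def sum.distrib add_divide_distrib)

lemma avg_diff: "avg S (\<lambda>s. f s - g s) = avg S f - avg S g"
  by (simp add: avg_def sum_subtractf diff_divide_distrib)

lemma avg_mult: "avg S (\<lambda>s. c * f s) = c * avg S f"
  by (simp add: avg_def sum_distrib_left)

lemma avg_sum: "avg S (\<lambda>s. \<Sum>i\<in>I. f i s) = (\<Sum>i\<in>I. avg S (f i))"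
  unfolding avg_def sum_divide_distrib[symmetric] by (simp add: sum.swap[of _ I S])

lemma avg_mono: "(\<And>s. s \<in> S \<Longrightarrow> f s \<le> g s) \<Longrightarrow> avg S f \<le> avg S g"
  unfolding avg_def by (intro divide_right_mono sum_mono) auto

lemma avg_cong: "(\<And>s. s \<in> S \<Longrightarrow> f s = g s) \<Longrightarrow> avg S f = avg S g"
  unfolding avg_def by (intro arg_cong2[where f = "(/)"] sum.cong) auto

lemma avg_nonneg: "(\<And>s. s \<in> S \<Longrightarrow> 0 \<le> f s) \<Longrightarrow> 0 \<le> avg S f"
  unfolding avg_def by (intro divide_nonneg_nonneg sum_nonneg) auto

lemma avg_le_const:
  assumes "\<And>s. s \<in> S \<Longrightarrow> f s \<le> c" "0 \<le> c"
  shows "avg S f \<le> c"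
proof (cases "finite S \<and> S \<noteq> {}")
  case True
  then show ?thesis using avg_mono[of S f "\<lambda>_. c"] assms(1) by auto
next
  case False
  then show ?thesis using assms(2) by (auto simp: avg_def)
qed

lemma avg_Times:
  "avg (A \<times> B) f = avg A (\<lambda>a. avg B (\<lambda>b. f (a, b)))"
  by (simp add: avg_def sum.cartesian_product card_cartesian_product mult.commute
      flip: sum_divide_distrib)

lemma avg_swap: "avg A (\<lambda>a. avg B (f a)) = avg B (\<lambda>b. avg A (\<lambda>a. f a b))"
  unfolding avg_def sum_divide_distrib[symmetric]
  by (subst sum.swap) (simp add: mult.commute)

lemma avg_markov:
  assumes "\<And>s. s \<in> S \<Longrightarrow> 0 \<le> f s" "0 < t"
  shows "avg S (\<lambda>s. of_bool (t < f s)) \<le> avg S f / t"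
proof -
  have "avg S (\<lambda>s. t * of_bool (t < f s)) \<le> avg S f"
    using assms by (intro avg_mono) auto
  then show ?thesis using assms by (simp add: avg_mult field_simps)
qed

lemma avg_union_bound:
  "avg S (\<lambda>s. of_bool (\<exists>i\<in>I. P i s)) \<le> (\<Sum>i\<in>I. avg S (\<lambda>s. of_bool (P i s)))" if "finite I"
proof -
  have "of_bool (\<exists>i\<in>I. P i s) \<le> (\<Sum>i\<in>I. of_bool (P i s) :: real)" for s
  proof (cases "\<exists>i\<in>I. P i s")
    case True
    then obtain i where "i \<in> I" "P i s" by blast
    then show ?thesis
      using member_le_sum[of i I "\<lambda>i. of_bool (P i s) :: real"] that by auto
  qed (auto intro: sum_nonneg)
  then show ?thesis unfolding avg_sum[symmetric] by (intro avg_mono)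
qed

text \<open>Jensen for a concave power with a spare factor 2: the linear split is taken at the
  mean.\<close>

lemma avg_powr_le:
  assumes S: "finite S" "S \<noteq> {}" and f: "\<And>s. s \<in> S \<Longrightarrow> 0 \<le> f s" and \<theta>: "0 < \<theta>" "\<theta> \<le> 1"
  shows "avg S (\<lambda>s. f s powr \<theta>) \<le> 2 * avg S f powr \<theta>"
proof (cases "avg S f = 0")
  case True
  then have "\<forall>s\<in>S. f s = 0"
    using S f by (simp add: avg_def sum_nonneg_eq_0_iff)
  then have "avg S (\<lambda>s. f s powr \<theta>) = avg S (\<lambda>s. 0)" by (intro avg_cong) auto
  then show ?thesis using S by simp
next
  case False
  then have v: "0 < avg S f" using avg_nonneg[of S f] f by (simp add: less_le)
  let ?v = "avg S f"
  have "avg S (\<lambda>s. f s powr \<theta>) \<le> avg S (\<lambda>s. ?v powr (\<theta> - 1) * f s + ?v powr \<theta>)"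
    using powr_le_linear_split[OF f v \<theta>] by (intro avg_mono) (simp add: mult.commute)
  also have "\<dots> = ?v powr (\<theta> - 1) * ?v + ?v powr \<theta>"
    using S by (simp add: avg_add avg_mult)
  also have "\<dots> = 2 * ?v powr \<theta>" using v by (simp add: powr_diff)
  finally show ?thesis .
qed

lemma avg_prod_PiE:
  assumes "finite I"  "\<And>i. i \<in> I \<Longrightarrow> finite (B i)"
  shows "avg (PiE I B) (\<lambda>\<omega>. \<Prod>i\<in>I. f i (\<omega> i)) = (\<Prod>i\<in>I. avg (B i) (f i))"
  unfolding avg_def using assms
  by (simp add: prod_sum_PiE card_PiE prod_dividef)

lemma avg_PiE_two:
  assumes I: "finite I" "i \<in> I" "j \<in> I" "i \<noteq> j"
    and B: "\<And>i. i \<in> I \<Longrightarrow> finite (B i)" "\<And>i. i \<in> I \<Longrightarrow> B i \<noteq> {}"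
  shows "avg (PiE I B) (\<lambda>\<omega>. f (\<omega> i) * g (\<omega> j)) = avg (B i) f * avg (B j) g"
proof -
  let ?F = "\<lambda>k. if k = i then f else if k = j then g else (\<lambda>_. 1)"
  have I2: "I = insert i (insert j (I - {i, j}))" using I by auto
  have "(\<Prod>k\<in>I. ?F k (\<omega> k)) = f (\<omega> i) * g (\<omega> j)" for \<omega>
    using I by (subst I2) (auto intro!: prod.neutral)
  then have "avg (PiE I B) (\<lambda>\<omega>. f (\<omega> i) * g (\<omega> j)) = avg (PiE I B) (\<lambda>\<omega>. \<Prod>k\<in>I. ?F k (\<omega> k))"
    by simp
  also have "\<dots> = (\<Prod>k\<in>I. avg (B k) (?F k))" using I B by (intro avg_prod_PiE)
  also have "\<dots> = avg (B i) f * avg (B j) g"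
    using I B by (subst I2) (auto intro!: prod.neutral)
  finally show ?thesis .
qed

lemma avg_PiE_one:
  assumes I: "finite I" "i \<in> I"
    and B: "\<And>i. i \<in> I \<Longrightarrow> finite (B i)" "\<And>i. i \<in> I \<Longrightarrow> B i \<noteq> {}"
  shows "avg (PiE I B) (\<lambda>\<omega>. f (\<omega> i)) = avg (B i) f"
proof -
  let ?F = "\<lambda>k. if k = i then f else (\<lambda>_. 1)"
  have "(\<Prod>k\<in>I. ?F k (\<omega> k)) = f (\<omega> i)" for \<omega>
  proof -
    have "(\<Prod>k\<in>I. ?F k (\<omega> k)) = (\<Prod>k\<in>I. if k = i then f (\<omega> i) else 1)"
      by (intro prod.cong) auto
    then show ?thesis using I by simp
  qed
  then have "avg (PiE I B) (\<lambda>\<omega>. f (\<omega> i)) = avg (PiE I B) (\<lambda>\<omega>. \<Prod>k\<in>I. ?F k (\<omega> k))"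
    by simp
  also have "\<dots> = (\<Prod>k\<in>I. avg (B k) (?F k))" using I B by (intro avg_prod_PiE)
  also have "\<dots> = (\<Prod>k\<in>I. if k = i then avg (B i) f else 1)"
    using B by (intro prod.cong) auto
  also have "\<dots> = avg (B i) f" using I by simp
  finally show ?thesis .
qed

section \<open>Random signs\<close>

definition signs :: "nat \<Rightarrow> (nat \<Rightarrow> real) set" where
  "signs n = PiE {..<n} (\<lambda>_. {-1, 1})"

lemma finite_signs [simp]: "finite (signs n)"
  unfolding signs_def by (intro finite_PiE) auto

lemma signs_nonempty [simp]: "signs n \<noteq> {}"
  unfolding signs_def by (simp add: PiE_eq_empty_iff)

lemma signs_cases: "\<epsilon> \<in> signs n \<Longrightarrow> i < n \<Longrightarrow> \<epsilon> i = -1 \<or> \<epsilon> i = 1"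
  unfolding signs_def by (auto simp: PiE_iff)

lemma signs_square: "\<epsilon> \<in> signs n \<Longrightarrow> i < n \<Longrightarrow> \<epsilon> i * \<epsilon> i = 1"
  using signs_cases[of \<epsilon> n i] by auto

lemma signs_abs: "\<epsilon> \<in> signs n \<Longrightarrow> i < n \<Longrightarrow> \<bar>\<epsilon> i\<bar> = 1"
  using signs_cases[of \<epsilon> n i] by auto

lemma avg_signs_odd:
  assumes i: "i < n" and f: "\<And>\<epsilon>. \<epsilon> \<in> signs n \<Longrightarrow> f (\<epsilon>(i := - \<epsilon> i)) = - f \<epsilon>"
  shows "avg (signs n) f = 0"
proof -
  have flip: "\<epsilon>(i := - \<epsilon> i) \<in> signs n" if "\<epsilon> \<in> signs n" for \<epsilon>
    using that i unfolding signs_def by (auto simp: PiE_iff extensional_def)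
  have "sum f (signs n) = (\<Sum>\<epsilon>\<in>signs n. f (\<epsilon>(i := - \<epsilon> i)))"
    by (rule sum.reindex_bij_witness[of _ "\<lambda>\<epsilon>. \<epsilon>(i := - \<epsilon> i)" "\<lambda>\<epsilon>. \<epsilon>(i := - \<epsilon> i)"])
      (use flip in auto)
  also have "\<dots> = - sum f (signs n)" using f by (simp add: sum_negf)
  finally show ?thesis by (simp add: avg_def)
qed

lemma avg_signs_square_sum:
  assumes I: "I \<subseteq> {..<n}"
  shows "avg (signs n) (\<lambda>\<epsilon>. (\<Sum>i\<in>I. \<epsilon> i * a i)\<^sup>2) = (\<Sum>i\<in>I. (a i)\<^sup>2)"
proof -
  have finI: "finite I" using I finite_subset by blast
  have "avg (signs n) (\<lambda>\<epsilon>. (\<Sum>i\<in>I. \<epsilon> i * a i)\<^sup>2)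
      = avg (signs n) (\<lambda>\<epsilon>. \<Sum>i\<in>I. \<Sum>j\<in>I. a i * a j * (\<epsilon> i * \<epsilon> j))"
    unfolding power2_eq_square sum_product by (intro avg_cong sum.cong) auto
  also have "\<dots> = (\<Sum>i\<in>I. \<Sum>j\<in>I. a i * a j * avg (signs n) (\<lambda>\<epsilon>. \<epsilon> i * \<epsilon> j))"
    by (simp add: avg_sum avg_mult)
  also have "\<dots> = (\<Sum>i\<in>I. \<Sum>j\<in>I. if j = i then (a i)\<^sup>2 else 0)"
  proof (intro sum.cong refl)
    fix i j assume ij: "i \<in> I" "j \<in> I"
    show "a i * a j * avg (signs n) (\<lambda>\<epsilon>. \<epsilon> i * \<epsilon> j) = (if j = i then (a i)\<^sup>2 else 0)"
    proof (cases "j = i")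
      case True
      have "avg (signs n) (\<lambda>\<epsilon>. \<epsilon> i * \<epsilon> i) = avg (signs n) (\<lambda>_. 1)"
        using ij I signs_square by (intro avg_cong) auto
      then show ?thesis using True by (simp add: power2_eq_square)
    next
      case False
      have "avg (signs n) (\<lambda>\<epsilon>. \<epsilon> i * \<epsilon> j) = 0"
        by (rule avg_signs_odd[of i]) (use ij I False in auto)
      then show ?thesis using False by simp
    qed
  qed
  also have "\<dots> = (\<Sum>i\<in>I. (a i)\<^sup>2)" using finI by simp
  finally show ?thesis .
qed

section \<open>Second moment of a sign chaos of order two\<close>

text \<open>Unordered pairs of indices, encoded with the larger index first.\<close>

definition pairs :: "nat \<Rightarrow> (nat \<times> nat) set" where
  "pairs n = Sigma {..<n} (\<lambda>i. {..<i})"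

lemma finite_pairs [simp]: "finite (pairs n)"
  unfolding pairs_def by auto

lemma sum_pairs: "(\<Sum>q\<in>pairs n. f (fst q) (snd q)) = (\<Sum>i<n. \<Sum>j<i. f i j)"
  unfolding pairs_def by (subst sum.Sigma) (auto simp: case_prod_unfold)

lemma sum_split_pairs:
  "(\<Sum>i<n. \<Sum>j<n. G i j) = (\<Sum>i<n. G i i) + (\<Sum>q\<in>pairs n. G (fst q) (snd q) + G (snd q) (fst q))"
  for G :: "nat \<Rightarrow> nat \<Rightarrow> real"
  unfolding sum_pairs[of "\<lambda>i j. G i j + G j i"]
  by (induction n) (auto simp: sum.distrib algebra_simps)

text \<open>The products \<epsilon> i * \<epsilon> j are orthonormal: for two different pairs some
  index occurs exactly once, and flipping its sign negates the product.\<close>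

lemma avg_signs_square_chaos:
  "avg (signs n) (\<lambda>\<epsilon>. (\<Sum>q\<in>pairs n. \<epsilon> (fst q) * \<epsilon> (snd q) * m q)\<^sup>2) = (\<Sum>q\<in>pairs n. (m q)\<^sup>2)"
proof -
  let ?e = "\<lambda>\<epsilon> q. \<epsilon> (fst q) * \<epsilon> (snd q) :: real"
  have "avg (signs n) (\<lambda>\<epsilon>. (\<Sum>q\<in>pairs n. ?e \<epsilon> q * m q)\<^sup>2)
      = avg (signs n) (\<lambda>\<epsilon>. \<Sum>q\<in>pairs n. \<Sum>q'\<in>pairs n. m q * m q' * (?e \<epsilon> q * ?e \<epsilon> q'))"
    unfolding power2_eq_square sum_product by (intro avg_cong sum.cong) auto
  also have "\<dots> = (\<Sum>q\<in>pairs n. \<Sum>q'\<in>pairs n. m q * m q' * avg (signs n) (\<lambda>\<epsilon>. ?e \<epsilon> q * ?e \<epsilon> q'))"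
    by (simp add: avg_sum avg_mult)
  also have "\<dots> = (\<Sum>q\<in>pairs n. \<Sum>q'\<in>pairs n. if q' = q then (m q)\<^sup>2 else 0)"
  proof (intro sum.cong refl)
    fix q q' assume q: "q \<in> pairs n" "q' \<in> pairs n"
    obtain i j k l where ij: "q = (i, j)" "q' = (k, l)" by (metis surj_pair)
    have lt: "j < i" "i < n" "l < k" "k < n" using q by (auto simp: ij pairs_def)
    show "m q * m q' * avg (signs n) (\<lambda>\<epsilon>. ?e \<epsilon> q * ?e \<epsilon> q') = (if q' = q then (m q)\<^sup>2 else 0)"
    proof (cases "q' = q")
      case True
      have "avg (signs n) (\<lambda>\<epsilon>. ?e \<epsilon> q * ?e \<epsilon> q) = avg (signs n) (\<lambda>_. 1)"
      proof (intro avg_cong)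
        fix \<epsilon> assume "\<epsilon> \<in> signs n"
        then have "\<epsilon> i * \<epsilon> i = 1" "\<epsilon> j * \<epsilon> j = 1" using lt by (auto intro!: signs_square[of _ n])
        then have "(\<epsilon> i * \<epsilon> i) * (\<epsilon> j * \<epsilon> j) = 1" by simp
        then show "?e \<epsilon> q * ?e \<epsilon> q = 1" by (simp add: ij ac_simps)
      qed
      then show ?thesis using True by (simp add: power2_eq_square)
    next
      case False
      \<comment> \<open>In each case the sign flipped below belongs to exactly one of the two pairs;
        in the third, j < i = l < k.\<close>
      then consider "i \<noteq> k \<and> i \<noteq> l" | "i = k \<and> j \<noteq> l" | "i = l \<and> k \<noteq> i" using ij lt by auto
      then have "avg (signs n) (\<lambda>\<epsilon>. ?e \<epsilon> q * ?e \<epsilon> q') = 0"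
      proof cases
        case 1
        then show ?thesis by (intro avg_signs_odd[of i]) (use lt in \<open>auto simp: ij\<close>)
      next
        case 2
        then show ?thesis by (intro avg_signs_odd[of j]) (use lt in \<open>auto simp: ij\<close>)
      next
        case 3
        then show ?thesis by (intro avg_signs_odd[of k]) (use lt in \<open>auto simp: ij\<close>)
      qed
      then show ?thesis using False by simp
    qed
  qed
  also have "\<dots> = (\<Sum>q\<in>pairs n. (m q)\<^sup>2)" by simp
  finally show ?thesis .
qed

section \<open>Hashing with random signs\<close>

definition hashes :: "nat \<Rightarrow> nat \<Rightarrow> (nat \<Rightarrow> nat) set" where
  "hashes n r = PiE {..<n} (\<lambda>_. {..<r})"

text \<open>Row b of the hash matrix whose only entry in column i is w i, in row h i. Signs as w
  give a CountSketch, \<open>heavy_weights\<close> the block T.\<close>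

definition sketch :: "nat \<Rightarrow> (nat \<Rightarrow> nat) \<Rightarrow> (nat \<Rightarrow> real) \<Rightarrow> (nat \<Rightarrow> real) \<Rightarrow> nat \<Rightarrow> real" where
  "sketch n h w y b = (\<Sum>i | i < n \<and> h i = b. w i * y i)"

lemma finite_hashes [simp]: "finite (hashes n r)"
  unfolding hashes_def by (intro finite_PiE) auto

lemma hashes_nonempty [simp]: "0 < r \<Longrightarrow> hashes n r \<noteq> {}"
  unfolding hashes_def by (auto simp: PiE_eq_empty_iff)

lemma hashes_less: "h \<in> hashes n r \<Longrightarrow> i < n \<Longrightarrow> h i < r"
  unfolding hashes_def by (auto simp: PiE_iff)

lemma avg_hashes_collision:
  assumes "i < n" "j < n" "i \<noteq> j" "0 < r"
  shows "avg (hashes n r) (\<lambda>h. of_bool (h i = h j)) = 1 / real r"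
proof -
  have one: "avg {..<r} (\<lambda>x. of_bool (x = b)) = 1 / real r" if "b < r" for b
  proof -
    have "(\<Sum>x<r. of_bool (x = b)) = (1 :: real)" using that by simp
    then show ?thesis unfolding avg_def by simp
  qed
  have "avg (hashes n r) (\<lambda>h. of_bool (h i = h j))
      = avg (hashes n r) (\<lambda>h. \<Sum>b<r. of_bool (h i = b) * of_bool (h j = b))"
  proof (intro avg_cong)
    fix h assume "h \<in> hashes n r"
    then have "h i < r" using assms hashes_less by blast
    then have "(\<Sum>b<r. of_bool (h i = b) * of_bool (h j = b)) = (\<Sum>b<r. if b = h i then of_bool (h i = h j) else (0::real))"
      by (intro sum.cong) auto
    also have "\<dots> = of_bool (h i = h j)" using \<open>h i < r\<close> by simp
    finally show "of_bool (h i = h j) = (\<Sum>b<r. of_bool (h i = b) * of_bool (h j = b) :: real)" ..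
  qed
  also have "\<dots> = (\<Sum>b<r. avg {..<r} (\<lambda>x. of_bool (x = b)) * avg {..<r} (\<lambda>x. of_bool (x = b)))"
    unfolding avg_sum hashes_def using assms
    by (intro sum.cong refl avg_PiE_two) auto
  also have "\<dots> = (\<Sum>b<r. 1 / real r * (1 / real r))"
    using one by (intro sum.cong refl) simp
  also have "\<dots> = 1 / real r" using assms by simp
  finally show ?thesis .
qed

lemma sketch_altdef: "sketch n h w y b = (\<Sum>i<n. of_bool (h i = b) * (w i * y i))"
proof -
  have "(\<Sum>i<n. of_bool (h i = b) * (w i * y i)) = (\<Sum>i<n. if h i = b then w i * y i else 0)"
    by (intro sum.cong) auto
  also have "\<dots> = sum (\<lambda>i. w i * y i) {i \<in> {..<n}. h i = b}"
    by (rule sum.inter_filter[symmetric]) simp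
  finally show ?thesis unfolding sketch_def by simp
qed

lemma sketch_add: "sketch n h w (\<lambda>i. y i + y' i) b = sketch n h w y b + sketch n h w y' b"
  unfolding sketch_def by (simp add: sum.distrib algebra_simps)

lemma sketch_cong: "(\<And>i. i < n \<Longrightarrow> y i = y' i) \<Longrightarrow> sketch n h w y b = sketch n h w y' b"
  unfolding sketch_def by (intro sum.cong) auto

lemma sketch_mat_vec:
  "sketch n h w (mat_vec d V z) b = (\<Sum>j<d. sketch n h w (\<lambda>i. V i j) b * z j)"
  unfolding sketch_def mat_vec_def sum_distrib_left sum_distrib_right
  by (subst sum.swap) (intro sum.cong, auto)

lemma sum_buckets:
  assumes "h \<in> hashes n r"
  shows "(\<Sum>b<r. \<Sum>i | i < n \<and> h i = b. f i) = (\<Sum>i<n. f i)"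
proof -
  have "(\<Sum>b<r. \<Sum>i | i \<in> {..<n} \<and> h i = b. f i) = (\<Sum>i<n. f i)"
    using hashes_less[OF assms] by (intro sum.group) auto
  then show ?thesis by simp
qed

lemma sum_sketch_product:
  assumes h: "h \<in> hashes n r"
  shows "(\<Sum>b<r. sketch n h w u b * sketch n h w v b)
    = (\<Sum>i<n. \<Sum>j<n. of_bool (h i = h j) * (w i * u i * (w j * v j)))"
proof -
  have "(\<Sum>b<r. sketch n h w u b * sketch n h w v b)
     = (\<Sum>b<r. \<Sum>i | i < n \<and> h i = b. w i * u i * sketch n h w v (h i))"
    by (subst (1) sketch_def) (simp add: sum_distrib_right)
  also have "\<dots> = (\<Sum>i<n. w i * u i * sketch n h w v (h i))"
    by (rule sum_buckets[OF h])
  also have "\<dots> = (\<Sum>i<n. \<Sum>j<n. of_bool (h i = h j) * (w i * u i * (w j * v j)))"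
    unfolding sketch_altdef sum_distrib_left by (intro sum.cong refl) auto
  finally show ?thesis .
qed

text \<open>The diagonal gives the inner product exactly, since signs square to 1. The rest is a
  chaos over colliding pairs: its second moment is a sum of squared coefficients, each surviving
  with probability 1 / r.\<close>

lemma avg_sketch_inner_deviation:
  assumes r: "0 < r"
  shows "avg (hashes n r) (\<lambda>h. avg (signs n) (\<lambda>\<epsilon>.
      ((\<Sum>b<r. sketch n h \<epsilon> u b * sketch n h \<epsilon> v b) - (\<Sum>i<n. u i * v i))\<^sup>2))
    \<le> 2 / real r * ((\<Sum>i<n. (u i)\<^sup>2) * (\<Sum>i<n. (v i)\<^sup>2))"
proof -
  define m where "m h q = of_bool (h (fst q) = h (snd q))
      * (u (fst q) * v (snd q) + u (snd q) * v (fst q))" for h :: "nat \<Rightarrow> nat" and q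
  have dev: "(\<Sum>b<r. sketch n h \<epsilon> u b * sketch n h \<epsilon> v b) - (\<Sum>i<n. u i * v i)
      = (\<Sum>q\<in>pairs n. \<epsilon> (fst q) * \<epsilon> (snd q) * m h q)"
    if h: "h \<in> hashes n r" and \<epsilon>: "\<epsilon> \<in> signs n" for h \<epsilon>
  proof -
    have "(\<Sum>i<n. of_bool (h i = h i) * (\<epsilon> i * u i * (\<epsilon> i * v i))) = (\<Sum>i<n. u i * v i)"
    proof (intro sum.cong refl)
      fix i assume "i \<in> {..<n}"
      then have "\<epsilon> i * \<epsilon> i = 1" using signs_square[OF \<epsilon>] by simp
      then have "(\<epsilon> i * \<epsilon> i) * (u i * v i) = u i * v i" by simp
      then show "of_bool (h i = h i) * (\<epsilon> i * u i * (\<epsilon> i * v i)) = u i * v i"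
        by (simp add: ac_simps)
    qed
    then show ?thesis
      unfolding sum_sketch_product[OF h] sum_split_pairs[of _ n]
      by (simp, intro sum.cong refl) (auto simp: m_def algebra_simps)
  qed
  have "avg (hashes n r) (\<lambda>h. avg (signs n) (\<lambda>\<epsilon>.
      ((\<Sum>b<r. sketch n h \<epsilon> u b * sketch n h \<epsilon> v b) - (\<Sum>i<n. u i * v i))\<^sup>2))
    = avg (hashes n r) (\<lambda>h. avg (signs n) (\<lambda>\<epsilon>. (\<Sum>q\<in>pairs n. \<epsilon> (fst q) * \<epsilon> (snd q) * m h q)\<^sup>2))"
    by (intro avg_cong arg_cong[where f = power2] dev)
  also have "\<dots> = (\<Sum>q\<in>pairs n. avg (hashes n r) (\<lambda>h. (m h q)\<^sup>2))"
    by (simp add: avg_signs_square_chaos avg_sum)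
  also have "\<dots> = (\<Sum>q\<in>pairs n. (u (fst q) * v (snd q) + u (snd q) * v (fst q))\<^sup>2 / real r)"
  proof (intro sum.cong refl)
    fix q assume q: "q \<in> pairs n"
    have lt: "fst q < n" "snd q < n" "fst q \<noteq> snd q" using q by (auto simp: pairs_def)
    have "avg (hashes n r) (\<lambda>h. (m h q)\<^sup>2)
      = avg (hashes n r) (\<lambda>h. (u (fst q) * v (snd q) + u (snd q) * v (fst q))\<^sup>2 * of_bool (h (fst q) = h (snd q)))"
      by (intro avg_cong) (auto simp: m_def)
    then show "avg (hashes n r) (\<lambda>h. (m h q)\<^sup>2) = (u (fst q) * v (snd q) + u (snd q) * v (fst q))\<^sup>2 / real r"
      using avg_hashes_collision[OF lt r] by (simp add: avg_mult)
  qed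
  also have "\<dots> \<le> (\<Sum>q\<in>pairs n. 2 / real r *
      ((u (fst q))\<^sup>2 * (v (snd q))\<^sup>2 + (u (snd q))\<^sup>2 * (v (fst q))\<^sup>2))"
  proof (intro sum_mono)
    fix q
    have "(a + b)\<^sup>2 \<le> 2 * (a\<^sup>2 + b\<^sup>2)" for a b :: real
      using sum_squares_bound[of a b] by (simp add: power2_sum)
    then have "(u (fst q) * v (snd q) + u (snd q) * v (fst q))\<^sup>2
        \<le> 2 * ((u (fst q))\<^sup>2 * (v (snd q))\<^sup>2 + (u (snd q))\<^sup>2 * (v (fst q))\<^sup>2)"
      by (simp flip: power_mult_distrib)
    from divide_right_mono[OF this, of "real r"]
    show "(u (fst q) * v (snd q) + u (snd q) * v (fst q))\<^sup>2 / real r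
      \<le> 2 / real r * ((u (fst q))\<^sup>2 * (v (snd q))\<^sup>2 + (u (snd q))\<^sup>2 * (v (fst q))\<^sup>2)"
      by simp
  qed
  also have "\<dots> = 2 / real r *
      (\<Sum>q\<in>pairs n. (u (fst q))\<^sup>2 * (v (snd q))\<^sup>2 + (u (snd q))\<^sup>2 * (v (fst q))\<^sup>2)"
    by (simp add: sum_distrib_left)
  also have "\<dots> \<le> 2 / real r * ((\<Sum>i<n. (u i)\<^sup>2) * (\<Sum>i<n. (v i)\<^sup>2))"
  proof (intro mult_left_mono)
    have "0 \<le> (\<Sum>i<n. (u i)\<^sup>2 * (v i)\<^sup>2)" by (intro sum_nonneg) auto
    then show "(\<Sum>q\<in>pairs n. (u (fst q))\<^sup>2 * (v (snd q))\<^sup>2 + (u (snd q))\<^sup>2 * (v (fst q))\<^sup>2)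
      \<le> (\<Sum>i<n. (u i)\<^sup>2) * (\<Sum>i<n. (v i)\<^sup>2)"
      unfolding sum_product sum_split_pairs[of "\<lambda>i j. (u i)\<^sup>2 * (v j)\<^sup>2" n] by linarith
  qed simp
  finally show ?thesis .
qed

section \<open>Euclidean subspace embedding by CountSketch\<close>

definition l2_embeds :: "nat \<Rightarrow> nat \<Rightarrow> nat \<Rightarrow> (nat \<Rightarrow> nat \<Rightarrow> real) \<Rightarrow> (nat \<Rightarrow> nat) \<Rightarrow> (nat \<Rightarrow> real) \<Rightarrow> bool" where
  "l2_embeds r n d A h \<epsilon> \<longleftrightarrow> (\<forall>x.
     \<bar>(\<Sum>b<r. (sketch n h \<epsilon> (mat_vec d A x) b)\<^sup>2) - (\<Sum>i<n. (mat_vec d A x i)\<^sup>2)\<bar>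
       \<le> 1 / 2 * (\<Sum>i<n. (mat_vec d A x i)\<^sup>2))"

text \<open>It is enough that sketching changes the Gram matrix of an orthonormal V by at most 1/2
  in Frobenius norm. Each of the d^2 entries has mean square error at most 2 / r, and Markov at the
  squared threshold 1/4 gives 8 d^2 / r. This is where the d^2 rows come from.\<close>

lemma l2_embedding:
  assumes r: "0 < r"
  shows "avg (hashes n r \<times> signs n) (\<lambda>(h, \<epsilon>). of_bool (\<not> l2_embeds r n d A h \<epsilon>)) \<le> 8 * (real d)\<^sup>2 / real r"
proof -
  have c: "\<forall>i<n. 0 \<le> (1::real)" "\<forall>i<n. \<forall>j<d. A i j \<noteq> 0 \<longrightarrow> 0 < (1::real)" by auto
  obtain V W where
    nrm: "\<And>j. j < d \<Longrightarrow> (\<Sum>i<n. 1 * V i j * V i j) \<in> {0, 1}"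
    and rep: "\<And>x. \<exists>z. (\<forall>i<n. mat_vec d A x i = mat_vec d V z i) \<and>
        (\<Sum>j<d. (z j)\<^sup>2) = (\<Sum>i<n. 1 * (mat_vec d A x i)\<^sup>2)"
    apply (rule orthonormal_basis[OF c])
    subgoal for V W by (rule that[of V]; blast)
    done
  define D where "D h \<epsilon> j k = (\<Sum>b<r. sketch n h \<epsilon> (\<lambda>i. V i j) b * sketch n h \<epsilon> (\<lambda>i. V i k) b)
      - (\<Sum>i<n. V i j * V i k)" for h \<epsilon> j k
  define F where "F h \<epsilon> = (\<Sum>j<d. \<Sum>k<d. (D h \<epsilon> j k)\<^sup>2)" for h \<epsilon>
  have good: "l2_embeds r n d A h \<epsilon>" if F: "F h \<epsilon> \<le> 1 / 4" for h \<epsilon>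
    unfolding l2_embeds_def
  proof
    fix x
    let ?y = "mat_vec d A x"
    obtain z where z: "\<forall>i<n. ?y i = mat_vec d V z i"
      "(\<Sum>j<d. (z j)\<^sup>2) = (\<Sum>i<n. 1 * (?y i)\<^sup>2)" using rep by blast
    define N where "N = (\<Sum>j<d. (z j)\<^sup>2)"
    have N0: "0 \<le> N" unfolding N_def by (intro sum_nonneg) auto
    have dev: "(\<Sum>b<r. (sketch n h \<epsilon> ?y b)\<^sup>2) - (\<Sum>i<n. (?y i)\<^sup>2)
        = (\<Sum>(j, k)\<in>{..<d} \<times> {..<d}. z j * z k * D h \<epsilon> j k)"
    proof -
      have sk: "sketch n h \<epsilon> ?y b = (\<Sum>j<d. sketch n h \<epsilon> (\<lambda>i. V i j) b * z j)" for b
        unfolding sketch_mat_vec[symmetric] using z(1) by (intro sketch_cong) auto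
      have expand: "(\<Sum>b\<in>B. (\<Sum>j<d. f j b * z j)\<^sup>2) = (\<Sum>j<d. \<Sum>k<d. z j * z k * (\<Sum>b\<in>B. f j b * f k b))"
        for B :: "nat set" and f
      proof -
        have "(\<Sum>b\<in>B. (\<Sum>j<d. f j b * z j)\<^sup>2) = (\<Sum>b\<in>B. \<Sum>j<d. \<Sum>k<d. z j * z k * (f j b * f k b))"
          unfolding power2_eq_square sum_product by (intro sum.cong refl) (simp add: ac_simps)
        also have "\<dots> = (\<Sum>j<d. \<Sum>k<d. \<Sum>b\<in>B. z j * z k * (f j b * f k b))"
          by (rule trans[OF sum.swap]) (intro sum.cong refl sum.swap)
        finally show ?thesis by (simp add: sum_distrib_left)
      qed
      have "(\<Sum>i<n. (?y i)\<^sup>2) = (\<Sum>i<n. (\<Sum>j<d. V i j * z j)\<^sup>2)"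
        using z(1) by (intro sum.cong refl) (auto simp: mat_vec_def)
      then show ?thesis
        unfolding sk expand[of "\<lambda>j b. sketch n h \<epsilon> (\<lambda>i. V i j) b"] expand[of "\<lambda>j i. V i j"]
        by (simp add: D_def sum_subtractf right_diff_distrib flip: sum.cartesian_product)
    qed
    have "((\<Sum>b<r. (sketch n h \<epsilon> ?y b)\<^sup>2) - (\<Sum>i<n. (?y i)\<^sup>2))\<^sup>2
        \<le> (\<Sum>(j, k)\<in>{..<d} \<times> {..<d}. (z j * z k)\<^sup>2) * (\<Sum>(j, k)\<in>{..<d} \<times> {..<d}. (D h \<epsilon> j k)\<^sup>2)"
      unfolding dev using Cauchy_Schwarz_ineq_sum[of "\<lambda>(j, k). z j * z k" "\<lambda>(j, k). D h \<epsilon> j k" "{..<d} \<times> {..<d}"]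
      by (simp add: case_prod_unfold)
    also have "(\<Sum>(j, k)\<in>{..<d} \<times> {..<d}. (z j * z k)\<^sup>2) = N * N"
      unfolding N_def sum_product by (simp add: sum.cartesian_product power_mult_distrib)
    also have "(\<Sum>(j, k)\<in>{..<d} \<times> {..<d}. (D h \<epsilon> j k)\<^sup>2) = F h \<epsilon>"
      unfolding F_def by (simp add: sum.cartesian_product)
    also have "N * N * F h \<epsilon> \<le> N * N * (1 / 4)" using F by (intro mult_left_mono) auto
    also have "\<dots> = (1 / 2 * N)\<^sup>2" by (simp add: power2_eq_square)
    finally have "\<bar>(\<Sum>b<r. (sketch n h \<epsilon> ?y b)\<^sup>2) - (\<Sum>i<n. (?y i)\<^sup>2)\<bar> \<le> 1 / 2 * N"
      unfolding abs_le_square_iff[symmetric] using N0 by simp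
    then show "\<bar>(\<Sum>b<r. (sketch n h \<epsilon> ?y b)\<^sup>2) - (\<Sum>i<n. (?y i)\<^sup>2)\<bar> \<le> 1 / 2 * (\<Sum>i<n. (?y i)\<^sup>2)"
      using z(2) by (simp add: N_def)
  qed
  have F0: "0 \<le> F h \<epsilon>" for h \<epsilon> unfolding F_def by (intro sum_nonneg) auto
  have "avg (hashes n r \<times> signs n) (\<lambda>(h, \<epsilon>). of_bool (\<not> l2_embeds r n d A h \<epsilon>))
      \<le> avg (hashes n r \<times> signs n) (\<lambda>s. of_bool (1 / 4 < F (fst s) (snd s)))"
    using good by (intro avg_mono) (force simp: case_prod_unfold not_le[symmetric])
  also have "\<dots> \<le> avg (hashes n r \<times> signs n) (\<lambda>s. F (fst s) (snd s)) / (1 / 4)"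
    using F0 by (intro avg_markov) auto
  also have "avg (hashes n r \<times> signs n) (\<lambda>s. F (fst s) (snd s))
      = (\<Sum>j<d. \<Sum>k<d. avg (hashes n r) (\<lambda>h. avg (signs n) (\<lambda>\<epsilon>. (D h \<epsilon> j k)\<^sup>2)))"
    unfolding avg_Times F_def by (simp add: avg_sum)
  also have "\<dots> \<le> (\<Sum>j<d. \<Sum>k<d. 2 / real r * (1 * 1))"
  proof (intro sum_mono)
    fix j k assume jk: "j \<in> {..<d}" "k \<in> {..<d}"
    have "(\<Sum>i<n. (V i j)\<^sup>2) \<le> 1" "(\<Sum>i<n. (V i k)\<^sup>2) \<le> 1"
      using nrm[of j] nrm[of k] jk by (auto simp: power2_eq_square)
    then have "(\<Sum>i<n. (V i j)\<^sup>2) * (\<Sum>i<n. (V i k)\<^sup>2) \<le> 1 * 1"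
      by (intro mult_mono) (auto intro: sum_nonneg)
    then show "avg (hashes n r) (\<lambda>h. avg (signs n) (\<lambda>\<epsilon>. (D h \<epsilon> j k)\<^sup>2)) \<le> 2 / real r * (1 * 1)"
      unfolding D_def
      by (intro order.trans[OF avg_sketch_inner_deviation[OF r]] mult_left_mono) auto
  qed
  also have "(\<Sum>j<d. \<Sum>k<d. 2 / real r * (1 * 1)) / (1 / 4) = 8 * (real d)\<^sup>2 / real r"
    by (simp add: power2_eq_square)
  finally show ?thesis by simp
qed

section \<open>Growth of p-norms under a CountSketch\<close>

lemma sum_powr_le_card:
  fixes t :: "'a \<Rightarrow> real"
  assumes S: "finite S" and t: "\<And>i. i \<in> S \<Longrightarrow> 0 \<le> t i" and p: "1 \<le> p" "p \<le> 2"
  shows "(\<Sum>i\<in>S. t i) powr p \<le> 4 * real (card S) powr (p - 1) * (\<Sum>i\<in>S. t i powr p)"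
proof (cases "S = {}")
  case False
  let ?c = "real (card S)"
  have c: "0 < ?c" using S False by (simp add: card_gt_0_iff)
  have "avg S (\<lambda>i. (t i powr p) powr (1 / p)) \<le> 2 * avg S (\<lambda>i. t i powr p) powr (1 / p)"
    using S False p by (intro avg_powr_le) auto
  moreover have "avg S (\<lambda>i. (t i powr p) powr (1 / p)) = avg S t"
    using t p by (intro avg_cong) (simp add: powr_powr)
  ultimately have le: "avg S t \<le> 2 * avg S (\<lambda>i. t i powr p) powr (1 / p)" by simp
  have a0: "0 \<le> avg S t" using t by (intro avg_nonneg)
  have a1: "0 \<le> avg S (\<lambda>i. t i powr p)" by (intro avg_nonneg) auto
  have "avg S t powr p \<le> (2 * avg S (\<lambda>i. t i powr p) powr (1 / p)) powr p"
    using le a0 p by (intro powr_mono2) auto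
  also have "\<dots> = 2 powr p * avg S (\<lambda>i. t i powr p)"
    using a1 p by (simp add: powr_mult powr_powr)
  also have "\<dots> \<le> 4 * avg S (\<lambda>i. t i powr p)"
    using powr_mono[of p 2 "2::real"] p a1 by (intro mult_right_mono) auto
  finally have "avg S t powr p \<le> 4 * avg S (\<lambda>i. t i powr p)" .
  then have "sum t S powr p / ?c powr p \<le> 4 * (\<Sum>i\<in>S. t i powr p) / ?c"
    using t c by (simp add: avg_def powr_divide sum_nonneg)
  then have "sum t S powr p \<le> 4 * (\<Sum>i\<in>S. t i powr p) / ?c * ?c powr p"
    using c by (simp add: field_simps)
  also have "\<dots> = 4 * ?c powr (p - 1) * (\<Sum>i\<in>S. t i powr p)"
    using c by (simp add: powr_diff)
  finally show ?thesis .
qed simp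

lemma npow_le_sum_squares:
  assumes r: "0 < r" and p: "0 < p" "p \<le> 2"
  shows "npow p r z \<le> 2 * real r powr (1 - p / 2) * (\<Sum>b<r. (z b)\<^sup>2) powr (p / 2)"
proof -
  have "avg {..<r} (\<lambda>b. (z b)\<^sup>2 powr (p / 2)) \<le> 2 * avg {..<r} (\<lambda>b. (z b)\<^sup>2) powr (p / 2)"
    using r p by (intro avg_powr_le) auto
  then have "npow p r z / real r \<le> 2 * ((\<Sum>b<r. (z b)\<^sup>2) powr (p / 2) / real r powr (p / 2))"
    by (simp add: avg_def power2_powr_half npow_def powr_divide sum_nonneg)
  then have "npow p r z \<le> 2 * ((\<Sum>b<r. (z b)\<^sup>2) powr (p / 2) / real r powr (p / 2)) * real r"
    using r by (simp add: field_simps)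
  also have "\<dots> = 2 * real r powr (1 - p / 2) * (\<Sum>b<r. (z b)\<^sup>2) powr (p / 2)"
    using r by (simp add: powr_diff)
  finally show ?thesis .
qed

text \<open>Coordinates in \<open>H\<close> are controlled by the number of them in a bucket, the remaining small ones
  by the \<open>l2\<close> norm of their sketch.\<close>

lemma npow_sketch_signs_le:
  assumes h: "h \<in> hashes n r" and \<epsilon>: "\<epsilon> \<in> signs n" and r: "0 < r" and p: "1 \<le> p" "p < 2"
    and k: "0 < k" and H: "finite H" "real (card H) \<le> m"
    and light: "\<And>i. i < n \<Longrightarrow> i \<notin> H \<Longrightarrow> \<bar>y i\<bar> powr p \<le> npow p n y / k"
    and l2: "(\<Sum>b<r. (sketch n h \<epsilon> (\<lambda>i. if i \<in> H then 0 else y i) b)\<^sup>2)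
        \<le> 2 * (\<Sum>i<n. (if i \<in> H then 0 else y i)\<^sup>2)"
  shows "npow p r (sketch n h \<epsilon> y) \<le> 16 * (m powr (p - 1) + (real r / k) powr (1 - p / 2)) * npow p n y"
proof -
  let ?Y = "npow p n y"
  let ?h = "\<lambda>i. if i \<in> H then y i else 0" and ?l = "\<lambda>i. if i \<in> H then 0 else y i"
  have split: "sketch n h \<epsilon> y b = sketch n h \<epsilon> ?h b + sketch n h \<epsilon> ?l b" for b
    unfolding sketch_add[symmetric] by (intro sketch_cong) auto
  have m0: "0 \<le> m" using H(2) by linarith
  have "\<bar>sketch n h \<epsilon> ?h b\<bar> powr p \<le> 4 * m powr (p - 1) * (\<Sum>i | i < n \<and> h i = b. \<bar>y i\<bar> powr p)" for b
  proof -
    let ?S = "{i. i < n \<and> h i = b}"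
    have fin: "finite ?S" by auto
    have "\<bar>sketch n h \<epsilon> ?h b\<bar> \<le> (\<Sum>i\<in>?S. \<bar>\<epsilon> i * ?h i\<bar>)"
      unfolding sketch_def by (rule sum_abs)
    also have "\<dots> = (\<Sum>i\<in>?S. if i \<in> H then \<bar>y i\<bar> else 0)"
      using signs_abs[OF \<epsilon>] by (intro sum.cong) (auto simp: abs_mult)
    also have "\<dots> = (\<Sum>i\<in>?S \<inter> H. \<bar>y i\<bar>)"
      using fin by (simp add: sum.inter_restrict)
    finally have "\<bar>sketch n h \<epsilon> ?h b\<bar> powr p \<le> (\<Sum>i\<in>?S \<inter> H. \<bar>y i\<bar>) powr p"
      using p by (intro powr_mono2) auto
    also have "\<dots> \<le> 4 * real (card (?S \<inter> H)) powr (p - 1) * (\<Sum>i\<in>?S \<inter> H. \<bar>y i\<bar> powr p)"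
      using p H by (intro sum_powr_le_card) auto
    also have "\<dots> \<le> 4 * m powr (p - 1) * (\<Sum>i\<in>?S. \<bar>y i\<bar> powr p)"
    proof (intro mult_mono powr_mono2 sum_mono2 sum_nonneg fin)
      \<comment> \<open>All of H may share one bucket; this crude count is affordable in the range
        of p where heavy rows are used.\<close>
      have "card (?S \<inter> H) \<le> card H" using H by (intro card_mono) auto
      then show "real (card (?S \<inter> H)) \<le> m" using H by linarith
    qed (use p m0 in auto)
    finally show ?thesis .
  qed
  then have "npow p r (sketch n h \<epsilon> ?h) \<le> (\<Sum>b<r. 4 * m powr (p - 1) * (\<Sum>i | i < n \<and> h i = b. \<bar>y i\<bar> powr p))"
    unfolding npow_def by (intro sum_mono)
  also have "\<dots> = 4 * m powr (p - 1) * ?Y"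
    using sum_buckets[OF h, of "\<lambda>i. \<bar>y i\<bar> powr p"] by (simp add: npow_def flip: sum_distrib_left)
  finally have heavy: "npow p r (sketch n h \<epsilon> ?h) \<le> 4 * m powr (p - 1) * ?Y" .
  have Y0: "0 \<le> ?Y" by simp
  \<comment> \<open>For a light coordinate the square is
    \<open>\<bar>y i\<bar> powr p * \<bar>y i\<bar> powr (2 - p)\<close>, and lightness bounds the
    second factor.\<close>
  have "(\<Sum>i<n. (?l i)\<^sup>2) \<le> (\<Sum>i<n. \<bar>y i\<bar> powr p * (?Y / k) powr ((2 - p) / p))"
  proof (intro sum_mono)
    fix i assume i: "i \<in> {..<n}"
    show "(?l i)\<^sup>2 \<le> \<bar>y i\<bar> powr p * (?Y / k) powr ((2 - p) / p)"
    proof (cases "i \<in> H \<or> y i = 0")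
      case False
      have "(\<bar>y i\<bar> powr p) powr ((2 - p) / p) \<le> (?Y / k) powr ((2 - p) / p)"
        using light[of i] i False p by (intro powr_mono2) auto
      then have "\<bar>y i\<bar> powr (2 - p) \<le> (?Y / k) powr ((2 - p) / p)"
        using p by (simp add: powr_powr)
      then have "\<bar>y i\<bar> powr p * \<bar>y i\<bar> powr (2 - p) \<le> \<bar>y i\<bar> powr p * (?Y / k) powr ((2 - p) / p)"
        by (intro mult_left_mono) auto
      then show ?thesis using False by (simp flip: powr_add)
    qed auto
  qed
  also have "\<dots> = ?Y * (?Y / k) powr ((2 - p) / p)" by (simp add: npow_def sum_distrib_right)
  finally have lsq: "(\<Sum>i<n. (?l i)\<^sup>2) \<le> ?Y * (?Y / k) powr ((2 - p) / p)" .
  have "npow p r (sketch n h \<epsilon> ?l)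
      \<le> 2 * real r powr (1 - p / 2) * (\<Sum>b<r. (sketch n h \<epsilon> ?l b)\<^sup>2) powr (p / 2)"
    using r p by (intro npow_le_sum_squares) auto
  also have "\<dots> \<le> 2 * real r powr (1 - p / 2) * (2 * (?Y * (?Y / k) powr ((2 - p) / p))) powr (p / 2)"
  proof (intro mult_left_mono powr_mono2)
    show "(\<Sum>b<r. (sketch n h \<epsilon> ?l b)\<^sup>2) \<le> 2 * (?Y * (?Y / k) powr ((2 - p) / p))"
      using l2 lsq by linarith
  qed (use p in \<open>auto intro!: sum_nonneg\<close>)
  also have "\<dots> = 2 * 2 powr (p / 2) * (real r / k) powr (1 - p / 2) * ?Y"
  proof -
    have "(2 - p) / p * (p / 2) = 1 - p / 2" using p by (simp add: field_simps)
    then have W: "((?Y / k) powr ((2 - p) / p)) powr (p / 2) = ?Y powr (1 - p / 2) / k powr (1 - p / 2)"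
      using k by (simp only: powr_powr) (simp add: powr_divide)
    have YY: "?Y powr (p / 2) * ?Y powr (1 - p / 2) = ?Y"
      using Y0 by (cases "?Y = 0") (auto simp flip: powr_add)
    have "(2 * (?Y * (?Y / k) powr ((2 - p) / p))) powr (p / 2)
        = 2 powr (p / 2) * ((?Y powr (p / 2) * ?Y powr (1 - p / 2)) / k powr (1 - p / 2))"
      using Y0 k by (simp add: powr_mult W del: powr_powr)
    then show ?thesis unfolding YY using k by (simp add: powr_divide)
  qed
  also have "\<dots> \<le> 2 * 2 * (real r / k) powr (1 - p / 2) * ?Y"
    using powr_mono[of "p / 2" 1 "2::real"] p by (intro mult_right_mono) auto
  finally have "npow p r (sketch n h \<epsilon> ?l) \<le> 4 * (real r / k) powr (1 - p / 2) * ?Y" by simp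
  moreover have "npow p r (sketch n h \<epsilon> y) \<le> 4 * (npow p r (sketch n h \<epsilon> ?h) + npow p r (sketch n h \<epsilon> ?l))"
    using npow_add_le[of p r "sketch n h \<epsilon> ?h" "sketch n h \<epsilon> ?l"] p split
    by (simp add: npow_cong[of r "sketch n h \<epsilon> y" "\<lambda>b. sketch n h \<epsilon> ?h b + sketch n h \<epsilon> ?l b"])
  ultimately show ?thesis using heavy by (simp add: algebra_simps)
qed

section \<open>Heavy-tailed levels\<close>

text \<open>For \<open>u\<close> uniform on \<open>{1..N}\<close> the variable \<open>N / u\<close> has tail probabilities close to \<open>1 / t\<close>.\<close>

lemma powr_telescope_bound:
  fixes q :: real
  assumes q: "1 < q" and u: "0 < u"
  shows "real u powr (- q) \<le> 2 powr q / (q - 1) * (real u powr (1 - q) - real (Suc u) powr (1 - q))"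
proof -
  have "\<exists>\<xi>. real u < \<xi> \<and> \<xi> < real (Suc u) \<and>
      real (Suc u) powr (1 - q) - real u powr (1 - q) = (real (Suc u) - real u) * ((1 - q) * \<xi> powr (1 - q - 1))"
    by (rule MVT2) (use u in \<open>auto intro!: derivative_eq_intros\<close>)
  then obtain \<xi> where \<xi>: "real u < \<xi>" "\<xi> < real (Suc u)"
    "real (Suc u) powr (1 - q) - real u powr (1 - q) = (1 - q) * \<xi> powr (- q)" by auto
  have "(2 * real u) powr (- q) \<le> \<xi> powr (- q)"
    using \<xi> u q by (intro powr_mono2') auto
  then have "real u powr (- q) \<le> 2 powr q * \<xi> powr (- q)"
    using u by (simp add: powr_mult powr_minus field_simps)
  also have "\<dots> = 2 powr q / (q - 1) * ((q - 1) * \<xi> powr (- q))" using q by simp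
  also have "(q - 1) * \<xi> powr (- q) = real u powr (1 - q) - real (Suc u) powr (1 - q)"
    using \<xi>(3) by (simp add: algebra_simps)
  finally show ?thesis .
qed

lemma sum_powr_tail_le:
  fixes q :: real
  assumes q: "1 < q" and m: "0 < m"
  shows "(\<Sum>u\<in>{m..<m + l}. real u powr (- q)) \<le> 2 powr q / (q - 1) * real m powr (1 - q)"
proof -
  have "(\<Sum>u\<in>{m..<m + l}. real u powr (- q))
      \<le> 2 powr q / (q - 1) * (real m powr (1 - q) - real (m + l) powr (1 - q))"
  proof (induction l)
    case (Suc l)
    have "(\<Sum>u\<in>{m..<m + Suc l}. real u powr (- q)) = (\<Sum>u\<in>{m..<m + l}. real u powr (- q)) + real (m + l) powr (- q)"
      by simp
    also have "\<dots> \<le> 2 powr q / (q - 1) * (real m powr (1 - q) - real (m + l) powr (1 - q))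
        + 2 powr q / (q - 1) * (real (m + l) powr (1 - q) - real (Suc (m + l)) powr (1 - q))"
      using q m by (intro add_mono Suc.IH powr_telescope_bound) auto
    finally show ?case by (simp add: right_diff_distrib)
  qed simp
  also have "\<dots> \<le> 2 powr q / (q - 1) * real m powr (1 - q)"
    using q by (intro mult_left_mono) auto
  finally show ?thesis .
qed

text \<open>With tail 1 / t and q > 1 the truncated moment is dominated by values near the
  truncation. Only u \<ge> N / t contribute, which is the tail of a convergent sum, so the bound
  does not depend on N.\<close>

lemma avg_level_moment:
  fixes q t :: real
  assumes q: "1 < q" and t: "0 < t" and N: "0 < N"
  shows "avg {1..N} (\<lambda>u. if real N / real u \<le> t then (real N / real u) powr q else 0)
    \<le> 2 powr q / (q - 1) * t powr (q - 1)"
proof -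
  define m where "m = max 1 (nat \<lceil>real N / t\<rceil>)"
  have m: "0 < m" "real N / t \<le> real m" unfolding m_def by linarith+
  have "(\<Sum>u\<in>{1..N}. if real N / real u \<le> t then (real N / real u) powr q else 0)
      = (\<Sum>u\<in>{u \<in> {1..N}. real N / real u \<le> t}. real N powr q * real u powr (- q))"
    unfolding sum.inter_filter[OF finite_atLeastAtMost, symmetric]
    by (intro sum.cong) (auto simp: powr_divide powr_minus_divide)
  also have "\<dots> \<le> (\<Sum>u\<in>{m..<m + (N + 1)}. real N powr q * real u powr (- q))"
  proof (intro sum_mono2 subsetI)
    fix u assume "u \<in> {u. u \<in> {1..N} \<and> real N / real u \<le> t}"
    then have u: "1 \<le> u" "u \<le> N" "real N / t \<le> real u" using t by (auto simp: field_simps)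
    then have "m \<le> u" unfolding m_def by (simp add: nat_le_iff ceiling_le_iff)
    then show "u \<in> {m..<m + (N + 1)}" using u by auto
  qed auto
  also have "\<dots> \<le> real N powr q * (2 powr q / (q - 1) * real m powr (1 - q))"
    unfolding sum_distrib_left[symmetric] by (intro mult_left_mono sum_powr_tail_le q m(1)) auto
  also have "\<dots> \<le> real N powr q * (2 powr q / (q - 1) * (real N / t) powr (1 - q))"
    using q m N t by (intro mult_left_mono powr_mono2') auto
  also have "\<dots> = real N * (2 powr q / (q - 1) * t powr (q - 1))"
  proof -
    have "real N powr q * (real N / t) powr (1 - q) = (real N powr q * real N powr (1 - q)) / t powr (1 - q)"
      using t by (simp add: powr_divide)
    also have "\<dots> = real N * t powr (q - 1)"
      using N powr_minus_divide[of t "1 - q"] by (simp flip: powr_add)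
    finally show ?thesis by (simp add: ac_simps)
  qed
  finally show ?thesis using N by (simp add: avg_def field_simps)
qed

lemma harmonic_sum_le:
  assumes m: "0 < m"
  shows "(\<Sum>u\<in>{m..m + l}. 1 / real u) \<le> 1 / real m + ln (real (m + l) / real m)"
proof (induction l)
  case (Suc l)
  have pos: "0 < real (m + l)" using m by simp
  have "ln (real (m + l) / real (m + Suc l)) \<le> real (m + l) / real (m + Suc l) - 1"
    using pos by (intro ln_le_minus_one) auto
  also have "\<dots> = - (1 / real (m + Suc l))" using m by (simp add: field_simps)
  finally have "1 / real (m + Suc l) \<le> ln (real (m + Suc l)) - ln (real (m + l))"
    using m by (simp add: ln_div)
  then show ?case using Suc.IH m by (simp add: ln_div)
qed (use m in simp)

text \<open>The borderline first moment: all scales between s and t contribute alike, hence a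
  logarithm. The contributing u lie between N / t and N / s, so their harmonic sum is at most ln (t
  / s) plus its first term, which is at most 1.\<close>

lemma avg_level_log:
  fixes s t :: real
  assumes s: "0 < s" "s \<le> t" and N: "0 < N"
  shows "avg {1..N} (\<lambda>u. if s < real N / real u \<and> real N / real u \<le> t then real N / real u else 0)
    \<le> 1 + ln (t / s)"
proof -
  let ?U = "{u \<in> {1..N}. s < real N / real u \<and> real N / real u \<le> t}"
  have ln0: "0 \<le> ln (t / s)" using s by simp
  have "(\<Sum>u\<in>?U. 1 / real u) \<le> 1 + ln (t / s)"
  proof (cases "?U = {}")
    case True
    show ?thesis unfolding True using ln0 by simp
  next
    case False
    have fin: "finite ?U" by simp
    define m M where "m = Min ?U" and "M = Max ?U"
    have mU: "m \<in> ?U" and MU: "M \<in> ?U" unfolding m_def M_def using fin False by (intro Min_in Max_in; simp)+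
    have sub: "?U \<subseteq> {m..m + (M - m)}" 
    proof
      fix u assume "u \<in> ?U"
      then have "m \<le> u" "u \<le> M" unfolding m_def M_def using fin by (intro Min_le Max_ge; simp)+
      then show "u \<in> {m..m + (M - m)}" by auto
    qed
    have mM: "m \<le> M" using MU sub by auto
    have m0: "0 < m" using mU by auto
    have "(\<Sum>u\<in>?U. 1 / real u) \<le> (\<Sum>u\<in>{m..m + (M - m)}. 1 / real u)"
      using sub by (intro sum_mono2) auto
    also have "\<dots> \<le> 1 / real m + ln (real (m + (M - m)) / real m)" by (rule harmonic_sum_le[OF m0])
    also have "\<dots> \<le> 1 + ln (t / s)"
    proof (intro add_mono)
      have "real M \<le> real N / s" "real N / t \<le> real m"
        using mU MU s m0 mM by (auto simp: field_simps)
      then have "real M / real m \<le> (real N / s) / (real N / t)"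
        using N s m0 by (intro frac_le) auto
      also have "\<dots> = t / s" using N s by (simp add: field_simps)
      finally show "ln (real (m + (M - m)) / real m) \<le> ln (t / s)"
        using mM m0 s by (subst ln_le_cancel_iff) auto
    qed (use m0 in auto)
    finally show ?thesis .
  qed
  moreover have "avg {1..N} (\<lambda>u. if s < real N / real u \<and> real N / real u \<le> t then real N / real u else 0)
    = (\<Sum>u\<in>?U. 1 / real u)"
  proof -
    have "(\<Sum>u\<in>{1..N}. if s < real N / real u \<and> real N / real u \<le> t then real N / real u else 0)
        = (\<Sum>u\<in>?U. real N / real u)"
      by (rule sum.inter_filter[symmetric]) simp
    also have "\<dots> = real N * (\<Sum>u\<in>?U. 1 / real u)"
      unfolding sum_distrib_left by simp
    finally show ?thesis using N unfolding avg_def by simp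
  qed
  ultimately show ?thesis by simp
qed

lemma avg_level_tail_le:
  fixes a t :: real
  assumes "0 \<le> a" "0 < t" "0 < N"
  shows "avg {1..N} (\<lambda>u. of_bool (t < real N / real u * a)) \<le> a / t"
proof -
  have "card {u \<in> {1..N}. t < real N / real u * a} \<le> card {1..nat \<lfloor>real N * a / t\<rfloor>}"
  proof (intro card_mono subsetI)
    fix u assume "u \<in> {u \<in> {1..N}. t < real N / real u * a}"
    then have "real u \<le> real N * a / t" "1 \<le> u" using assms by (auto simp: field_simps)
    then show "u \<in> {1..nat \<lfloor>real N * a / t\<rfloor>}" by (simp add: le_nat_floor)
  qed simp
  then have "real (card {u \<in> {1..N}. t < real N / real u * a}) \<le> real (nat \<lfloor>real N * a / t\<rfloor>)" by simp
  also have "\<dots> \<le> real N * a / t" using assms by simp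
  finally have "real (card {u \<in> {1..N}. t < real N / real u * a}) / real N \<le> a / t"
    using assms by (simp add: field_simps)
  then show ?thesis by (simp add: avg_def Int_def)
qed

text \<open>Rounding to whole levels costs 1 / N for one coordinate and so n / N over all
  coordinates.\<close>

lemma avg_level_tail_ge:
  fixes a :: real
  assumes "0 \<le> a" "0 < N"
  shows "min 1 a - 1 / real N \<le> avg {1..N} (\<lambda>u. of_bool (1 \<le> real N / real u * a))"
proof -
  have "card {1..min N (nat \<lfloor>real N * a\<rfloor>)} \<le> card {u \<in> {1..N}. 1 \<le> real N / real u * a}"
  proof (intro card_mono subsetI)
    fix u assume "u \<in> {1..min N (nat \<lfloor>real N * a\<rfloor>)}"
    then have u: "1 \<le> u" "u \<le> N" "int u \<le> \<lfloor>real N * a\<rfloor>" by auto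
    then have "real u \<le> real N * a" by linarith
    then show "u \<in> {u \<in> {1..N}. 1 \<le> real N / real u * a}" using u by (auto simp: field_simps)
  qed simp
  then have "real (min N (nat \<lfloor>real N * a\<rfloor>)) \<le> real (card {u \<in> {1..N}. 1 \<le> real N / real u * a})" by simp
  moreover have "real N * min 1 a - 1 \<le> real (min N (nat \<lfloor>real N * a\<rfloor>))"
  proof (cases "1 \<le> a")
    case True
    then have "real N \<le> real N * a" using assms by (simp add: mult_le_cancel_left1)
    then have "N \<le> nat \<lfloor>real N * a\<rfloor>" by (simp add: le_nat_floor)
    then show ?thesis using True by simp
  next
    case False
    have "real N * a - 1 \<le> real (nat \<lfloor>real N * a\<rfloor>)" by linarith
    moreover have "real N * a \<le> real N" using False assms by (simp add: mult_le_cancel_left2)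
    ultimately show ?thesis using False by (auto simp: min_def)
  qed
  ultimately have "real N * min 1 a - 1 \<le> real (card {u \<in> {1..N}. 1 \<le> real N / real u * a})" by linarith
  from divide_right_mono[OF this, of "real N"]
  have "min 1 a - 1 / real N \<le> real (card {u \<in> {1..N}. 1 \<le> real N / real u * a}) / real N"
    using assms by (simp add: diff_divide_distrib)
  then show ?thesis unfolding avg_def
    by (simp only: sum_of_bool_eq finite_atLeastAtMost Int_def mem_Collect_eq card_atLeastAtMost) simp
qed

section \<open>Hashing with heavy-tailed weights\<close>

definition levels :: "nat \<Rightarrow> nat \<Rightarrow> (nat \<Rightarrow> nat) set" where
  "levels n N = PiE {..<n} (\<lambda>_. {1..N})"

text \<open>The p-th power of the modulus is N / u, with tail about 1 / t; hence the weight itself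
  has tail about \<open>t powr (- p)\<close>.\<close>

definition heavy_weights :: "real \<Rightarrow> nat \<Rightarrow> (nat \<Rightarrow> real) \<Rightarrow> (nat \<Rightarrow> nat) \<Rightarrow> nat \<Rightarrow> real" where
  "heavy_weights p N \<epsilon> u i = \<epsilon> i * (real N / real (u i)) powr (1 / p)"

text \<open>Sum of the p-th powers of the Euclidean norms of the rows of T V. By Cauchy--Schwarz in
  every bucket it controls T V z for all z at once, so one scalar event governs the dilation on the
  whole subspace.\<close>

definition frame_pow :: "real \<Rightarrow> nat \<Rightarrow> nat \<Rightarrow> nat \<Rightarrow> (nat \<Rightarrow> nat \<Rightarrow> real) \<Rightarrow> (nat \<Rightarrow> nat) \<Rightarrow> (nat \<Rightarrow> real) \<Rightarrow> real" where
  "frame_pow p r n d V h w = (\<Sum>b<r. row_norm d (\<lambda>b j. sketch n h w (\<lambda>i. V i j) b) b powr p)"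

lemma finite_levels [simp]: "finite (levels n N)"
  unfolding levels_def by (intro finite_PiE) auto

lemma levels_nonempty [simp]: "0 < N \<Longrightarrow> levels n N \<noteq> {}"
  unfolding levels_def by (auto simp: PiE_eq_empty_iff)

lemma avg_levels_coord: "i < n \<Longrightarrow> 0 < N \<Longrightarrow> avg (levels n N) (\<lambda>u. f (u i)) = avg {1..N} f"
  unfolding levels_def by (subst avg_PiE_one) auto

lemma npow_sketch_le_frame_pow:
  assumes p: "0 < p"
  shows "npow p r (sketch n h w (mat_vec d V z)) \<le> sqrt (\<Sum>j<d. (z j)\<^sup>2) powr p * frame_pow p r n d V h w"
proof -
  let ?U = "\<lambda>b j. sketch n h w (\<lambda>i. V i j) b"
  have eq: "sketch n h w (mat_vec d V z) b = mat_vec d ?U z b" for b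
    unfolding sketch_mat_vec by (simp add: mat_vec_def)
  have "\<bar>mat_vec d ?U z b\<bar> powr p \<le> (row_norm d ?U b * sqrt (\<Sum>j<d. (z j)\<^sup>2)) powr p" for b
    using p abs_mat_vec_le by (intro powr_mono2) auto
  then have "npow p r (sketch n h w (mat_vec d V z)) \<le> (\<Sum>b<r. (row_norm d ?U b * sqrt (\<Sum>j<d. (z j)\<^sup>2)) powr p)"
    unfolding npow_def eq by (intro sum_mono)
  also have "\<dots> = sqrt (\<Sum>j<d. (z j)\<^sup>2) powr p * frame_pow p r n d V h w"
    unfolding frame_pow_def sum_distrib_left
    by (intro sum.cong) (auto simp: powr_mult sum_nonneg)
  finally show ?thesis .
qed

lemma frame_pow_cong:
  "(\<And>i. i < n \<Longrightarrow> w i = w' i) \<Longrightarrow> frame_pow p r n d V h w = frame_pow p r n d V h w'"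
  unfolding frame_pow_def row_norm_def sketch_def
  by (intro sum.cong refl arg_cong[where f = "\<lambda>x. sqrt x powr p"] arg_cong[where f = power2]) auto

text \<open>Jensen for the power p / 2 brings the sign average inside, where orthogonality of the
  signs removes the cross terms.\<close>

lemma avg_frame_pow_signs_le:
  assumes p: "0 < p" "p \<le> 2"
  shows "avg (signs n) (\<lambda>\<epsilon>. frame_pow p r n d V h (\<lambda>i. \<epsilon> i * x i))
    \<le> (\<Sum>b<r. 2 * (\<Sum>i | i < n \<and> h i = b. (x i * row_norm d V i)\<^sup>2) powr (p / 2))"
proof -
  have "avg (signs n) (\<lambda>\<epsilon>. row_norm d (\<lambda>b j. sketch n h (\<lambda>i. \<epsilon> i * x i) (\<lambda>i. V i j) b) b powr p)
      \<le> 2 * (\<Sum>i | i < n \<and> h i = b. (x i * row_norm d V i)\<^sup>2) powr (p / 2)" for b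
  proof -
    let ?S = "{i. i < n \<and> h i = b}"
    let ?f = "\<lambda>\<epsilon>. \<Sum>j<d. (\<Sum>i\<in>?S. \<epsilon> i * (x i * V i j))\<^sup>2"
    have f0: "0 \<le> ?f \<epsilon>" for \<epsilon> by (intro sum_nonneg) auto
    have "row_norm d (\<lambda>b j. sketch n h (\<lambda>i. \<epsilon> i * x i) (\<lambda>i. V i j) b) b powr p = ?f \<epsilon> powr (p / 2)" for \<epsilon>
      using f0[of \<epsilon>]
      unfolding row_norm_def sketch_def by (simp add: powr_half_sqrt[symmetric] powr_powr mult.assoc)
    then have "avg (signs n) (\<lambda>\<epsilon>. row_norm d (\<lambda>b j. sketch n h (\<lambda>i. \<epsilon> i * x i) (\<lambda>i. V i j) b) b powr p)
        = avg (signs n) (\<lambda>\<epsilon>. ?f \<epsilon> powr (p / 2))" by simp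
    also have "\<dots> \<le> 2 * avg (signs n) ?f powr (p / 2)"
      using f0 p by (intro avg_powr_le) auto
    also have "avg (signs n) ?f = (\<Sum>j<d. \<Sum>i\<in>?S. (x i * V i j)\<^sup>2)"
      unfolding avg_sum by (intro sum.cong refl avg_signs_square_sum) auto
    also have "\<dots> = (\<Sum>i\<in>?S. (x i * row_norm d V i)\<^sup>2)"
      unfolding power_mult_distrib row_norm_power2 sum_distrib_left by (rule sum.swap)
    finally show ?thesis .
  qed
  then show ?thesis unfolding frame_pow_def avg_sum by (intro sum_mono)
qed

text \<open>The weighted row i has p-th power s i = N / u i * \<rho> i, with tail about \<rho> i /
  t. Values above T are excluded by a union bound at cost D / T. Values between \<tau> and T enter
  by first moments, \<rho> i * (1 + ln (T / \<tau>)). Below \<tau> the moment of order 2 / p gives C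
  * \<rho> i, plus an additive \<tau> per bucket. First moments alone would produce a logarithm
  depending on n, because \<rho> i may be tiny.\<close>

lemma heavy_frame_pow_le:
  fixes p :: real
  assumes p: "1 \<le> p" "p < 2" and r: "0 < r" and N: "0 < N"
    and \<tau>: "0 < \<tau>" "\<tau> \<le> T" and L: "0 < L"
    and D: "(\<Sum>i<n. row_norm d V i powr p) \<le> D"
  shows "avg (hashes n r) (\<lambda>h. avg (signs n) (\<lambda>\<epsilon>. avg (levels n N) (\<lambda>u.
      of_bool (L < frame_pow p r n d V h (heavy_weights p N \<epsilon> u)))))
    \<le> D / T + 2 * (real r * \<tau> + D * (2 powr (2 / p) / (2 / p - 1) + 1 + ln (T / \<tau>))) / L"
proof -
  define q where "q = 2 / p"
  define C where "C = 2 powr q / (q - 1)"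
  define \<rho> where "\<rho> i = row_norm d V i powr p" for i
  define s where "s u i = real N / real (u i) * \<rho> i" for u :: "nat \<Rightarrow> nat" and i
  define x where "x u i = (if s u i \<le> T then (real N / real (u i)) powr (1 / p) else 0)" for u :: "nat \<Rightarrow> nat" and i
  \<comment> \<open>Majorant for the share of row i in the p-th power of its bucket: squares of
    weighted rows below \<tau>, p-th powers up to T, and zero beyond, where x cuts the weight
    off.\<close>
  define g where "g i v = (let s = real N / real v * \<rho> i in
      if s \<le> \<tau> then \<tau> powr (1 - q) * s powr q else if s \<le> T then s else 0)" for i and v :: nat
  define F where "F h \<epsilon> u = frame_pow p r n d V h (\<lambda>i. \<epsilon> i * x u i)" for h \<epsilon> u
  define E where "E = real r * \<tau> + D * (C + 1 + ln (T / \<tau>))"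
  have q1: "1 < q" using p by (simp add: q_def)
  have \<rho>0: "0 \<le> \<rho> i" for i by (simp add: \<rho>_def)
  have s0: "0 \<le> s u i" for u i using \<rho>0 by (simp add: s_def)
  have T: "0 < T" using \<tau> by simp
  have C0: "0 \<le> C" using q1 by (simp add: C_def)
  have ln0: "0 \<le> ln (T / \<tau>)" using \<tau> by simp

  have g_avg: "avg {1..N} (g i) \<le> \<rho> i * (C + 1 + ln (T / \<tau>))" for i
  proof (cases "\<rho> i = 0")
    case True
    then have "avg {1..N} (g i) = avg {1..N} (\<lambda>_. 0)"
      using \<tau> by (intro avg_cong) (simp add: g_def)
    then show ?thesis using True N by simp
  next
    case False
    then have a: "0 < \<rho> i" using \<rho>0[of i] by linarith
    have "avg {1..N} (g i) \<le> avg {1..N} (\<lambda>v.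
        \<tau> powr (1 - q) * \<rho> i powr q * (if real N / real v \<le> \<tau> / \<rho> i then (real N / real v) powr q else 0)
        + \<rho> i * (if \<tau> / \<rho> i < real N / real v \<and> real N / real v \<le> T / \<rho> i then real N / real v else 0))"
    proof (intro avg_mono)
      fix v assume "v \<in> {1..N}"
      have iff: "real N / real v * \<rho> i \<le> t \<longleftrightarrow> real N / real v \<le> t / \<rho> i" for t
        using a by (simp add: pos_le_divide_eq)
      show "g i v \<le> \<tau> powr (1 - q) * \<rho> i powr q * (if real N / real v \<le> \<tau> / \<rho> i then (real N / real v) powr q else 0)
        + \<rho> i * (if \<tau> / \<rho> i < real N / real v \<and> real N / real v \<le> T / \<rho> i then real N / real v else 0)"
        unfolding g_def Let_def iff using a by (auto simp: powr_mult powr_divide ac_simps)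
    qed
    also have "\<dots> \<le> \<tau> powr (1 - q) * \<rho> i powr q * (C * (\<tau> / \<rho> i) powr (q - 1))
        + \<rho> i * (1 + ln ((T / \<rho> i) / (\<tau> / \<rho> i)))"
      unfolding avg_add avg_mult C_def using a \<tau> N q1
      by (intro add_mono mult_left_mono avg_level_moment avg_level_log) (auto simp: divide_right_mono)
    also have "\<tau> powr (1 - q) * \<rho> i powr q * (C * (\<tau> / \<rho> i) powr (q - 1)) = C * \<rho> i"
    proof -
      have "\<tau> powr (1 - q) * \<tau> powr (q - 1) = 1" using \<tau> by (simp flip: powr_add)
      moreover have "\<rho> i powr q / \<rho> i powr (q - 1) = \<rho> i" using a by (simp flip: powr_diff)
      moreover have "\<tau> powr (1 - q) * \<rho> i powr q * (C * (\<tau> / \<rho> i) powr (q - 1))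
          = C * (\<tau> powr (1 - q) * \<tau> powr (q - 1)) * (\<rho> i powr q / \<rho> i powr (q - 1))"
        using a \<tau> by (simp add: powr_divide)
      ultimately show ?thesis by simp
    qed
    also have "(T / \<rho> i) / (\<tau> / \<rho> i) = T / \<tau>" using a by simp
    finally show ?thesis by (simp add: algebra_simps)
  qed

  have bucket: "(\<Sum>i | i < n \<and> h i = b. (x u i * row_norm d V i)\<^sup>2) powr (p / 2)
      \<le> \<tau> + (\<Sum>i | i < n \<and> h i = b. g i (u i))" for h :: "nat \<Rightarrow> nat" and b u
  proof -
    let ?S = "{i. i < n \<and> h i = b}"
    define sm md where "sm i = (if s u i \<le> \<tau> then s u i powr q else 0)"
      and "md i = (if \<tau> < s u i \<and> s u i \<le> T then s u i powr q else 0)" for i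
    have nn: "0 \<le> sm i" "0 \<le> md i" for i by (auto simp: sm_def md_def)
    have x2: "(x u i * row_norm d V i)\<^sup>2 = sm i + md i" for i
    proof -
      have e: "(c powr (1 / p))\<^sup>2 = c powr (2 / p)" if "0 \<le> c" for c :: real
        using that by (cases "c = 0") (auto simp: power2_eq_square simp flip: powr_add)
      have "(row_norm d V i)\<^sup>2 = (\<rho> i powr (1 / p))\<^sup>2"
        using p by (simp add: \<rho>_def powr_powr)
      then have "(row_norm d V i)\<^sup>2 = \<rho> i powr q" using e[OF \<rho>0] by (simp add: q_def)
      then have "((real N / real (u i)) powr (1 / p) * row_norm d V i)\<^sup>2 = s u i powr q"
        using \<rho>0[of i] by (simp add: power_mult_distrib e s_def q_def flip: powr_mult)
      then show ?thesis using \<tau> by (auto simp: x_def sm_def md_def)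
    qed
    have "(\<Sum>i\<in>?S. (x u i * row_norm d V i)\<^sup>2) powr (p / 2)
        = ((\<Sum>i\<in>?S. sm i) + (\<Sum>i\<in>?S. md i)) powr (p / 2)"
      by (simp add: x2 sum.distrib)
    also have "\<dots> \<le> (\<Sum>i\<in>?S. sm i) powr (p / 2) + (\<Sum>i\<in>?S. md i) powr (p / 2)"
      using nn p by (intro powr_add_subadditive sum_nonneg) auto
    \<comment> \<open>The split at \<open>\<tau> powr q\<close> replaces the concave power of the
      small squares by their sum with slope \<open>\<tau> powr (1 - q)\<close>, whose average is
      known.\<close>
    also have "(\<Sum>i\<in>?S. sm i) powr (p / 2) \<le> (\<Sum>i\<in>?S. sm i) * (\<tau> powr q) powr (p / 2 - 1) + (\<tau> powr q) powr (p / 2)"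
      using nn p \<tau> by (intro powr_le_linear_split sum_nonneg) auto
    also have "(\<tau> powr q) powr (p / 2) = \<tau>" using \<tau> p by (simp add: powr_powr q_def)
    also have "(\<tau> powr q) powr (p / 2 - 1) = \<tau> powr (1 - q)"
    proof -
      have "q * (p / 2 - 1) = 1 - q" using p by (simp add: q_def right_diff_distrib)
      then show ?thesis by (simp add: powr_powr)
    qed
    also have "(\<Sum>i\<in>?S. md i) powr (p / 2) \<le> (\<Sum>i\<in>?S. md i powr (p / 2))"
      using nn p by (intro powr_sum_subadditive) auto
    also have "(\<Sum>i\<in>?S. sm i) * \<tau> powr (1 - q) + \<tau> + (\<Sum>i\<in>?S. md i powr (p / 2))
        = \<tau> + (\<Sum>i\<in>?S. sm i * \<tau> powr (1 - q) + md i powr (p / 2))"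
      by (simp add: sum.distrib sum_distrib_right)
    also have "(\<Sum>i\<in>?S. sm i * \<tau> powr (1 - q) + md i powr (p / 2)) = (\<Sum>i\<in>?S. g i (u i))"
    proof (intro sum.cong refl)
      fix i
      have "(s u i powr q) powr (p / 2) = s u i" using s0 p by (simp add: powr_powr q_def)
      then show "sm i * \<tau> powr (1 - q) + md i powr (p / 2) = g i (u i)"
        by (auto simp: sm_def md_def g_def Let_def s_def mult.commute)
    qed
    finally show ?thesis by simp
  qed

  have F_avg: "avg (signs n) (\<lambda>\<epsilon>. avg (levels n N) (\<lambda>u. F h \<epsilon> u)) \<le> 2 * E" if h: "h \<in> hashes n r" for h
  proof -
    have "avg (signs n) (\<lambda>\<epsilon>. avg (levels n N) (\<lambda>u. F h \<epsilon> u))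
        = avg (levels n N) (\<lambda>u. avg (signs n) (\<lambda>\<epsilon>. F h \<epsilon> u))" by (rule avg_swap)
    also have "\<dots> \<le> avg (levels n N) (\<lambda>u. 2 * (real r * \<tau> + (\<Sum>i<n. g i (u i))))"
    proof (intro avg_mono)
      fix u
      have "avg (signs n) (\<lambda>\<epsilon>. F h \<epsilon> u)
          \<le> (\<Sum>b<r. 2 * (\<Sum>i | i < n \<and> h i = b. (x u i * row_norm d V i)\<^sup>2) powr (p / 2))"
        unfolding F_def using p by (intro avg_frame_pow_signs_le) auto
      also have "\<dots> \<le> (\<Sum>b<r. 2 * (\<tau> + (\<Sum>i | i < n \<and> h i = b. g i (u i))))"
        by (intro sum_mono mult_left_mono bucket) auto
      also have "\<dots> = 2 * (real r * \<tau> + (\<Sum>i<n. g i (u i)))"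
        using sum_buckets[OF h, of "\<lambda>i. g i (u i)"]
        by (simp add: sum.distrib flip: sum_distrib_left)
      finally show "avg (signs n) (\<lambda>\<epsilon>. F h \<epsilon> u) \<le> 2 * (real r * \<tau> + (\<Sum>i<n. g i (u i)))" .
    qed
    also have "\<dots> = 2 * (real r * \<tau> + (\<Sum>i<n. avg {1..N} (g i)))"
      using N by (simp add: avg_mult avg_add avg_sum avg_levels_coord)
    also have "\<dots> \<le> 2 * (real r * \<tau> + (\<Sum>i<n. \<rho> i * (C + 1 + ln (T / \<tau>))))"
      by (intro mult_left_mono add_left_mono sum_mono g_avg) auto
    also have "\<dots> \<le> 2 * E"
    proof -
      have "(\<Sum>i<n. \<rho> i) * (C + 1 + ln (T / \<tau>)) \<le> D * (C + 1 + ln (T / \<tau>))"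
        using D C0 ln0 by (intro mult_right_mono) (auto simp: \<rho>_def)
      then show ?thesis by (simp add: E_def sum_distrib_right)
    qed
    finally show ?thesis .
  qed

  have trunc: "avg (levels n N) (\<lambda>u. of_bool (\<exists>i\<in>{..<n}. T < s u i)) \<le> D / T"
  proof -
    have "avg (levels n N) (\<lambda>u. of_bool (\<exists>i\<in>{..<n}. T < s u i))
        \<le> (\<Sum>i<n. avg (levels n N) (\<lambda>u. of_bool (T < s u i)))"
      by (rule avg_union_bound) simp
    also have "\<dots> \<le> (\<Sum>i<n. \<rho> i / T)"
    proof (intro sum_mono)
      fix i assume "i \<in> {..<n}"
      then have "avg (levels n N) (\<lambda>u. of_bool (T < s u i)) = avg {1..N} (\<lambda>v. of_bool (T < real N / real v * \<rho> i))"
        unfolding s_def using N by (intro avg_levels_coord) auto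
      then show "avg (levels n N) (\<lambda>u. of_bool (T < s u i)) \<le> \<rho> i / T"
        using avg_level_tail_le[OF \<rho>0 T N] by simp
    qed
    also have "\<dots> \<le> D / T"
      using D T by (simp add: \<rho>_def divide_right_mono flip: sum_divide_distrib)
    finally show ?thesis .
  qed

  \<comment> \<open>Either some row exceeds T, or truncation changes nothing and Markov applies to
    F.\<close>
  have "avg (hashes n r) (\<lambda>h. avg (signs n) (\<lambda>\<epsilon>. avg (levels n N) (\<lambda>u.
        of_bool (L < frame_pow p r n d V h (heavy_weights p N \<epsilon> u)))))
    \<le> avg (hashes n r) (\<lambda>h. avg (signs n) (\<lambda>\<epsilon>. avg (levels n N) (\<lambda>u.
        of_bool (\<exists>i\<in>{..<n}. T < s u i) + 1 / L * F h \<epsilon> u)))"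
  proof (intro avg_mono)
    fix h \<epsilon> u
    have F0: "0 \<le> F h \<epsilon> u" unfolding F_def frame_pow_def by (intro sum_nonneg) auto
    show "of_bool (L < frame_pow p r n d V h (heavy_weights p N \<epsilon> u))
      \<le> of_bool (\<exists>i\<in>{..<n}. T < s u i) + 1 / L * F h \<epsilon> u"
    proof (cases "\<exists>i\<in>{..<n}. T < s u i")
      case True
      then show ?thesis using F0 L by simp
    next
      case False
      then have "frame_pow p r n d V h (heavy_weights p N \<epsilon> u) = F h \<epsilon> u"
        unfolding F_def by (intro frame_pow_cong) (auto simp: heavy_weights_def x_def not_less)
      then show ?thesis using F0 L False by (auto simp: field_simps)
    qed
  qed
  also have "\<dots> = avg (hashes n r) (\<lambda>h. avg (levels n N) (\<lambda>u. of_bool (\<exists>i\<in>{..<n}. T < s u i))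
      + 1 / L * avg (signs n) (\<lambda>\<epsilon>. avg (levels n N) (\<lambda>u. F h \<epsilon> u)))"
    unfolding avg_add avg_mult by simp
  also have "\<dots> \<le> avg (hashes n r) (\<lambda>h. D / T + 1 / L * (2 * E))"
    using F_avg trunc L by (intro avg_mono add_mono mult_left_mono) auto
  also have "\<dots> = D / T + 2 * E / L" using r by simp
  finally show ?thesis unfolding E_def C_def q_def .
qed

section \<open>Contraction by the heavy-tailed block\<close>

lemma sum_Pow_power_card:
  fixes x y :: real
  assumes "finite A"
  shows "(\<Sum>B\<in>Pow A. x ^ card B * y ^ card (A - B)) = (x + y) ^ card A"
proof -
  have "(\<Prod>a\<in>A. x + y) = (\<Sum>B\<in>Pow A. (\<Prod>a\<in>B. x) * (\<Prod>a\<in>A - B. y))"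
    by (rule prod_add[OF assms])
  then show ?thesis by simp
qed

text \<open>Choose in every bucket a coordinate at least \<open>\<theta>\<close>. A sign vector with all bucket sums below
  \<open>\<theta>\<close> is determined by its values off the chosen coordinates, as flipping a chosen sign moves the sum
  by at least \<open>2 \<theta>\<close>.\<close>

lemma avg_signs_small_buckets:
  fixes x :: "nat \<Rightarrow> real"
  assumes B: "finite B" and big: "\<And>b. b \<in> B \<Longrightarrow> \<exists>i<n. h i = b \<and> \<theta> \<le> \<bar>x i\<bar>"
  shows "avg (signs n) (\<lambda>\<epsilon>. of_bool (\<forall>b\<in>B. \<bar>\<Sum>i | i < n \<and> h i = b. \<epsilon> i * x i\<bar> < \<theta>)) \<le> (1 / 2) ^ card B"
proof -
  obtain rep where rep: "\<And>b. b \<in> B \<Longrightarrow> rep b < n \<and> h (rep b) = b \<and> \<theta> \<le> \<bar>x (rep b)\<bar>"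
    using big by metis
  define R where "R = rep ` B"
  have inj: "inj_on rep B" using rep by (metis inj_onI)
  have cardR: "card R = card B" unfolding R_def using inj by (rule card_image)
  have R: "R \<subseteq> {..<n}" "finite R" unfolding R_def using rep B by auto
  let ?Z = "\<lambda>\<epsilon> b. \<Sum>i | i < n \<and> h i = b. \<epsilon> i * x i"
  define S where "S = {\<epsilon> \<in> signs n. \<forall>b\<in>B. \<bar>?Z \<epsilon> b\<bar> < \<theta>}"
  have "inj_on (\<lambda>\<epsilon>. restrict \<epsilon> ({..<n} - R)) S"
  proof (rule inj_onI)
    fix \<epsilon> \<epsilon>' assume \<epsilon>: "\<epsilon> \<in> S" "\<epsilon>' \<in> S" and eq: "restrict \<epsilon> ({..<n} - R) = restrict \<epsilon>' ({..<n} - R)"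
    have off: "\<epsilon> i = \<epsilon>' i" if "i < n" "i \<notin> R" for i
      using fun_cong[OF eq, of i] that by (simp add: restrict_def)
    have on: "\<epsilon> (rep b) = \<epsilon>' (rep b)" if b: "b \<in> B" for b
    proof (rule ccontr)
      assume ne: "\<epsilon> (rep b) \<noteq> \<epsilon>' (rep b)"
      let ?i = "rep b" and ?S = "{i. i < n \<and> h i = b}"
      have i: "?i < n" "h ?i = b" "\<theta> \<le> \<bar>x ?i\<bar>" using rep[OF b] by auto
      have other: "\<epsilon> k = \<epsilon>' k" if "k \<in> ?S - {?i}" for k
      proof (rule off)
        show "k \<notin> R" unfolding R_def using that rep by auto
      qed (use that in auto)
      have rest: "(\<Sum>k\<in>?S - {?i}. \<epsilon> k * x k) = (\<Sum>k\<in>?S - {?i}. \<epsilon>' k * x k)"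
        using other by (intro sum.cong) auto
      have split: "?Z e b = e ?i * x ?i + (\<Sum>k\<in>?S - {?i}. e k * x k)" for e
        using i by (intro sum.remove) auto
      have "\<epsilon> ?i = - \<epsilon>' ?i" "\<bar>\<epsilon> ?i\<bar> = 1"
        using ne signs_cases[of \<epsilon> n ?i] signs_cases[of \<epsilon>' n ?i] \<epsilon> i by (auto simp: S_def)
      then have "\<bar>?Z \<epsilon> b - ?Z \<epsilon>' b\<bar> = 2 * \<bar>x ?i\<bar>"
        unfolding split rest by (simp add: abs_mult)
      moreover have "\<bar>?Z \<epsilon> b\<bar> < \<theta>" "\<bar>?Z \<epsilon>' b\<bar> < \<theta>" using \<epsilon> b by (auto simp: S_def)
      ultimately show False using i by linarith
    qed
    show "\<epsilon> = \<epsilon>'"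
    proof
      fix i
      show "\<epsilon> i = \<epsilon>' i"
      proof (cases "i < n")
        case True
        then show ?thesis using on off by (cases "i \<in> R") (auto simp: R_def)
      next
        case False
        then show ?thesis using \<epsilon> unfolding S_def signs_def by (auto simp: PiE_def extensional_def)
      qed
    qed
  qed
  moreover have "(\<lambda>\<epsilon>. restrict \<epsilon> ({..<n} - R)) ` S \<subseteq> PiE ({..<n} - R) (\<lambda>_. {-1, 1})"
    unfolding S_def signs_def by (auto simp: restrict_PiE_iff PiE_iff split: if_splits)
  ultimately have "card S \<le> card (PiE ({..<n} - R) (\<lambda>_. {-1, 1::real}))"
    by (intro card_inj_on_le finite_PiE) auto
  also have "\<dots> = 2 ^ (n - card B)"
    using R cardR by (simp add: card_PiE card_Diff_subset numeral_2_eq_2)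
  finally have "real (card S) \<le> 2 ^ (n - card B)" by (metis of_nat_le_iff of_nat_numeral of_nat_power)
  moreover have "card B \<le> n" using card_mono[OF _ R(1)] cardR by simp
  ultimately have le: "real (card S) / 2 ^ n \<le> (1 / 2) ^ card B"
    by (simp add: power_diff field_simps)
  have "avg (signs n) (\<lambda>\<epsilon>. of_bool (\<forall>b\<in>B. \<bar>?Z \<epsilon> b\<bar> < \<theta>)) = real (card S) / real (card (signs n))"
    unfolding avg_def S_def by (simp add: Int_def)
  also have "card (signs n) = 2 ^ n" unfolding signs_def by (simp add: card_PiE numeral_2_eq_2)
  finally show ?thesis using le by simp
qed

text \<open>The buckets are dependent but the coordinates are not: coordinate i violates the event
  with probability card G / r times its chance of being large, and 1 - x \<le> exp (- x). The bound
  is geometric in card G, as if the buckets in G were independent.\<close>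

lemma avg_no_hit_le:
  fixes a :: "nat \<Rightarrow> real"
  assumes r: "0 < r" and N: "0 < N" and G: "G \<subseteq> {..<r}"
  shows "avg (hashes n r) (\<lambda>h. avg (levels n N) (\<lambda>u.
      of_bool (\<forall>i<n. h i \<in> G \<longrightarrow> \<not> 1 \<le> real N / real (u i) * a i)))
    \<le> exp (- ((\<Sum>i<n. avg {1..N} (\<lambda>v. of_bool (1 \<le> real N / real v * a i))) / real r)) ^ card G"
proof -
  define c where "c i v = (of_bool (1 \<le> real N / real v * a i) :: real)" for i and v :: nat
  define q where "q i = avg {1..N} (c i)" for i
  have "(of_bool (\<forall>i<n. h i \<in> G \<longrightarrow> \<not> 1 \<le> real N / real (u i) * a i) :: real)
      = (\<Prod>i<n. 1 - of_bool (h i \<in> G) * c i (u i))"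
    (is "of_bool ?P = ?prod") for h :: "nat \<Rightarrow> nat" and u
  proof (cases ?P)
    case True
    then have "\<forall>i\<in>{..<n}. 1 - of_bool (h i \<in> G) * c i (u i) = 1" by (auto simp: c_def)
    from prod.neutral[OF this] have "?prod = 1" .
    moreover have "of_bool ?P = (1::real)" using True by (subst of_bool_eq_1_iff)
    ultimately show ?thesis by (simp only:)
  next
    case False
    then have "\<exists>i\<in>{..<n}. 1 - of_bool (h i \<in> G) * c i (u i) = 0" by (auto simp: c_def)
    then have "?prod = 0" by (intro prod_zero) auto
    moreover have "of_bool ?P = (0::real)" using False by (subst of_bool_eq_0_iff)
    ultimately show ?thesis by (simp only:)
  qed
  then have "avg (hashes n r) (\<lambda>h. avg (levels n N) (\<lambda>u.
      of_bool (\<forall>i<n. h i \<in> G \<longrightarrow> \<not> 1 \<le> real N / real (u i) * a i)))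
    = avg (levels n N) (\<lambda>u. avg (hashes n r) (\<lambda>h. \<Prod>i<n. 1 - of_bool (h i \<in> G) * c i (u i)))"
    by (subst avg_swap) simp
  also have "\<dots> = avg (levels n N) (\<lambda>u. \<Prod>i<n. avg {..<r} (\<lambda>b. 1 - of_bool (b \<in> G) * c i (u i)))"
    unfolding hashes_def by (intro avg_cong avg_prod_PiE) auto
  also have "\<dots> = avg (levels n N) (\<lambda>u. \<Prod>i<n. 1 - real (card G) / real r * c i (u i))"
  proof -
    have "avg {..<r} (\<lambda>b. 1 - of_bool (b \<in> G) * t) = 1 - real (card G) / real r * t" for t
    proof -
      have "avg {..<r} (\<lambda>b. t * of_bool (b \<in> G)) = t * (real (card G) / real r)"
        unfolding avg_mult using G by (simp add: avg_def Int_absorb1)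
      moreover have "avg {..<r} (\<lambda>b. 1 - t * of_bool (b \<in> G)) = 1 - avg {..<r} (\<lambda>b. t * of_bool (b \<in> G))"
        unfolding avg_diff using r by (subst avg_const) auto
      ultimately show ?thesis by (simp add: mult.commute)
    qed
    then show ?thesis by simp
  qed
  also have "\<dots> = (\<Prod>i<n. avg {1..N} (\<lambda>v. 1 - real (card G) / real r * c i v))"
    unfolding levels_def by (intro avg_prod_PiE) auto
  also have "\<dots> = (\<Prod>i<n. 1 - real (card G) / real r * q i)"
  proof -
    have "avg {1..N} (\<lambda>v. 1 - t * c i v) = 1 - t * q i" for t i
      unfolding avg_diff avg_mult q_def using N by simp
    then show ?thesis by (intro prod.cong refl)
  qed
  also have "\<dots> \<le> (\<Prod>i<n. exp (- (real (card G) / real r * q i)))"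
  proof (intro prod_mono conjI)
    fix i
    have "card G \<le> r" using card_mono[OF _ G] by simp
    then have "real (card G) / real r \<le> 1" using r by simp
    moreover have "q i \<le> 1" "0 \<le> q i"
      unfolding q_def c_def by (auto intro!: avg_le_const avg_nonneg)
    ultimately have "real (card G) / real r * q i \<le> 1 * 1" by (intro mult_mono) auto
    then show "0 \<le> 1 - real (card G) / real r * q i" by simp
    show "1 - real (card G) / real r * q i \<le> exp (- (real (card G) / real r * q i))"
      using exp_ge_add_one_self[of "- (real (card G) / real r * q i)"] by simp
  qed
  also have "\<dots> = exp (- (sum q {..<n} / real r)) ^ card G"
  proof -
    have "(\<Sum>i<n. real (card G) / real r * q i) = real (card G) * (sum q {..<n} / real r)"
      by (simp add: sum_distrib_left sum_divide_distrib)
    then show ?thesis by (simp add: exp_sum[symmetric] sum_negf flip: exp_of_nat_mult)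
  qed
  finally show ?thesis unfolding q_def c_def .
qed

text \<open>A bucket is good if its sketch value has \<open>p\<close>-th power at least \<open>1 / K\<close>. With \<open>W\<close> good buckets,
  \<open>W \<le> r / 16\<close> forces \<open>8 powr (r / 16) * (1 / 8) ^ W \<ge> 1\<close>, and \<open>(1 / 8) ^ W\<close> is bounded by summing
  over the possible sets of good buckets.\<close>

lemma npow_heavy_sketch_ge:
  fixes p K :: real
  assumes p: "1 \<le> p" "p < 2" and r: "0 < r" and N: "0 < N" and K: "0 < K"
    and Q: "2 * real r \<le> K * npow p n y - K powr (2 / p) * (\<Sum>i<n. (y i)\<^sup>2) - real n / real N"
  shows "avg (hashes n r) (\<lambda>h. avg (signs n) (\<lambda>\<epsilon>. avg (levels n N) (\<lambda>u.
      of_bool (npow p r (sketch n h (heavy_weights p N \<epsilon> u) y) < real r / (16 * K)))))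
    \<le> exp (- (real r / 10))"
proof -
  define a where "a i = \<bar>y i\<bar> powr p * K" for i
  define \<theta> where "\<theta> = (1 / K) powr (1 / p)"
  define Z where "Z h \<epsilon> u b = sketch n h (heavy_weights p N \<epsilon> u) y b" for h \<epsilon> u b
  define Q' where "Q' = (\<Sum>i<n. avg {1..N} (\<lambda>v. of_bool (1 \<le> real N / real v * a i)))"
  define hit where "hit h u = {b \<in> {..<r}. \<exists>i<n. h i = b \<and> 1 \<le> real N / real (u i) * a i}"
    for h :: "nat \<Rightarrow> nat" and u :: "nat \<Rightarrow> nat"
  define \<kappa> where "\<kappa> = exp (- (Q' / real r))"
  define good where "good h \<epsilon> u = {b \<in> {..<r}. \<theta> \<le> \<bar>Z h \<epsilon> u b\<bar>}" for h \<epsilon> u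
  have \<theta>0: "0 < \<theta>" using K by (simp add: \<theta>_def)
  have \<theta>p: "\<theta> powr p = 1 / K" using K p by (simp add: \<theta>_def powr_powr)
  have a0: "0 \<le> a i" for i using K by (simp add: a_def)

  have Q'2: "2 * real r \<le> Q'"
  proof -
    \<comment> \<open>For a i > 1 the right-hand side is not positive, since 2 / p > 1. This is how
      a small Euclidean norm of y forces many buckets to be hit.\<close>
    have "min 1 (a i) \<ge> a i - K powr (2 / p) * (y i)\<^sup>2" for i
    proof -
      have e: "a i powr (2 / p) = K powr (2 / p) * (y i)\<^sup>2"
      proof (cases "y i = 0")
        case False
        then show ?thesis using p K by (simp add: a_def powr_mult powr_powr)
      qed (use p in \<open>simp add: a_def\<close>)
      show ?thesis
      proof (cases "a i \<le> 1")
        case False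
        then have "a i powr 1 \<le> a i powr (2 / p)" using p by (intro powr_mono) auto
        then show ?thesis using False e by simp
      qed (use K in \<open>simp add: min_def\<close>)
    qed
    then have "(\<Sum>i<n. a i - K powr (2 / p) * (y i)\<^sup>2 - 1 / real N) \<le> Q'"
      unfolding Q'_def using avg_level_tail_ge[OF a0 N] by (intro sum_mono) (smt (verit))
    moreover have "(\<Sum>i<n. a i - K powr (2 / p) * (y i)\<^sup>2 - 1 / real N)
        = K * npow p n y - K powr (2 / p) * (\<Sum>i<n. (y i)\<^sup>2) - real n / real N"
      by (simp add: sum_subtractf a_def npow_def sum_distrib_left mult.commute)
    ultimately show ?thesis using Q by linarith
  qed
  have \<kappa>4: "\<kappa> \<le> 1 / 4" "0 < \<kappa>"
  proof -
    have "2 \<le> Q' / real r" using Q'2 r by (simp add: field_simps)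
    then have "\<kappa> \<le> exp (- 2)" by (simp add: \<kappa>_def)
    also have "exp (- 2 :: real) \<le> 1 / 4"
    proof -
      have "(2::real) \<le> exp 1" using exp_ge_add_one_self[of "1::real"] by simp
      then have "(2::real) * 2 \<le> exp 1 * exp 1" by (intro mult_mono) auto
      then show ?thesis by (simp add: exp_minus field_simps flip: exp_add)
    qed
    finally show "\<kappa> \<le> 1 / 4" "0 < \<kappa>" by (auto simp: \<kappa>_def)
  qed

  \<comment> \<open>Hashes and levels are fixed here. A hit bucket holds a weighted coordinate of
    size at least \<theta>, so the signs alone make it bad with probability at most 1/2.\<close>
  have bad_le: "avg (signs n) (\<lambda>\<epsilon>. of_bool (\<forall>b\<in>B. \<bar>Z h \<epsilon> u b\<bar> < \<theta>)) \<le> (1 / 2) ^ card (B \<inter> hit h u)"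
    if B: "B \<subseteq> {..<r}" for B h u
  proof -
    let ?x = "\<lambda>i. (real N / real (u i)) powr (1 / p) * y i"
    have finB: "finite B" using B finite_subset by blast
    have "avg (signs n) (\<lambda>\<epsilon>. of_bool (\<forall>b\<in>B. \<bar>Z h \<epsilon> u b\<bar> < \<theta>))
      \<le> avg (signs n) (\<lambda>\<epsilon>. of_bool (\<forall>b\<in>B \<inter> hit h u. \<bar>\<Sum>i | i < n \<and> h i = b. \<epsilon> i * ?x i\<bar> < \<theta>))"
      by (intro avg_mono) (auto simp: Z_def sketch_def heavy_weights_def mult.assoc)
    also have "\<dots> \<le> (1 / 2) ^ card (B \<inter> hit h u)"
    proof (rule avg_signs_small_buckets)
      fix b assume "b \<in> B \<inter> hit h u"
      then obtain i where i: "i < n" "h i = b" "1 \<le> real N / real (u i) * a i" by (auto simp: hit_def)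
      have "1 / K \<le> real N / real (u i) * \<bar>y i\<bar> powr p"
        using i(3) K by (simp add: a_def field_simps)
      then have "\<theta> \<le> (real N / real (u i) * \<bar>y i\<bar> powr p) powr (1 / p)"
        unfolding \<theta>_def using K p by (intro powr_mono2) auto
      also have "\<dots> = \<bar>?x i\<bar>" using p by (simp add: powr_mult powr_powr powr_divide abs_mult)
      finally show "\<exists>i<n. h i = b \<and> \<theta> \<le> \<bar>?x i\<bar>" using i by blast
    qed (use finB in auto)
    finally show ?thesis .
  qed

  have hits: "avg (hashes n r) (\<lambda>h. avg (levels n N) (\<lambda>u. (1 / 2) ^ card (B \<inter> hit h u)))
      \<le> ((1 + \<kappa>) / 2) ^ card B" if B: "B \<subseteq> {..<r}" for B
  proof -
    have finB: "finite B" using B finite_subset by blast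
    \<comment> \<open>\<open>(1 / 2) ^ card (B \<inter> S)\<close> is the probability that a
      uniformly random subset G of B misses S. This turns the power into a sum of events to which
      \<open>avg_no_hit_le\<close> applies.\<close>
    have half: "(1 / 2) ^ card (B \<inter> S) = (1 / 2) ^ card B * (\<Sum>G\<in>Pow B. of_bool (G \<inter> S = {}) :: real)" for S
    proof -
      have "(\<Sum>G\<in>Pow B. of_bool (G \<inter> S = {}) :: real) = real (card (Pow B \<inter> {G. G \<inter> S = {}}))"
        using finB by simp
      also have "Pow B \<inter> {G. G \<inter> S = {}} = Pow (B - S)" by auto
      also have "real (card (Pow (B - S))) = 2 ^ card (B - S)" using finB by (simp add: card_Pow)
      finally have 1: "(\<Sum>G\<in>Pow B. of_bool (G \<inter> S = {}) :: real) = 2 ^ card (B - S)" .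
      have "card B = card (B \<inter> S) + card (B - S)"
        using finB by (simp add: card_Int_Diff)
      then show ?thesis unfolding 1 by (simp add: power_add power_divide)
    qed
    have "avg (hashes n r) (\<lambda>h. avg (levels n N) (\<lambda>u. (1 / 2) ^ card (B \<inter> hit h u)))
      = (1 / 2) ^ card B * (\<Sum>G\<in>Pow B. avg (hashes n r) (\<lambda>h. avg (levels n N) (\<lambda>u. of_bool (G \<inter> hit h u = {}))))"
      unfolding half by (simp add: avg_mult avg_sum)
    also have "\<dots> \<le> (1 / 2) ^ card B * (\<Sum>G\<in>Pow B. \<kappa> ^ card G)"
    proof (intro mult_left_mono sum_mono)
      fix G assume "G \<in> Pow B"
      then have G: "G \<subseteq> {..<r}" using B by auto
      have "avg (hashes n r) (\<lambda>h. avg (levels n N) (\<lambda>u. of_bool (G \<inter> hit h u = {})))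
        = avg (hashes n r) (\<lambda>h. avg (levels n N) (\<lambda>u.
            of_bool (\<forall>i<n. h i \<in> G \<longrightarrow> \<not> 1 \<le> real N / real (u i) * a i)))"
        using G by (intro avg_cong arg_cong[where f = of_bool]) (fastforce simp: hit_def)
      also have "\<dots> \<le> \<kappa> ^ card G" unfolding \<kappa>_def Q'_def by (rule avg_no_hit_le[OF r N G])
      finally show "avg (hashes n r) (\<lambda>h. avg (levels n N) (\<lambda>u. of_bool (G \<inter> hit h u = {}))) \<le> \<kappa> ^ card G" .
    qed simp
    also have "\<dots> = ((1 + \<kappa>) / 2) ^ card B"
      using sum_Pow_power_card[OF finB, of \<kappa> 1] by (simp add: power_divide add.commute)
    finally show ?thesis .
  qed

  have good_avg: "avg (hashes n r) (\<lambda>h. avg (signs n) (\<lambda>\<epsilon>. avg (levels n N) (\<lambda>u. (1 / 8) ^ card (good h \<epsilon> u))))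
      \<le> (3 / 4) ^ r"
  proof -
    have point: "(1 / 8) ^ card (good h \<epsilon> u)
        \<le> (\<Sum>B\<in>Pow {..<r}. (1 / 8) ^ card B * of_bool (\<forall>b\<in>{..<r} - B. \<bar>Z h \<epsilon> u b\<bar> < \<theta>) :: real)" for h \<epsilon> u
    proof -
      let ?f = "\<lambda>B. (1 / 8) ^ card B * of_bool (\<forall>b\<in>{..<r} - B. \<bar>Z h \<epsilon> u b\<bar> < \<theta>) :: real"
      have "?f (good h \<epsilon> u) \<le> (\<Sum>B\<in>Pow {..<r}. ?f B)"
        by (intro member_le_sum) (auto simp: good_def)
      moreover have "?f (good h \<epsilon> u) = (1 / 8) ^ card (good h \<epsilon> u)" by (simp add: good_def not_le)
      ultimately show ?thesis by simp
    qed
    have "avg (hashes n r) (\<lambda>h. avg (signs n) (\<lambda>\<epsilon>. avg (levels n N) (\<lambda>u. (1 / 8) ^ card (good h \<epsilon> u))))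
      \<le> avg (hashes n r) (\<lambda>h. avg (signs n) (\<lambda>\<epsilon>. avg (levels n N) (\<lambda>u.
          \<Sum>B\<in>Pow {..<r}. (1 / 8) ^ card B * of_bool (\<forall>b\<in>{..<r} - B. \<bar>Z h \<epsilon> u b\<bar> < \<theta>))))"
      by (intro avg_mono point)
    also have "\<dots> = (\<Sum>B\<in>Pow {..<r}. (1 / 8) ^ card B * avg (hashes n r) (\<lambda>h. avg (levels n N) (\<lambda>u.
        avg (signs n) (\<lambda>\<epsilon>. of_bool (\<forall>b\<in>{..<r} - B. \<bar>Z h \<epsilon> u b\<bar> < \<theta>)))))"
      by (simp only: avg_swap[of "signs n" "levels n N"] avg_sum avg_mult)
    also have "\<dots> \<le> (\<Sum>B\<in>Pow {..<r}. (1 / 8) ^ card B * ((1 + \<kappa>) / 2) ^ card ({..<r} - B))"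
    proof (intro sum_mono mult_left_mono)
      fix B
      have "avg (hashes n r) (\<lambda>h. avg (levels n N) (\<lambda>u.
          avg (signs n) (\<lambda>\<epsilon>. of_bool (\<forall>b\<in>{..<r} - B. \<bar>Z h \<epsilon> u b\<bar> < \<theta>))))
        \<le> avg (hashes n r) (\<lambda>h. avg (levels n N) (\<lambda>u. (1 / 2) ^ card (({..<r} - B) \<inter> hit h u)))"
        by (intro avg_mono bad_le) auto
      also have "\<dots> \<le> ((1 + \<kappa>) / 2) ^ card ({..<r} - B)" by (intro hits) auto
      finally show "avg (hashes n r) (\<lambda>h. avg (levels n N) (\<lambda>u.
          avg (signs n) (\<lambda>\<epsilon>. of_bool (\<forall>b\<in>{..<r} - B. \<bar>Z h \<epsilon> u b\<bar> < \<theta>)))) \<le> \<dots>" .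
    qed simp
    also have "\<dots> = (1 / 8 + (1 + \<kappa>) / 2) ^ r"
      using sum_Pow_power_card[of "{..<r}" "1 / 8" "(1 + \<kappa>) / 2"] by simp
    \<comment> \<open>Each bucket counts 1/8 if it is good and at most (1 + 1/4) / 2 = 5/8
      otherwise.\<close>
    also have "\<dots> \<le> (3 / 4) ^ r"
    proof (rule power_mono)
      have "(1 + \<kappa>) / 2 \<le> (1 + 1 / 4) / 2" using \<kappa>4 by (intro divide_right_mono add_left_mono) auto
      from add_left_mono[OF this, of "1 / 8"] show "1 / 8 + (1 + \<kappa>) / 2 \<le> 3 / 4" by simp
    qed (use \<kappa>4 in simp)
    finally show ?thesis .
  qed

  have point: "of_bool (npow p r (Z h \<epsilon> u) < real r / (16 * K)) \<le> 8 powr (real r / 16) * (1 / 8) ^ card (good h \<epsilon> u)"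
    for h \<epsilon> u
  proof (cases "npow p r (Z h \<epsilon> u) < real r / (16 * K)")
    case True
    have "(\<Sum>b\<in>good h \<epsilon> u. 1 / K) \<le> (\<Sum>b\<in>good h \<epsilon> u. \<bar>Z h \<epsilon> u b\<bar> powr p)"
    proof (intro sum_mono)
      fix b assume "b \<in> good h \<epsilon> u"
      then have "\<theta> powr p \<le> \<bar>Z h \<epsilon> u b\<bar> powr p" using \<theta>0 p by (intro powr_mono2) (auto simp: good_def)
      then show "1 / K \<le> \<bar>Z h \<epsilon> u b\<bar> powr p" by (simp add: \<theta>p)
    qed
    also have "\<dots> \<le> npow p r (Z h \<epsilon> u)"
      unfolding npow_def by (intro sum_mono2) (auto simp: good_def)
    finally have "real (card (good h \<epsilon> u)) / K < real r / (16 * K)" using True by simp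
    then have "real (card (good h \<epsilon> u)) \<le> real r / 16" using K by (simp add: field_simps)
    then have "(8::real) powr real (card (good h \<epsilon> u)) \<le> 8 powr (real r / 16)" by (intro powr_mono) auto
    then show ?thesis using True by (simp add: powr_realpow power_divide field_simps)
  qed simp
  have "avg (hashes n r) (\<lambda>h. avg (signs n) (\<lambda>\<epsilon>. avg (levels n N) (\<lambda>u.
      of_bool (npow p r (Z h \<epsilon> u) < real r / (16 * K)))))
    \<le> avg (hashes n r) (\<lambda>h. avg (signs n) (\<lambda>\<epsilon>. avg (levels n N) (\<lambda>u. 8 powr (real r / 16) * (1 / 8) ^ card (good h \<epsilon> u))))"
    by (intro avg_mono point)
  also have "\<dots> \<le> 8 powr (real r / 16) * (3 / 4) ^ r"
    unfolding avg_mult using good_avg by (intro mult_left_mono) auto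
  also have "\<dots> \<le> exp (- (real r / 10))"
  proof -
    \<comment> \<open>The sixteenth power of the comparison
      \<open>8 powr (1 / 16) * (3 / 4) \<le> exp (- (1 / 10))\<close>; the gap between 9/100 and 1/9
      leaves room for the bound exp 1 \<le> 3.\<close>
    have "8 * (3 / 4 :: real) ^ 16 \<le> 9 / 100" by (simp add: power_divide)
    also have "(9 / 100 :: real) \<le> exp (- (16 / 10))"
    proof -
      have "exp (16 / 10 :: real) \<le> exp (1 + 1)" by simp
      also have "\<dots> = exp 1 * exp (1 :: real)" by (rule exp_add)
      also have "\<dots> \<le> 3 * 3" using exp_le by (intro mult_mono) auto
      finally show ?thesis by (simp add: exp_minus field_simps)
    qed
    finally have "ln (8 * (3 / 4 :: real) ^ 16) \<le> ln (exp (- (16 / 10)))"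
      by (subst ln_le_cancel_iff) auto
    then have "ln (8 * (3 / 4 :: real) ^ 16) \<le> - (16 / 10)" by (simp only: ln_exp)
    then have "ln 8 + 16 * ln (3 / 4 :: real) \<le> - (16 / 10)"
      by (simp add: ln_mult ln_realpow)
    then have "real r / 16 * (ln 8 + 16 * ln (3 / 4)) \<le> real r / 16 * - (16 / 10)"
      by (intro mult_left_mono) auto
    then have "real r / 16 * ln 8 + real r * ln (3 / 4) \<le> - (real r / 10)"
      by (simp add: algebra_simps)
    then have "exp (real r / 16 * ln 8 + real r * ln (3 / 4)) \<le> exp (- (real r / 10))" by simp
    then show ?thesis by (simp add: exp_add powr_def powr_realpow[symmetric])
  qed
  finally show ?thesis unfolding Z_def .
qed

section \<open>The stacked sketch\<close>

definition stacked :: "nat \<Rightarrow> real \<Rightarrow> (nat \<Rightarrow> nat) \<Rightarrow> (nat \<Rightarrow> real) \<Rightarrow> (nat \<Rightarrow> nat) \<Rightarrow> (nat \<Rightarrow> real) \<Rightarrow> nat \<Rightarrow> nat \<Rightarrow> real" where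
  "stacked r1 \<alpha> h1 w1 h2 w2 b i =
    (if b < r1 then (if h1 i = b then \<alpha> * w1 i else 0) else (if h2 i = b - r1 then w2 i else 0))"

lemma two_sparse_stacked: "two_sparse_cols r n (stacked r1 \<alpha> h1 w1 h2 w2)"
  unfolding two_sparse_cols_def
proof (intro allI impI)
  fix j
  have "{i. i < r \<and> stacked r1 \<alpha> h1 w1 h2 w2 i j \<noteq> 0} \<subseteq> {h1 j, r1 + h2 j}"
    by (auto simp: stacked_def split: if_splits)
  then have "card {i. i < r \<and> stacked r1 \<alpha> h1 w1 h2 w2 i j \<noteq> 0} \<le> card {h1 j, r1 + h2 j}"
    by (intro card_mono) auto
  also have "\<dots> \<le> 2" by (simp add: card_insert_if)
  finally show "card {i. i < r \<and> stacked r1 \<alpha> h1 w1 h2 w2 i j \<noteq> 0} \<le> 2" .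
qed

lemma npow_stacked:
  assumes "0 \<le> \<alpha>"
  shows "npow p (r1 + r2) (mat_vec n (stacked r1 \<alpha> h1 w1 h2 w2) y)
    = \<alpha> powr p * npow p r1 (sketch n h1 w1 y) + npow p r2 (sketch n h2 w2 y)"
proof -
  let ?P = "stacked r1 \<alpha> h1 w1 h2 w2"
  have 1: "mat_vec n ?P y b = \<alpha> * sketch n h1 w1 y b" if "b < r1" for b
    unfolding mat_vec_def sketch_altdef sum_distrib_left
    using that by (intro sum.cong) (auto simp: stacked_def)
  have 2: "mat_vec n ?P y (r1 + b) = sketch n h2 w2 y b" for b
    unfolding mat_vec_def sketch_altdef by (intro sum.cong) (auto simp: stacked_def)
  have "npow p (r1 + r2) f = npow p r1 f + npow p r2 (\<lambda>b. f (r1 + b))" for f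
  proof -
    have "npow p (r1 + r2) f = (\<Sum>b\<in>{..<r1}. \<bar>f b\<bar> powr p) + (\<Sum>b\<in>{r1..<r1 + r2}. \<bar>f b\<bar> powr p)"
      unfolding npow_def by (subst sum.union_disjoint[symmetric]) (auto intro!: sum.cong)
    also have "(\<Sum>b\<in>{r1..<r1 + r2}. \<bar>f b\<bar> powr p) = (\<Sum>b\<in>{..<r2}. \<bar>f (r1 + b)\<bar> powr p)"
      by (rule sum.reindex_bij_witness[of _ "\<lambda>b. r1 + b" "\<lambda>b. b - r1"]) auto
    finally show ?thesis by (simp add: npow_def)
  qed
  then have "npow p (r1 + r2) (mat_vec n ?P y)
      = npow p r1 (mat_vec n ?P y) + npow p r2 (\<lambda>b. mat_vec n ?P y (r1 + b))" .
  also have "npow p r1 (mat_vec n ?P y) = npow p r1 (\<lambda>b. \<alpha> * sketch n h1 w1 y b)"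
    using 1 by (intro npow_cong)
  finally show ?thesis using assms by (simp add: npow_scale 2)
qed

lemma npow_mat_vec_le:
  assumes "0 < p"
  shows "npow p n (mat_vec d V z) \<le> sqrt (\<Sum>j<d. (z j)\<^sup>2) powr p * (\<Sum>i<n. row_norm d V i powr p)"
proof -
  have "npow p n (mat_vec d V z) \<le> (\<Sum>i<n. (row_norm d V i * sqrt (\<Sum>j<d. (z j)\<^sup>2)) powr p)"
    unfolding npow_def using assms abs_mat_vec_le by (intro sum_mono powr_mono2) auto
  also have "\<dots> = sqrt (\<Sum>j<d. (z j)\<^sup>2) powr p * (\<Sum>i<n. row_norm d V i powr p)"
    unfolding sum_distrib_left by (intro sum.cong) (auto simp: powr_mult sum_nonneg)
  finally show ?thesis .
qed

section \<open>A net in the coefficient space\<close>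

text \<open>Integer vectors k stand for the points k / D of the cube [-2, 2]^d, which contains every
  z with \<bar>z\<bar> \<le> 2.\<close>

definition grid :: "nat \<Rightarrow> nat \<Rightarrow> (nat \<Rightarrow> int) set" where
  "grid d D = PiE {..<d} (\<lambda>_. {- 2 * int D..2 * int D})"

lemma finite_grid [simp]: "finite (grid d D)"
  unfolding grid_def by (intro finite_PiE) auto

lemma card_grid: "card (grid d D) = (4 * D + 1) ^ d"
  unfolding grid_def by (simp add: card_PiE nat_add_distrib nat_mult_distrib)

lemma grid_approx:
  assumes D: "0 < D" and z: "sqrt (\<Sum>j<d. (z j)\<^sup>2) \<le> 2"
  obtains k where "k \<in> grid d D"
    "sqrt (\<Sum>j<d. (real_of_int (k j) / real D - z j)\<^sup>2) \<le> sqrt (real d) / real D"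
proof -
  define k where "k j = (if j < d then \<lfloor>real D * z j\<rfloor> else undefined)" for j
  have zj: "\<bar>z j\<bar> \<le> 2" if "j < d" for j
  proof -
    have "(z j)\<^sup>2 \<le> (\<Sum>j<d. (z j)\<^sup>2)" using that by (intro member_le_sum) auto
    then have "sqrt ((z j)\<^sup>2) \<le> 2" using z by (meson order.trans real_sqrt_le_mono)
    then show ?thesis by simp
  qed
  have "k \<in> grid d D"
    unfolding grid_def
  proof (rule PiE_I)
    fix j assume j: "j \<in> {..<d}"
    have "\<bar>real D * z j\<bar> \<le> real D * 2"
      unfolding abs_mult using zj[of j] j by (intro mult_mono) auto
    then have "- (2 * real D) \<le> real D * z j" "real D * z j \<le> 2 * real D" by linarith+
    then show "k j \<in> {- 2 * int D..2 * int D}"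
      using j unfolding k_def by (auto simp: le_floor_iff floor_le_iff)
  qed (simp add: k_def)
  moreover have "sqrt (\<Sum>j<d. (real_of_int (k j) / real D - z j)\<^sup>2) \<le> sqrt (real d) / real D"
  proof -
    have "(\<Sum>j<d. (real_of_int (k j) / real D - z j)\<^sup>2) \<le> (\<Sum>j<d. (1 / real D)\<^sup>2)"
    proof (intro sum_mono)
      fix j assume j: "j \<in> {..<d}"
      have "\<bar>real_of_int (k j) - real D * z j\<bar> \<le> 1" using j unfolding k_def by simp linarith
      then have "\<bar>(real_of_int (k j) - real D * z j) / real D\<bar> \<le> 1 / real D"
        unfolding abs_divide using D by (simp add: divide_right_mono)
      then have "\<bar>real_of_int (k j) / real D - z j\<bar> \<le> \<bar>1 / real D\<bar>"
        using D by (simp add: diff_divide_distrib)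
      then show "(real_of_int (k j) / real D - z j)\<^sup>2 \<le> (1 / real D)\<^sup>2"
        by (simp only: abs_le_square_iff)
    qed
    also have "\<dots> = real d * (1 / real D)\<^sup>2" by simp
    finally have "sqrt (\<Sum>j<d. (real_of_int (k j) / real D - z j)\<^sup>2) \<le> sqrt (real d * (1 / real D)\<^sup>2)"
      by (rule real_sqrt_le_mono)
    then show ?thesis by (simp add: real_sqrt_mult)
  qed
  ultimately show thesis by (rule that)
qed

text \<open>The hypothesis of \<open>npow_heavy_sketch_ge\<close> for N = n, where the rounding loss
  n / N is the final 1. It depends on y alone, so the net event can be restricted to points
  satisfying it.\<close>

definition spread :: "real \<Rightarrow> nat \<Rightarrow> nat \<Rightarrow> real \<Rightarrow> (nat \<Rightarrow> real) \<Rightarrow> bool" where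
  "spread p n r K y \<longleftrightarrow> 2 * real r \<le> K * npow p n y - K powr (2 / p) * (\<Sum>i<n. (y i)\<^sup>2) - 1"

text \<open>No randomness is left. If the Euclidean norm of y is at least \<beta>, then S nearly
  keeps it, the p-norm of S y dominates it, and the factor 1 / \<beta> restores size 1. Otherwise z
  is rounded to the net. The error e is small in \<open>npow\<close>, so the rounded y' keeps its
  mass; in Euclidean norm, so y' is spread; and after T, by the dilation bound, so the estimate for
  y' passes back to y.\<close>

lemma stacked_lower_bound:
  fixes p :: real
  assumes p: "1 \<le> p" "p < 2" and r2: "0 < r2" and D: "0 < D"
    and \<rho>: "(\<Sum>i<n. row_norm d V i powr p) \<le> 2 * real d"
    and y: "npow p n y = 1" and z: "\<And>i. i < n \<Longrightarrow> y i = mat_vec d V z i" "sqrt (\<Sum>j<d. (z j)\<^sup>2) powr p \<le> 2"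
    and l2: "1 / 2 * (\<Sum>i<n. (y i)\<^sup>2) \<le> (\<Sum>b<r1. (sketch n h1 w1 y b)\<^sup>2)"
    and frame: "frame_pow p r2 n d V h2 w2 \<le> L"
    and net: "\<And>k. k \<in> grid d D \<Longrightarrow> spread p n r2 K (mat_vec d V (\<lambda>j. real_of_int (k j) / real D)) \<Longrightarrow>
      1 / 768 \<le> npow p r2 (sketch n h2 w2 (mat_vec d V (\<lambda>j. real_of_int (k j) / real D)))"
    and K: "K = 48 * real r2" and \<beta>: "0 < \<beta>" "\<beta>\<^sup>2 = K powr (1 - 2 / p) / 64"
    and \<eta>: "sqrt (real d) / real D \<le> \<eta>" "\<eta> \<le> 1" "\<eta> * (2 * real d) \<le> 1 / 8"
      "\<eta>\<^sup>2 * (2 * real d) powr (2 / p) \<le> \<beta>\<^sup>2" "\<eta> * L \<le> 1 / 6144"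
  shows "1 / 8000 \<le> (1 / \<beta>) powr p * npow p r1 (sketch n h1 w1 y) + npow p r2 (sketch n h2 w2 y)"
proof (cases "\<beta>\<^sup>2 \<le> (\<Sum>i<n. (y i)\<^sup>2)")
  case True
  let ?S = "npow p r1 (sketch n h1 w1 y)"
  have "1 / 2 * \<beta>\<^sup>2 \<le> ?S powr (2 / p)"
    using True l2 sum_squares_le_npow[of p "sketch n h1 w1 y" r1] p by simp
  then have "(1 / 2 * \<beta>\<^sup>2) powr (p / 2) \<le> (?S powr (2 / p)) powr (p / 2)"
    using p by (intro powr_mono2) auto
  then have "(1 / 2) powr (p / 2) * (\<beta>\<^sup>2) powr (p / 2) \<le> ?S"
    using p by (simp add: powr_mult powr_divide powr_powr)
  then have "(1 / 2) powr (p / 2) * \<beta> powr p \<le> ?S"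
    unfolding power2_powr_half using \<beta> by simp
  then have "(1 / \<beta>) powr p * ((1 / 2) powr (p / 2) * \<beta> powr p) \<le> (1 / \<beta>) powr p * ?S"
    by (intro mult_left_mono) auto
  moreover have "(1 / \<beta>) powr p * ((1 / 2) powr (p / 2) * \<beta> powr p) = (1 / 2) powr (p / 2)"
    using \<beta> by (simp add: powr_divide)
  moreover have "(1 / 2 :: real) powr 1 \<le> (1 / 2) powr (p / 2)"
    using p by (intro powr_mono') auto
  ultimately have "1 / 2 \<le> (1 / \<beta>) powr p * ?S" by simp
  moreover have "0 \<le> npow p r2 (sketch n h2 w2 y)" by simp
  ultimately show ?thesis by linarith
next
  case False
  \<comment> \<open>Since p \<ge> 1, the bound 2 on the p-th power puts z into the ball covered by
    the grid.\<close>
  have "s \<le> 2" if "s powr p \<le> 2" for s :: real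
  proof (rule ccontr)
    assume s: "\<not> s \<le> 2"
    then have "s powr 1 \<le> s powr p" using p by (intro powr_mono) auto
    then show False using s that by simp
  qed
  from this[OF z(2)] have "sqrt (\<Sum>j<d. (z j)\<^sup>2) \<le> 2" .
  then obtain k where k: "k \<in> grid d D"
    "sqrt (\<Sum>j<d. (real_of_int (k j) / real D - z j)\<^sup>2) \<le> sqrt (real d) / real D"
    by (rule grid_approx[OF D])
  define z' where "z' j = real_of_int (k j) / real D" for j
  have z'_eq: "z' = (\<lambda>j. real_of_int (k j) / real D)" by (rule ext) (rule z'_def)
  define e where "e = mat_vec d V (\<lambda>j. z' j - z j)"
  define y' where "y' = mat_vec d V z'"
  define t where "t = sqrt (\<Sum>j<d. (z' j - z j)\<^sup>2)"
  have t: "0 \<le> t" "t \<le> \<eta>" using k \<eta> by (auto simp: t_def z'_def intro!: sum_nonneg)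
  have \<eta>0: "0 \<le> \<eta>" using t by simp
  have tp: "t powr p \<le> \<eta>"
  proof -
    have "t powr p \<le> \<eta> powr p" using t p by (intro powr_mono2) auto
    also have "\<dots> \<le> \<eta> powr 1" using \<eta> \<eta>0 p by (intro powr_mono') auto
    finally show ?thesis using \<eta>0 by simp
  qed
  have y'_eq: "y' i = y i + e i" if "i < n" for i
    using z(1)[OF that] by (simp add: y'_def e_def mat_vec_def algebra_simps sum_subtractf)
  have e1: "npow p n e \<le> 1 / 8"
  proof -
    have "npow p n e \<le> t powr p * (\<Sum>i<n. row_norm d V i powr p)"
      unfolding e_def t_def using p by (intro npow_mat_vec_le) auto
    also have "\<dots> \<le> \<eta> * (2 * real d)" using tp \<rho> \<eta>0 by (intro mult_mono) (auto intro: sum_nonneg)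
    finally show ?thesis using \<eta> by linarith
  qed
  have e2: "(\<Sum>i<n. (e i)\<^sup>2) \<le> \<beta>\<^sup>2"
  proof -
    have "(\<Sum>i<n. (e i)\<^sup>2) \<le> (\<Sum>i<n. t\<^sup>2 * (row_norm d V i)\<^sup>2)"
    proof (intro sum_mono)
      fix i
      have "\<bar>e i\<bar> \<le> \<bar>t * row_norm d V i\<bar>"
        using abs_mat_vec_le[of d V "\<lambda>j. z' j - z j" i] t by (simp add: e_def t_def mult.commute)
      then have "(e i)\<^sup>2 \<le> (t * row_norm d V i)\<^sup>2" by (simp only: abs_le_square_iff)
      then show "(e i)\<^sup>2 \<le> t\<^sup>2 * (row_norm d V i)\<^sup>2" by (simp only: power_mult_distrib)
    qed
    also have "\<dots> = t\<^sup>2 * (\<Sum>i<n. (row_norm d V i)\<^sup>2)" by (simp add: sum_distrib_left)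
    also have "\<dots> \<le> \<eta>\<^sup>2 * (2 * real d) powr (2 / p)"
    proof (intro mult_mono power_mono)
      have "(\<Sum>i<n. (row_norm d V i)\<^sup>2) \<le> npow p n (row_norm d V) powr (2 / p)"
        using p by (intro sum_squares_le_npow) auto
      also have "\<dots> \<le> (2 * real d) powr (2 / p)"
        using \<rho> p by (intro powr_mono2) (auto simp: npow_def intro: sum_nonneg)
      finally show "(\<Sum>i<n. (row_norm d V i)\<^sup>2) \<le> (2 * real d) powr (2 / p)" .
    qed (use t in \<open>auto intro: sum_nonneg\<close>)
    finally show ?thesis using \<eta> by linarith
  qed
  have y'1: "1 / 8 \<le> npow p n y'"
  proof -
    have "npow p n (\<lambda>i. y' i + (- e i)) \<le> 4 * (npow p n y' + npow p n (\<lambda>i. - e i))"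
      using p by (intro npow_add_le) auto
    moreover have "npow p n (\<lambda>i. y' i + (- e i)) = npow p n y"
      using y'_eq by (intro npow_cong) auto
    moreover have "npow p n (\<lambda>i. - e i) = npow p n e" by (simp add: npow_def)
    ultimately show ?thesis using y e1 by simp
  qed
  have y'2: "(\<Sum>i<n. (y' i)\<^sup>2) \<le> 4 * \<beta>\<^sup>2"
  proof -
    have "(\<Sum>i<n. (y' i)\<^sup>2) \<le> (\<Sum>i<n. 2 * (y i)\<^sup>2 + 2 * (e i)\<^sup>2)"
    proof (intro sum_mono)
      fix i assume "i \<in> {..<n}"
      then show "(y' i)\<^sup>2 \<le> 2 * (y i)\<^sup>2 + 2 * (e i)\<^sup>2"
        using y'_eq[of i] sum_squares_bound[of "y i" "e i"] by (simp add: power2_sum)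
    qed
    also have "\<dots> = 2 * (\<Sum>i<n. (y i)\<^sup>2) + 2 * (\<Sum>i<n. (e i)\<^sup>2)"
      by (simp add: sum.distrib sum_distrib_left)
    finally show ?thesis using False e2 by linarith
  qed
  have K0: "0 < K" using K r2 by simp
  \<comment> \<open>With \<open>npow p n y'\<close> at least 1/8 and a squared Euclidean norm at
    most \<open>K powr (1 - 2 / p) / 16\<close>, the condition follows from 2 r2 \<le> K / 8 - K /
    16 - 1 = 3 r2 - 1. Hence the constants 48 in K and 64 in \<beta>.\<close>
  have "spread p n r2 K y'"
  proof -
    have "K powr (2 / p) * K powr (1 - 2 / p) = K" using K0 by (simp flip: powr_add)
    then have "K powr (2 / p) * (4 * \<beta>\<^sup>2) = K / 16" unfolding \<beta>(2) by (simp add: field_simps)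
    moreover have "K powr (2 / p) * (\<Sum>i<n. (y' i)\<^sup>2) \<le> K powr (2 / p) * (4 * \<beta>\<^sup>2)"
      using y'2 by (intro mult_left_mono) auto
    moreover have "K * (1 / 8) \<le> K * npow p n y'" using y'1 K0 by (intro mult_left_mono) auto
    moreover have "1 \<le> real r2" using r2 by simp
    ultimately show ?thesis unfolding spread_def K by linarith
  qed
  then have T': "1 / 768 \<le> npow p r2 (sketch n h2 w2 y')"
    using net[OF k(1)] unfolding y'_def z'_eq by blast
  have "npow p r2 (sketch n h2 w2 e) \<le> t powr p * frame_pow p r2 n d V h2 w2"
    unfolding e_def t_def using p by (intro npow_sketch_le_frame_pow) auto
  also have "\<dots> \<le> \<eta> * L"
    using tp frame \<eta>0 by (intro mult_mono) (auto simp: frame_pow_def intro: sum_nonneg)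
  finally have Te: "npow p r2 (sketch n h2 w2 e) \<le> 1 / 6144" using \<eta> by linarith
  have "npow p r2 (sketch n h2 w2 y') = npow p r2 (\<lambda>b. sketch n h2 w2 y b + sketch n h2 w2 e b)"
    unfolding sketch_add[symmetric] using y'_eq by (intro npow_cong sketch_cong) auto
  also have "\<dots> \<le> 4 * (npow p r2 (sketch n h2 w2 y) + npow p r2 (sketch n h2 w2 e))"
    using p by (intro npow_add_le) auto
  \<comment> \<open>A quarter of 1/768 minus 1/6144 is 1/6144, rounded down to 1/8000.\<close>
  finally have "1 / 8000 \<le> npow p r2 (sketch n h2 w2 y)"
    using T' Te unfolding distrib_left by linarith
  moreover have "0 \<le> (1 / \<beta>) powr p * npow p r1 (sketch n h1 w1 y)" by simp
  ultimately show ?thesis by linarith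
qed

section \<open>Dilation of the CountSketch block on the subspace\<close>

text \<open>Without a heavy part the \<open>l2\<close> norm alone bounds the \<open>p\<close>-th power of the sketch by
  \<open>d powr (2 - p)\<close>, which exceeds the target \<open>d powr (p / 2)\<close> exactly for \<open>p < 4 / 3\<close>.\<close>

definition heavy_rows :: "real \<Rightarrow> nat \<Rightarrow> nat \<Rightarrow> (nat \<Rightarrow> nat \<Rightarrow> real) \<Rightarrow> nat set" where
  "heavy_rows p n d V = (if p \<le> 4 / 3 then {i. i < n \<and> 1 / real d \<le> row_norm d V i powr p} else {})"

text \<open>The row norms leave at most 2 d^2 heavy rows, which cost
  \<open>(2 * d\<^sup>2) powr (p - 1)\<close>, of order at most \<open>d powr (p / 2)\<close>
  exactly for p \<le> 4/3. The other rows are light with k = d / 2; then r / k is of order d and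
  costs \<open>d powr (1 - p / 2)\<close>, harmless for p \<ge> 1. For p > 4/3 no row is heavy, k =
  1, and the cost is \<open>d powr (2 - p)\<close>.\<close>

lemma light_part_bound:
  fixes p :: real
  assumes p: "1 \<le> p" "p < 2" and d: "2 \<le> d" and h: "h \<in> hashes n r" and \<epsilon>: "\<epsilon> \<in> signs n"
    and r: "r = 8000 * d\<^sup>2"
    and \<rho>: "(\<Sum>i<n. row_norm d V i powr p) \<le> 2 * real d"
    and z: "\<And>i. i < n \<Longrightarrow> y i = mat_vec d V z i" "sqrt (\<Sum>j<d. (z j)\<^sup>2) powr p \<le> 2 * npow p n y"
    and l2: "(\<Sum>b<r. (sketch n h \<epsilon> (\<lambda>i. if i \<in> heavy_rows p n d V then 0 else y i) b)\<^sup>2)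
        \<le> 2 * (\<Sum>i<n. (if i \<in> heavy_rows p n d V then 0 else y i)\<^sup>2)"
  shows "npow p r (sketch n h \<epsilon> y) \<le> 300000 * real d powr (p / 2) * npow p n y"
proof -
  let ?H = "heavy_rows p n d V"
  have r0: "0 < r" using r d by simp
  have d1: "1 \<le> real d" using d by simp
  have Y0: "0 \<le> npow p n y" by simp
  have finH: "finite ?H" by (simp add: heavy_rows_def)
  have pw: "x powr e \<le> x" if "1 \<le> x" "e \<le> 1" for x e :: real
    using powr_mono[of e 1 x] that by simp
  have dmono: "real d powr e \<le> real d powr (p / 2)" if "e \<le> p / 2" for e
    using that d1 by (intro powr_mono) auto
  show ?thesis
  proof (cases "p \<le> 4 / 3")
    case True
    have cardH: "real (card ?H) \<le> 2 * (real d)\<^sup>2"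
    proof -
      have "(\<Sum>i\<in>?H. 1 / real d) \<le> (\<Sum>i\<in>?H. row_norm d V i powr p)"
        using True by (intro sum_mono) (auto simp: heavy_rows_def)
      also have "\<dots> \<le> (\<Sum>i<n. row_norm d V i powr p)"
        by (intro sum_mono2) (auto simp: heavy_rows_def)
      finally have "real (card ?H) / real d \<le> 2 * real d" using \<rho> by simp
      then show ?thesis using d by (simp add: field_simps power2_eq_square)
    qed
    have light: "\<bar>y i\<bar> powr p \<le> npow p n y / (real d / 2)" if i: "i < n" "i \<notin> ?H" for i
    proof -
      have "\<bar>y i\<bar> powr p \<le> (row_norm d V i * sqrt (\<Sum>j<d. (z j)\<^sup>2)) powr p"
        using z(1)[OF i(1)] abs_mat_vec_le p by (intro powr_mono2) auto
      also have "\<dots> = row_norm d V i powr p * sqrt (\<Sum>j<d. (z j)\<^sup>2) powr p"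
        by (simp add: powr_mult sum_nonneg)
      also have "\<dots> \<le> 1 / real d * (2 * npow p n y)"
        using z(2) i True by (intro mult_mono) (auto simp: heavy_rows_def)
      finally show ?thesis by (simp add: mult.commute)
    qed
    have "npow p r (sketch n h \<epsilon> y) \<le> 16 * ((2 * (real d)\<^sup>2) powr (p - 1) + (real r / (real d / 2)) powr (1 - p / 2)) * npow p n y"
      using d by (intro npow_sketch_signs_le[OF h \<epsilon> r0 p _ finH cardH light l2]) auto
    also have "\<dots> \<le> 16 * (2 * real d powr (p / 2) + 16000 * real d powr (p / 2)) * npow p n y"
    proof (intro mult_right_mono mult_left_mono add_mono)
      have "(2 * (real d)\<^sup>2) powr (p - 1) = 2 powr (p - 1) * real d powr (2 * (p - 1))"
        using d1 by (simp add: powr_mult powr_powr flip: powr_numeral)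
      also have "\<dots> \<le> 2 * real d powr (p / 2)"
        using pw[of 2 "p - 1"] p True by (intro mult_mono dmono) auto
      finally show "(2 * (real d)\<^sup>2) powr (p - 1) \<le> 2 * real d powr (p / 2)" .
      have "real r / (real d / 2) = 16000 * real d" using d by (simp add: r power2_eq_square)
      then have "(real r / (real d / 2)) powr (1 - p / 2) = 16000 powr (1 - p / 2) * real d powr (1 - p / 2)"
        using d1 by (simp add: powr_mult)
      also have "\<dots> \<le> 16000 * real d powr (p / 2)"
        using pw[of 16000 "1 - p / 2"] p by (intro mult_mono dmono) auto
      finally show "(real r / (real d / 2)) powr (1 - p / 2) \<le> 16000 * real d powr (p / 2)" .
    qed auto
    also have "\<dots> \<le> 300000 * real d powr (p / 2) * npow p n y"
      using Y0 by (intro mult_right_mono) auto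
    finally show ?thesis .
  next
    case False
    have H: "?H = {}" using False by (simp add: heavy_rows_def)
    have light: "\<bar>y i\<bar> powr p \<le> npow p n y / 1" if "i < n" "i \<notin> ?H" for i
      using npow_coord_le[of i n y p] that by simp
    have cardH: "real (card ?H) \<le> 0" by (simp add: H)
    \<comment> \<open>No heavy rows: m = 0, and \<open>0 powr (p - 1) = 0\<close> removes their
      term.\<close>
    have "npow p r (sketch n h \<epsilon> y) \<le> 16 * (0 powr (p - 1) + (real r / 1) powr (1 - p / 2)) * npow p n y"
      by (intro npow_sketch_signs_le[OF h \<epsilon> r0 p _ finH cardH light l2]) auto
    also have "\<dots> \<le> 16 * (0 + 8000 * real d powr (p / 2)) * npow p n y"
    proof (intro mult_right_mono mult_left_mono add_mono)
      have "(real r / 1) powr (1 - p / 2) = 8000 powr (1 - p / 2) * real d powr (2 * (1 - p / 2))"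
        using d1 by (simp add: r powr_mult powr_powr flip: powr_numeral)
      also have "\<dots> \<le> 8000 * real d powr (p / 2)"
        using pw[of 8000 "1 - p / 2"] p False by (intro mult_mono dmono) auto
      finally show "(real r / 1) powr (1 - p / 2) \<le> 8000 * real d powr (p / 2)" .
    qed auto
    also have "\<dots> \<le> 300000 * real d powr (p / 2) * npow p n y"
      using Y0 by (intro mult_right_mono) auto
    finally show ?thesis .
  qed
qed

lemma half_le_ln: "2 \<le> d \<Longrightarrow> 1 / 2 \<le> ln (real d)" for d :: nat
proof -
  assume d: "2 \<le> d"
  have "exp (1 / 2 :: real) * exp (1 / 2) \<le> 2 * 2"
    using exp_le by (simp flip: exp_add)
  then have "exp (1 / 2 :: real) \<le> 2"
    by (metis abs_of_pos exp_gt_zero power2_eq_square power2_le_imp_le zero_le_numeral)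
  then have "exp (1 / 2) \<le> real d" using d by linarith
  then have "ln (exp (1 / 2)) \<le> ln (real d)" using d by (subst ln_le_cancel_iff) auto
  then show ?thesis by (simp only: ln_exp)
qed

text \<open>The number r of rows occurs on both sides, since the fineness of the net is a power of
  r. With x = r / d the circle breaks: ln x is at most x / 160 + ln 160, and ln d is at most x / 160
  once C \<ge> 160. The remaining constants M are absorbed by the summand 40 * M of C.\<close>

lemma net_size_bound:
  fixes B :: nat
  assumes B: "0 < B"
  obtains C :: real where "2 \<le> C"
    "\<And>d r :: nat. 2 \<le> d \<Longrightarrow> C * (real d * ln (real d)) \<le> real r \<Longrightarrow>
      real d * ln (5 * real B * real r ^ 4) + ln 1000 \<le> real r / 10"
proof -
  define M :: real where "M = ln (5 * real B) + 4 * ln 160 + ln 1000"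
  have M0: "0 \<le> M" using B by (simp add: M_def)
  define C where "C = 160 + 40 * M"
  show thesis
  proof (rule that[of C])
    show "2 \<le> C" using M0 by (simp add: C_def)
    fix d r :: nat
    assume d: "2 \<le> d" and r: "C * (real d * ln (real d)) \<le> real r"
    define x where "x = real r / real d"
    have d0: "0 < real d" using d by simp
    have lnd: "1 / 2 \<le> ln (real d)" using half_le_ln[OF d] .
    have xC: "C * ln (real d) \<le> x" using r d0 by (simp add: x_def field_simps)
    have C0: "0 < C" using M0 by (simp add: C_def)
    have "C * (1 / 2) \<le> x" using mult_left_mono[OF lnd, of C] xC C0 by linarith
    then have x0: "80 + 20 * M \<le> x" by (simp add: C_def)
    then have xpos: "0 < x" using M0 by linarith
    have r_eq: "real r = x * real d" using d0 by (simp add: x_def)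
    have lnx: "ln x \<le> x / 160 + ln 160"
    proof -
      have "ln (x / 160) \<le> x / 160 - 1" using xpos by (intro ln_le_minus_one) auto
      then show ?thesis using xpos by (simp add: ln_div)
    qed
    have lnd2: "4 * ln (real d) \<le> x / 40"
    proof -
      have "160 * ln (real d) \<le> C * ln (real d)" using M0 lnd by (intro mult_right_mono) (auto simp: C_def)
      then show ?thesis using xC by linarith
    qed
    have "ln (5 * real B * real r ^ 4) = ln (5 * real B) + 4 * (ln x + ln (real d))"
      using B xpos d0 unfolding r_eq by (simp add: ln_mult ln_realpow)
    then have "ln (5 * real B * real r ^ 4) + ln 1000 \<le> M + x / 40 + x / 40"
      using lnx lnd2 unfolding M_def distrib_left by linarith
    also have "\<dots> \<le> x / 10" using x0 M0 by linarith
    finally have "real d * (ln (5 * real B * real r ^ 4) + ln 1000) \<le> real d * (x / 10)"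
      using d0 by (intro mult_left_mono) auto
    then have "real d * ln (5 * real B * real r ^ 4) + real d * ln 1000 \<le> real r / 10"
      unfolding distrib_left r_eq by (simp add: mult.commute)
    moreover have "1 * ln 1000 \<le> real d * ln (1000::real)" using d by (intro mult_right_mono) auto
    ultimately show "real d * ln (5 * real B * real r ^ 4) + ln 1000 \<le> real r / 10" by linarith
  qed
qed

section \<open>Choice of the parameters\<close>

text \<open>As \<eta> is a negative power of r2, crude bounds suffice: d \<le> r2, ln t \<le> t, and
  \<open>K powr (1 - 2 / p) \<ge> 1 / K\<close> because p \<ge> 1. The integer B absorbs the
  numerical constants in L, and the extra factor r2 in the mesh absorbs the square root of
  d.\<close>

lemma lower_parameters:
  fixes p Cq :: real and B r2 d :: nat
  assumes p: "1 \<le> p" "p < 2" and Cq: "0 \<le> Cq" and d: "1 \<le> d" "d \<le> r2"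
    and B: "6144 * (4000 * (Cq + 2002)) \<le> real B"
    and L: "L = 2000 * (real d + 2 * real d * (Cq + 1 + ln (2000 * real r2)))"
    and \<eta>: "\<eta> = 1 / (real B * real r2 ^ 3)"
  shows "sqrt (real d) / real (B * r2 ^ 4) \<le> \<eta>" "\<eta> \<le> 1" "\<eta> * (2 * real d) \<le> 1 / 8"
    "\<eta>\<^sup>2 * (2 * real d) powr (2 / p) \<le> (48 * real r2) powr (1 - 2 / p) / 64" "\<eta> * L \<le> 1 / 6144"
proof -
  have r: "1 \<le> real r2" and dr: "real d \<le> real r2" and d1: "1 \<le> real d" using d by auto
  have B128: "128 \<le> real B" using B Cq unfolding distrib_left by linarith
  have B0: "0 < real B" using B128 by linarith
  have r3: "1 \<le> real r2 ^ 3" using r by simp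
  have rr3: "real r2 \<le> real r2 ^ 3" using r power_increasing[of 1 3 "real r2"] by simp
  show "sqrt (real d) / real (B * r2 ^ 4) \<le> \<eta>"
  proof -
    have "sqrt (real d) \<le> real r2"
      using dr d1 real_sqrt_le_mono[of "real d" "(real r2)\<^sup>2"] r
      by (smt (verit) mult_le_cancel_left1 power2_eq_square real_sqrt_abs2 real_sqrt_le_iff)
    then have "sqrt (real d) / real (B * r2 ^ 4) \<le> real r2 / real (B * r2 ^ 4)"
      by (intro divide_right_mono) auto
    also have "\<dots> = \<eta>" using r by (simp add: \<eta> power_eq_if)
    finally show ?thesis .
  qed
  have "1 * 1 \<le> real B * real r2 ^ 3" using B128 r3 by (intro mult_mono) auto
  then show "\<eta> \<le> 1" by (simp add: \<eta>)
  have "128 * real d \<le> real B * real r2 ^ 3" using B128 dr rr3 d1 by (intro mult_mono) auto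
  then show "\<eta> * (2 * real d) \<le> 1 / 8" using B0 r by (simp add: \<eta> field_simps)
  show "\<eta>\<^sup>2 * (2 * real d) powr (2 / p) \<le> (48 * real r2) powr (1 - 2 / p) / 64"
  proof -
    have "(2 * real d) powr (2 / p) \<le> (2 * real d) powr 2"
      using d1 p by (intro powr_mono) (auto simp: field_simps)
    also have "\<dots> = (2 * real d)\<^sup>2" using d1 by simp
    also have "\<dots> \<le> (2 * real r2)\<^sup>2" using dr by (intro power_mono) auto
    finally have "\<eta>\<^sup>2 * (2 * real d) powr (2 / p) \<le> \<eta>\<^sup>2 * (2 * real r2)\<^sup>2"
      by (intro mult_left_mono) auto
    also have "\<dots> = 4 / ((real B)\<^sup>2 * real r2 ^ 4)"
      using r B0 by (simp add: \<eta> power_eq_if field_simps)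
    also have "\<dots> \<le> 1 / (48 * real r2) / 64"
    proof -
      have "128 * 128 \<le> real B * real B" using B128 by (intro mult_mono) auto
      then have "12288 * real r2 \<le> (real B)\<^sup>2 * real r2 ^ 4"
        using r power_increasing[of 1 4 "real r2"] unfolding power2_eq_square by (intro mult_mono) auto
      then show ?thesis using B0 r by (simp add: field_simps)
    qed
    also have "1 / (48 * real r2) = (48 * real r2) powr (- 1)" using r by (simp add: powr_minus_divide)
    also have "(48 * real r2) powr (- 1) / 64 \<le> (48 * real r2) powr (1 - 2 / p) / 64"
      using r p by (intro divide_right_mono powr_mono) (auto simp: field_simps)
    finally show ?thesis .
  qed
  have ln: "ln (2000 * real r2) \<le> 2000 * real r2"
    using ln_le_minus_one[of "2000 * real r2"] r by simp
  have "L \<le> 2000 * (real r2 * (2 * ((Cq + 2002) * real r2)))"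
  proof -
    have "real d + 2 * real d * (Cq + 1 + ln (2000 * real r2)) = real d * (1 + 2 * (Cq + 1 + ln (2000 * real r2)))"
      by (simp add: algebra_simps)
    also have "\<dots> \<le> real r2 * (2 * ((Cq + 2002) * real r2))"
    proof (intro mult_mono dr)
      have "Cq * 1 \<le> Cq * real r2" using r Cq by (intro mult_left_mono) auto
      then have "1 + 2 * (Cq + 1 + 2000 * real r2) \<le> 2 * ((Cq + 2002) * real r2)"
        using r unfolding distrib_left distrib_right by linarith
      then show "1 + 2 * (Cq + 1 + ln (2000 * real r2)) \<le> 2 * ((Cq + 2002) * real r2)"
        using ln unfolding distrib_left by linarith
      show "0 \<le> 1 + 2 * (Cq + 1 + ln (2000 * real r2))" using Cq r by simp
    qed simp
    finally show ?thesis unfolding L by simp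
  qed
  also have "\<dots> = 4000 * (Cq + 2002) * (real r2 * real r2)" by simp
  also have "\<dots> \<le> 4000 * (Cq + 2002) * real r2 ^ 3"
    using r Cq by (intro mult_left_mono) (auto simp: power_eq_if mult_le_cancel_left1)
  finally have "6144 * L \<le> 6144 * (4000 * (Cq + 2002) * real r2 ^ 3)" by (rule mult_left_mono) simp
  also have "\<dots> = (6144 * (4000 * (Cq + 2002))) * real r2 ^ 3" by (simp only: mult.assoc)
  also have "\<dots> \<le> real B * real r2 ^ 3" using B by (intro mult_right_mono) auto
  finally show "\<eta> * L \<le> 1 / 6144" using B0 r by (simp add: \<eta> field_simps)
qed

text \<open>With X = d ln d, \<open>(1 / \<beta>) powr p\<close> is
  O(\<open>X powr (1 - p / 2)\<close>) and \<open>d powr (p / 2)\<close> is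
  O(\<open>X powr (p / 2)\<close>), so their product is O(X). In L the logarithm is O(ln d), because
  r2 is O(d^2).\<close>

lemma upper_parameters:
  fixes p Cq C1 :: real and r2 d :: nat
  assumes p: "1 \<le> p" "p < 2" and Cq: "0 \<le> Cq" and d: "2 \<le> d" and C1: "2 \<le> C1" and r0: "0 < r2"
    and r2: "real r2 \<le> C1 * (real d * ln (real d)) + 1"
    and L: "L = 2000 * (real d + 2 * real d * (Cq + 1 + ln (2000 * real r2)))"
    and \<beta>: "0 < \<beta>" "\<beta>\<^sup>2 = (48 * real r2) powr (1 - 2 / p) / 64"
  shows "(1 / \<beta>) powr p * (300000 * real d powr (p / 2)) + 2 * L
    \<le> (64 * (48 * (C1 + 1)) * 600000 + 4000 * (4 * Cq + 10 + 4 * ln (2000 * (C1 + 1)))) * (real d * ln (real d))"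
proof -
  define X where "X = real d * ln (real d)"
  have lnd: "1 / 2 \<le> ln (real d)" using half_le_ln[OF d] .
  have dX: "real d \<le> 2 * X" using mult_left_mono[OF lnd, of "2 * real d"] by (simp add: X_def)
  have X1: "1 \<le> X" using dX d by linarith
  have r2X: "real r2 \<le> (C1 + 1) * X" using r2 X1 unfolding X_def[symmetric] distrib_right by linarith
  have pw: "x powr e \<le> x" if "1 \<le> x" "e \<le> 1" for x e :: real
    using powr_mono[of e 1 x] that by simp
  have "(1 / \<beta>) powr p = (\<beta>\<^sup>2) powr (- (p / 2))"
    using \<beta>(1) power2_powr_half[of \<beta> "- p"] by (simp add: powr_divide powr_minus_divide)
  also have "\<dots> = 64 powr (p / 2) * (48 * real r2) powr (1 - p / 2)"
  proof -
    have "(1 - 2 / p) * - (p / 2) = 1 - p / 2" using p by (simp add: field_simps)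
    then have "((48 * real r2) powr (1 - 2 / p)) powr - (p / 2) = (48 * real r2) powr (1 - p / 2)"
      by (simp only: powr_powr)
    moreover have "(x / 64) powr - (p / 2) = 64 powr (p / 2) * x powr - (p / 2)" if "0 \<le> x" for x :: real
      using that by (simp add: powr_divide powr_minus_divide)
    ultimately show ?thesis unfolding \<beta>(2) by simp
  qed
  also have "\<dots> \<le> 64 * (48 * ((C1 + 1) * X)) powr (1 - p / 2)"
    using pw[of 64 "p / 2"] p r2X by (intro mult_mono powr_mono2) auto
  also have "(48 * ((C1 + 1) * X)) powr (1 - p / 2) = (48 * (C1 + 1)) powr (1 - p / 2) * X powr (1 - p / 2)"
    using C1 X1 by (simp add: mult.assoc[symmetric] powr_mult)
  also have "64 * ((48 * (C1 + 1)) powr (1 - p / 2) * X powr (1 - p / 2)) \<le> 64 * ((48 * (C1 + 1)) * X powr (1 - p / 2))"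
    using pw[of "48 * (C1 + 1)" "1 - p / 2"] C1 p by (intro mult_left_mono mult_right_mono) auto
  finally have \<alpha>: "(1 / \<beta>) powr p \<le> 64 * ((48 * (C1 + 1)) * X powr (1 - p / 2))" .
  have dp: "real d powr (p / 2) \<le> 2 * X powr (p / 2)"
  proof -
    have "real d powr (p / 2) \<le> (2 * X) powr (p / 2)" using dX p by (intro powr_mono2) auto
    also have "\<dots> \<le> 2 * X powr (p / 2)"
      using pw[of 2 "p / 2"] p X1 by (simp add: powr_mult)
    finally show ?thesis .
  qed
  have "(1 / \<beta>) powr p * (300000 * real d powr (p / 2))
      \<le> (64 * ((48 * (C1 + 1)) * X powr (1 - p / 2))) * (300000 * (2 * X powr (p / 2)))"
    using \<alpha> dp C1 by (intro mult_mono) auto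
  also have "\<dots> = 64 * (48 * (C1 + 1)) * 600000 * (X powr (1 - p / 2) * X powr (p / 2))" by simp
  also have "X powr (1 - p / 2) * X powr (p / 2) = X" using X1 by (simp flip: powr_add)
  finally have 1: "(1 / \<beta>) powr p * (300000 * real d powr (p / 2)) \<le> 64 * (48 * (C1 + 1)) * 600000 * X" .
  define l where "l = ln (2000 * (C1 + 1))"
  have l0: "0 \<le> l" using C1 by (simp add: l_def)
  have "X \<le> real d * real d" unfolding X_def using ln_le_minus_one[of "real d"] d
    by (intro mult_left_mono) auto
  then have "2000 * real r2 \<le> 2000 * ((C1 + 1) * (real d * real d))"
    using r2X C1 by (smt (verit) mult_left_mono)
  then have "ln (2000 * real r2) \<le> ln (2000 * ((C1 + 1) * (real d * real d)))"
    using r0 C1 d by (subst ln_le_cancel_iff) auto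
  also have "\<dots> = ln ((2000 * (C1 + 1)) * (real d * real d))" by (simp only: mult.assoc)
  also have "\<dots> = l + ln (real d * real d)" unfolding l_def using C1 d by (intro ln_mult_pos) auto
  also have "ln (real d * real d) = 2 * ln (real d)" using d by (simp add: ln_mult)
  finally have lnr: "ln (2000 * real r2) \<le> l + 2 * ln (real d)" .
  have "real d + 2 * real d * (Cq + 1 + ln (2000 * real r2))
      \<le> real d + 2 * real d * (Cq + 1 + (l + 2 * ln (real d)))"
    using lnr by (intro add_left_mono mult_left_mono) auto
  also have "\<dots> = real d * (2 * Cq + 3 + 2 * l) + 4 * X" by (simp add: X_def algebra_simps)
  also have "\<dots> \<le> (2 * X) * (2 * Cq + 3 + 2 * l) + 4 * X"
    using dX Cq l0 by (intro add_right_mono mult_right_mono) auto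
  also have "\<dots> = (4 * Cq + 10 + 4 * l) * X" by (simp add: algebra_simps)
  finally have "2 * L \<le> 4000 * ((4 * Cq + 10 + 4 * l) * X)" unfolding L by simp
  with 1 show ?thesis unfolding X_def[symmetric] l_def[symmetric] by (simp add: distrib_right)
qed

section \<open>The embedding theorem\<close>

lemma prob_map_pmf_of_set_ge:
  assumes \<Omega>: "finite \<Omega>" "\<Omega> \<noteq> {}" and bad: "avg \<Omega> (\<lambda>\<omega>. of_bool (\<not> good \<omega>)) \<le> 1 / 100"
    and S: "\<And>\<omega>. \<omega> \<in> \<Omega> \<Longrightarrow> good \<omega> \<Longrightarrow> F \<omega> \<in> S"
  shows "99 / 100 \<le> measure (measure_pmf (map_pmf F (pmf_of_set \<Omega>))) S"
proof -
  have "1 - avg \<Omega> (\<lambda>\<omega>. of_bool (\<not> good \<omega>)) = avg \<Omega> (\<lambda>\<omega>. 1 - of_bool (\<not> good \<omega>))"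
    using \<Omega> by (simp add: avg_diff)
  also have "\<dots> \<le> avg \<Omega> (\<lambda>\<omega>. of_bool (F \<omega> \<in> S))" using S by (intro avg_mono) auto
  also have "\<dots> = real (card (\<Omega> \<inter> F -` S)) / real (card \<Omega>)"
    using \<Omega> by (simp add: avg_def vimage_def)
  also have "\<dots> = measure (measure_pmf (map_pmf F (pmf_of_set \<Omega>))) S"
    using \<Omega> by (simp add: measure_pmf_of_set)
  finally show ?thesis using bad by linarith
qed

lemma avg_Times_fst: "finite B \<Longrightarrow> B \<noteq> {} \<Longrightarrow> avg (A \<times> B) (\<lambda>\<omega>. f (fst \<omega>)) = avg A f"
  unfolding avg_Times by simp

lemma avg_Times_snd: "finite A \<Longrightarrow> A \<noteq> {} \<Longrightarrow> avg (A \<times> B) (\<lambda>\<omega>. f (snd \<omega>)) = avg B f"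
  unfolding avg_Times by simp

text \<open>Each spread net point fails with probability at most exp (- r / 10), and at most (5 D)^d
  points compete. The threshold 1/768 is r / (16 K) for K = 48 r.\<close>

lemma avg_net_failure_le:
  fixes p :: real
  assumes p: "1 \<le> p" "p < 2" and r: "0 < r" and n: "0 < n" and D: "0 < D"
    and size: "real d * ln (5 * real D) + ln 1000 \<le> real r / 10"
  shows "avg (hashes n r \<times> signs n \<times> levels n n) (\<lambda>(h, \<epsilon>, u). of_bool (\<not> (\<forall>k\<in>grid d D.
      spread p n r (48 * real r) (mat_vec d V (\<lambda>j. real_of_int (k j) / real D)) \<longrightarrow>
      1 / 768 \<le> npow p r (sketch n h (heavy_weights p n \<epsilon> u) (mat_vec d V (\<lambda>j. real_of_int (k j) / real D))))))
    \<le> 1 / 1000"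
proof -
  define y where "y k = mat_vec d V (\<lambda>j. real_of_int (k j) / real D)" for k :: "nat \<Rightarrow> int"
  define K where "K = 48 * real r"
  let ?\<Omega> = "hashes n r \<times> signs n \<times> levels n n"
  define fail where "fail k \<omega> \<longleftrightarrow> spread p n r K (y k) \<and>
    npow p r (sketch n (fst \<omega>) (heavy_weights p n (fst (snd \<omega>)) (snd (snd \<omega>))) (y k)) < 1 / 768" for k \<omega>
  have K: "0 < K" "real r / (16 * K) = 1 / 768" using r by (auto simp: K_def)
  have each: "avg ?\<Omega> (\<lambda>\<omega>. of_bool (fail k \<omega>)) \<le> exp (- (real r / 10))" for k
  proof (cases "spread p n r K (y k)")
    case True
    then have "2 * real r \<le> K * npow p n (y k) - K powr (2 / p) * (\<Sum>i<n. (y k i)\<^sup>2) - real n / real n"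
      using n by (simp add: spread_def)
    from npow_heavy_sketch_ge[OF p r n K(1) this] show ?thesis
      unfolding avg_Times K(2) using True by (simp add: fail_def)
  next
    case False
    then have "avg ?\<Omega> (\<lambda>\<omega>. of_bool (fail k \<omega>)) = avg ?\<Omega> (\<lambda>\<omega>. 0)" by (simp add: fail_def)
    also have "\<dots> = 0" by (simp add: avg_def)
    finally show ?thesis by simp
  qed
  have "avg ?\<Omega> (\<lambda>(h, \<epsilon>, u). of_bool (\<not> (\<forall>k\<in>grid d D.
      spread p n r K (y k) \<longrightarrow> 1 / 768 \<le> npow p r (sketch n h (heavy_weights p n \<epsilon> u) (y k)))))
    = avg ?\<Omega> (\<lambda>\<omega>. of_bool (\<exists>k\<in>grid d D. fail k \<omega>))"
    by (intro avg_cong) (auto simp: fail_def not_le)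
  also have "\<dots> \<le> (\<Sum>k\<in>grid d D. avg ?\<Omega> (\<lambda>\<omega>. of_bool (fail k \<omega>)))"
    by (rule avg_union_bound) simp
  also have "\<dots> \<le> (\<Sum>k\<in>grid d D. exp (- (real r / 10)))" by (intro sum_mono each)
  also have "\<dots> = real (4 * D + 1) ^ d * exp (- (real r / 10))" by (simp add: card_grid)
  also have "\<dots> \<le> (5 * real D) ^ d * exp (- (real r / 10))"
    using D by (intro mult_right_mono power_mono) auto
  also have "(5 * real D) ^ d = exp (real d * ln (5 * real D))"
    using D by (simp add: exp_of_nat_mult)
  also have "\<dots> * exp (- (real r / 10)) \<le> exp (- ln 1000)"
    unfolding exp_add[symmetric] using size by simp
  also have "\<dots> = 1 / 1000" by (simp add: exp_minus)
  finally show ?thesis unfolding K_def y_def .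
qed

lemma mat_vec_scale: "mat_vec d A (\<lambda>j. s * x j) = (\<lambda>i. s * mat_vec d A x i)"
  unfolding mat_vec_def by (simp add: sum_distrib_left ac_simps)

theorem theorem5:
  fixes p :: real
  assumes "1 \<le> p" and "p < 2"
  shows "\<exists>c C. c > 0 \<and> C > 0 \<and>
    (\<forall>d n :: nat. d \<ge> 2 \<longrightarrow> n \<ge> 1 \<longrightarrow>
      (\<exists>(r :: nat) (M :: (nat \<Rightarrow> nat \<Rightarrow> real) measure).
         real r \<le> C * real d ^ 2 \<and> prob_space M \<and>
         (AE P in M. two_sparse_cols r n P) \<and>
         (\<forall>A :: nat \<Rightarrow> nat \<Rightarrow> real.
            \<exists>E \<in> sets M. measure M E \<ge> 0.99 \<and>
              (\<forall>P \<in> E. \<forall>x :: nat \<Rightarrow> real.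
                 c * lp_norm p n (mat_vec d A x)
                   \<le> lp_norm p r (mat_vec n P (mat_vec d A x)) \<and>
                 lp_norm p r (mat_vec n P (mat_vec d A x))
                   \<le> C * (real d * ln (real d)) powr (1 / p) * lp_norm p n (mat_vec d A x)))))"
proof -
  have p: "1 \<le> p" "p < 2" by fact+
  define Cq where "Cq = 2 powr (2 / p) / (2 / p - 1)"
  have Cq: "0 \<le> Cq" using p by (simp add: Cq_def)
  define B where "B = nat \<lceil>6144 * (4000 * (Cq + 2002))\<rceil>"
  have B: "6144 * (4000 * (Cq + 2002)) \<le> real B" unfolding B_def by linarith
  then have "0 < real B" using Cq unfolding distrib_left by linarith
  then have B0: "0 < B" by simp
  obtain C1 :: real where C1: "2 \<le> C1"
    "\<And>d r :: nat. 2 \<le> d \<Longrightarrow> C1 * (real d * ln (real d)) \<le> real r \<Longrightarrow>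
      real d * ln (5 * real B * real r ^ 4) + ln 1000 \<le> real r / 10"
    by (rule net_size_bound[OF B0]) (rule that)
  define Cu where "Cu = 64 * (48 * (C1 + 1)) * 600000 + 4000 * (4 * Cq + 10 + 4 * ln (2000 * (C1 + 1)))"
  define c where "c = (1 / 8000) powr (1 / p)"
  \<comment> \<open>One constant serves both claims: 8000 + (C1 + 1) for the rows of the two blocks,
    the last summand for the dilation.\<close>
  define C where "C = 8000 + (C1 + 1) + Cu powr (1 / p)"
  have C: "0 < C" "8000 + (C1 + 1) \<le> C" "Cu powr (1 / p) \<le> C" 
    unfolding C_def using C1(1) powr_ge_zero[of Cu "1 / p"] by linarith+

  have main: "\<exists>(r :: nat) (M :: (nat \<Rightarrow> nat \<Rightarrow> real) measure).
         real r \<le> C * real d ^ 2 \<and> prob_space M \<and>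
         (AE P in M. two_sparse_cols r n P) \<and>
         (\<forall>A :: nat \<Rightarrow> nat \<Rightarrow> real.
            \<exists>E \<in> sets M. measure M E \<ge> 0.99 \<and>
              (\<forall>P \<in> E. \<forall>x :: nat \<Rightarrow> real.
                 c * lp_norm p n (mat_vec d A x)
                   \<le> lp_norm p r (mat_vec n P (mat_vec d A x)) \<and>
                 lp_norm p r (mat_vec n P (mat_vec d A x))
                   \<le> C * (real d * ln (real d)) powr (1 / p) * lp_norm p n (mat_vec d A x)))"
    if d: "2 \<le> d" and n: "1 \<le> n" for d n :: nat
  proof -
    define X where "X = real d * ln (real d)"
    have lnd: "1 / 2 \<le> ln (real d)" using half_le_ln[OF d] .
    have dX: "real d \<le> 2 * X" using mult_left_mono[OF lnd, of "2 * real d"] by (simp add: X_def)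
    have X1: "1 \<le> X" using dX d by linarith
    \<comment> \<open>Makes the failure bound 8 d^2 / r1 of \<open>l2_embedding\<close> equal to
      1/1000.\<close>
    define r1 where "r1 = 8000 * d\<^sup>2"
    define r2 where "r2 = nat \<lceil>C1 * X\<rceil>"
    have r1: "0 < r1" using d by (simp add: r1_def)
    have C1X: "2 * X \<le> C1 * X" using C1 X1 by (intro mult_right_mono) auto
    have r2_ge: "C1 * X \<le> real r2" unfolding r2_def by linarith
    have r2_le: "real r2 \<le> C1 * X + 1" unfolding r2_def using C1X X1 by linarith
    have dr2: "d \<le> r2" using dX C1X r2_ge by linarith
    then have r2: "0 < r2" using d by simp
    define K where "K = 48 * real r2"
    have K: "0 < K" using r2 by (simp add: K_def)
    define \<beta> where "\<beta> = sqrt (K powr (1 - 2 / p) / 64)"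
    have \<beta>: "0 < \<beta>" "\<beta>\<^sup>2 = K powr (1 - 2 / p) / 64" using K by (auto simp: \<beta>_def)
    define D where "D = B * r2 ^ 4"
    have D: "0 < D" using B0 r2 by (simp add: D_def)
    define \<eta> where "\<eta> = 1 / (real B * real r2 ^ 3)"
    define L where "L = 2000 * (real d + 2 * real d * (Cq + 1 + ln (2000 * real r2)))"
    have L: "0 < L" using d r2 Cq by (auto simp: L_def intro!: add_pos_nonneg)
    note lower = lower_parameters[OF p Cq _ dr2 B L_def \<eta>_def]
    have upper: "(1 / \<beta>) powr p * (300000 * real d powr (p / 2)) + 2 * L \<le> Cu * X"
      unfolding Cu_def X_def
      by (rule upper_parameters[OF p Cq d C1(1) r2 r2_le[unfolded X_def] L_def \<beta>(1) \<beta>(2)[unfolded K_def]])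
    define \<Omega>\<^sub>1 where "\<Omega>\<^sub>1 = hashes n r1 \<times> signs n"
    \<comment> \<open>As many levels as coordinates, so that the rounding loss n / N is 1.\<close>
    define \<Omega>\<^sub>2 where "\<Omega>\<^sub>2 = hashes n r2 \<times> signs n \<times> levels n n"
    define \<Omega> where "\<Omega> = \<Omega>\<^sub>1 \<times> \<Omega>\<^sub>2"
    have \<Omega>1: "finite \<Omega>\<^sub>1" "\<Omega>\<^sub>1 \<noteq> {}" using r1 by (auto simp: \<Omega>\<^sub>1_def)
    have \<Omega>2: "finite \<Omega>\<^sub>2" "\<Omega>\<^sub>2 \<noteq> {}" using r2 n by (auto simp: \<Omega>\<^sub>2_def)
    have \<Omega>: "finite \<Omega>" "\<Omega> \<noteq> {}" using \<Omega>1 \<Omega>2 by (auto simp: \<Omega>_def)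
    define F where "F = (\<lambda>((h1, \<epsilon>1), (h2, \<epsilon>2, u)). stacked r1 (1 / \<beta>) h1 \<epsilon>1 h2 (heavy_weights p n \<epsilon>2 u))"
    \<comment> \<open>Fixed before A: the Lewis basis, the heavy rows and the net enter the analysis
      only.\<close>
    define M where "M = measure_pmf (map_pmf F (pmf_of_set \<Omega>))"
    have rows: "real (r1 + r2) \<le> C * real d ^ 2"
    proof -
      have "X \<le> real d * real d" unfolding X_def using ln_le_minus_one[of "real d"] d
        by (intro mult_left_mono) auto
      then have "(C1 + 1) * X \<le> (C1 + 1) * (real d)\<^sup>2"
        unfolding power2_eq_square using C1 by (intro mult_left_mono) auto
      moreover have "real r2 \<le> (C1 + 1) * X" using r2_le X1 unfolding distrib_right by linarith
      ultimately have "real (r1 + r2) \<le> (8000 + (C1 + 1)) * (real d)\<^sup>2"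
        unfolding distrib_right by (simp add: r1_def)
      also have "\<dots> \<le> C * (real d)\<^sup>2" using C by (intro mult_right_mono) auto
      finally show ?thesis .
    qed
    have sparse: "AE P in M. two_sparse_cols (r1 + r2) n P"
      unfolding M_def by (auto simp: AE_measure_pmf_iff F_def two_sparse_stacked split: prod.splits)
    have embed: "\<exists>E \<in> sets M. measure M E \<ge> 0.99 \<and>
              (\<forall>P \<in> E. \<forall>x :: nat \<Rightarrow> real.
                 c * lp_norm p n (mat_vec d A x)
                   \<le> lp_norm p (r1 + r2) (mat_vec n P (mat_vec d A x)) \<and>
                 lp_norm p (r1 + r2) (mat_vec n P (mat_vec d A x))
                   \<le> C * X powr (1 / p) * lp_norm p n (mat_vec d A x))" for A :: "nat \<Rightarrow> nat \<Rightarrow> real"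
    proof -
      obtain V where
        rep: "\<And>x. \<exists>z. (\<forall>i<n. mat_vec d A x i = mat_vec d V z i) \<and>
          sqrt (\<Sum>j<d. (z j)\<^sup>2) powr p \<le> 2 * npow p n (mat_vec d A x)"
        and \<rho>: "(\<Sum>i<n. row_norm d V i powr p) \<le> 2 * real d"
        by (rule lewis_basis[OF p, of n d A]) (rule that)
      let ?H = "heavy_rows p n d V"
      \<comment> \<open>Deleting the heavy rows leaves a matrix with d columns whose image is the
        set of light parts of the vectors A x. So the same hash embeds these as well, at the price
        of a second event of probability at most 1/1000.\<close>
      define A' where "A' i j = (if i \<in> ?H then 0 else A i j)" for i j
      have A': "mat_vec d A' x = (\<lambda>i. if i \<in> ?H then 0 else mat_vec d A x i)" for x
        by (rule ext) (simp add: mat_vec_def A'_def)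
      define G1 where "G1 A s \<longleftrightarrow> l2_embeds r1 n d A (fst s) (snd s)"
        for A :: "nat \<Rightarrow> nat \<Rightarrow> real" and s
      define w where "w t = heavy_weights p n (fst (snd t)) (snd (snd t))"
        for t :: "(nat \<Rightarrow> nat) \<times> (nat \<Rightarrow> real) \<times> (nat \<Rightarrow> nat)"
      define G3 where "G3 t \<longleftrightarrow> frame_pow p r2 n d V (fst t) (w t) \<le> L" for t
      define G4 where "G4 t \<longleftrightarrow> (\<forall>k\<in>grid d D.
          spread p n r2 K (mat_vec d V (\<lambda>j. real_of_int (k j) / real D)) \<longrightarrow>
          1 / 768 \<le> npow p r2 (sketch n (fst t) (w t) (mat_vec d V (\<lambda>j. real_of_int (k j) / real D))))" for t
      define good where "good \<omega> \<longleftrightarrow> G1 A (fst \<omega>) \<and> G1 A' (fst \<omega>) \<and> G3 (snd \<omega>) \<and> G4 (snd \<omega>)" for \<omega>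
      have G1: "avg \<Omega>\<^sub>1 (\<lambda>s. of_bool (\<not> G1 A s)) \<le> 1 / 1000" for A
        using l2_embedding[OF r1, of n d A] d unfolding \<Omega>\<^sub>1_def G1_def by (simp add: case_prod_unfold r1_def)
      have G3: "avg \<Omega>\<^sub>2 (\<lambda>t. of_bool (\<not> G3 t)) \<le> 2 / 1000"
      proof -
        \<comment> \<open>The row norms sum to at most 2 d, so T makes the truncation cost 1/1000,
          while \<tau> makes the bucket term r2 * \<tau> equal to d. L is 2000 times the resulting
          bracket, so that the Markov term is 1/1000 too.\<close>
        let ?\<tau> = "real d / real r2" and ?T = "2000 * real d"
        have \<tau>: "0 < ?\<tau>" "?\<tau> \<le> ?T"
          using d r2 by (auto simp: divide_le_eq mult_le_cancel_left1)
        have T\<tau>: "?T / ?\<tau> = 2000 * real r2" using d r2 by simp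
        have "avg \<Omega>\<^sub>2 (\<lambda>t. of_bool (\<not> G3 t))
          \<le> 2 * real d / ?T + 2 * (real r2 * ?\<tau> + 2 * real d * (2 powr (2 / p) / (2 / p - 1) + 1 + ln (?T / ?\<tau>))) / L"
          using heavy_frame_pow_le[OF p r2 _ \<tau> L \<rho>, of n] n
          unfolding \<Omega>\<^sub>2_def avg_Times G3_def w_def not_le by simp
        also have "\<dots> = 2 / 1000"
        proof -
          define e where "e = real d + 2 * real d * (Cq + 1 + ln (2000 * real r2))"
          have "L = 2000 * e" by (simp add: L_def e_def)
          moreover have "real r2 * ?\<tau> + 2 * real d * (2 powr (2 / p) / (2 / p - 1) + 1 + ln (?T / ?\<tau>)) = e"
            unfolding T\<tau> Cq_def[symmetric] e_def using r2 by simp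
          ultimately show ?thesis using L d by simp
        qed
        finally show ?thesis .
      qed
      have G4: "avg \<Omega>\<^sub>2 (\<lambda>t. of_bool (\<not> G4 t)) \<le> 1 / 1000"
      proof -
        have "5 * real D = 5 * real B * real r2 ^ 4" by (simp add: D_def)
        with C1(2)[OF d r2_ge[unfolded X_def]]
        have "real d * ln (5 * real D) + ln 1000 \<le> real r2 / 10" by (simp only:)
        from avg_net_failure_le[OF p r2 _ D this, of n V] show ?thesis
          using n unfolding \<Omega>\<^sub>2_def G4_def w_def K_def by (simp add: case_prod_unfold)
      qed
      have bad: "avg \<Omega> (\<lambda>\<omega>. of_bool (\<not> good \<omega>)) \<le> 1 / 100"
      proof -
        have "avg \<Omega> (\<lambda>\<omega>. of_bool (\<not> good \<omega>)) \<le> avg \<Omega> (\<lambda>\<omega>.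
            (of_bool (\<not> G1 A (fst \<omega>)) + of_bool (\<not> G1 A' (fst \<omega>)))
            + (of_bool (\<not> G3 (snd \<omega>)) + of_bool (\<not> G4 (snd \<omega>))))"
          by (intro avg_mono) (auto simp: good_def)
        also have "\<dots> = (avg \<Omega>\<^sub>1 (\<lambda>s. of_bool (\<not> G1 A s)) + avg \<Omega>\<^sub>1 (\<lambda>s. of_bool (\<not> G1 A' s)))
            + (avg \<Omega>\<^sub>2 (\<lambda>t. of_bool (\<not> G3 t)) + avg \<Omega>\<^sub>2 (\<lambda>t. of_bool (\<not> G4 t)))"
          unfolding avg_add \<Omega>_def
          using avg_Times_fst[OF \<Omega>2, of \<Omega>\<^sub>1 "\<lambda>s. of_bool (\<not> G1 A s)"]
            avg_Times_fst[OF \<Omega>2, of \<Omega>\<^sub>1 "\<lambda>s. of_bool (\<not> G1 A' s)"]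
            avg_Times_snd[OF \<Omega>1, of \<Omega>\<^sub>2 "\<lambda>t. of_bool (\<not> G3 t)"]
            avg_Times_snd[OF \<Omega>1, of \<Omega>\<^sub>2 "\<lambda>t. of_bool (\<not> G4 t)"]
          by (simp only:)
        also have "\<dots> \<le> 1 / 100" using G1[of A] G1[of A'] G3 G4 by linarith
        finally show ?thesis .
      qed
      define E where "E = {P. \<forall>x. 1 / 8000 * npow p n (mat_vec d A x) \<le> npow p (r1 + r2) (mat_vec n P (mat_vec d A x)) \<and>
          npow p (r1 + r2) (mat_vec n P (mat_vec d A x)) \<le> Cu * X * npow p n (mat_vec d A x)}"
      have good_E: "F \<omega> \<in> E" if \<omega>: "\<omega> \<in> \<Omega>" and g: "good \<omega>" for \<omega>
      proof -
        obtain h1 \<epsilon>1 h2 \<epsilon>2 u where \<omega>_eq: "\<omega> = ((h1, \<epsilon>1), (h2, \<epsilon>2, u))" by (metis surj_pair)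
        have h1: "h1 \<in> hashes n r1" and \<epsilon>1: "\<epsilon>1 \<in> signs n"
          using \<omega> by (auto simp: \<omega>_eq \<Omega>_def \<Omega>\<^sub>1_def)
        define w2 where "w2 = heavy_weights p n \<epsilon>2 u"
        have l2: "l2_embeds r1 n d A h1 \<epsilon>1" and l2': "l2_embeds r1 n d A' h1 \<epsilon>1"
          and frame: "frame_pow p r2 n d V h2 w2 \<le> L"
          and net: "\<And>k. k \<in> grid d D \<Longrightarrow> spread p n r2 K (mat_vec d V (\<lambda>j. real_of_int (k j) / real D)) \<Longrightarrow>
            1 / 768 \<le> npow p r2 (sketch n h2 w2 (mat_vec d V (\<lambda>j. real_of_int (k j) / real D)))"
          using g by (auto simp: good_def G1_def G3_def G4_def w_def w2_def \<omega>_eq)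
        have P: "npow p (r1 + r2) (mat_vec n (F \<omega>) y)
            = (1 / \<beta>) powr p * npow p r1 (sketch n h1 \<epsilon>1 y) + npow p r2 (sketch n h2 w2 y)" for y
          unfolding \<omega>_eq F_def w2_def using \<beta> by (simp add: npow_stacked)
        have lower_unit: "1 / 8000 \<le> npow p (r1 + r2) (mat_vec n (F \<omega>) (mat_vec d A x))"
          if unit: "npow p n (mat_vec d A x) = 1" for x
        proof -
          obtain z where z: "\<forall>i<n. mat_vec d A x i = mat_vec d V z i"
            "sqrt (\<Sum>j<d. (z j)\<^sup>2) powr p \<le> 2 * npow p n (mat_vec d A x)" using rep by blast
          have sq: "1 / 2 * (\<Sum>i<n. (mat_vec d A x i)\<^sup>2) \<le> (\<Sum>b<r1. (sketch n h1 \<epsilon>1 (mat_vec d A x) b)\<^sup>2)"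
            using l2[unfolded l2_embeds_def, rule_format, of x] by linarith
          have \<eta>\<beta>: "\<eta>\<^sup>2 * (2 * real d) powr (2 / p) \<le> \<beta>\<^sup>2" unfolding \<beta>(2) K_def using lower(4) d by simp
          show ?thesis unfolding P
            by (rule stacked_lower_bound[OF p r2 D \<rho> unit _ _ sq frame net K_def \<beta> _ _ _ \<eta>\<beta>, of z])
              (use z unit d lower in \<open>auto simp: D_def\<close>)
        qed
        have lower_all: "1 / 8000 * npow p n (mat_vec d A x) \<le> npow p (r1 + r2) (mat_vec n (F \<omega>) (mat_vec d A x))" for x
        proof (cases "npow p n (mat_vec d A x) = 0")
          case False
          define Y where "Y = npow p n (mat_vec d A x)"
          have Y: "0 < Y" using False npow_nonneg[of p n "mat_vec d A x"] unfolding Y_def by linarith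
          \<comment> \<open>Normalises A x; both sides are homogeneous of degree p in x.\<close>
          define s where "s = Y powr (- (1 / p))"
          have "\<bar>s\<bar> powr p = Y powr (- 1)" using p by (simp add: s_def powr_powr)
          then have sp: "\<bar>s\<bar> powr p = 1 / Y" using Y by (simp add: powr_minus_divide)
          have "npow p n (mat_vec d A (\<lambda>j. s * x j)) = 1"
            unfolding mat_vec_scale npow_scale sp Y_def[symmetric] using Y by simp
          from lower_unit[OF this]
          have "1 / 8000 \<le> 1 / Y * npow p (r1 + r2) (mat_vec n (F \<omega>) (mat_vec d A x))"
            unfolding mat_vec_scale npow_scale sp .
          then show ?thesis using Y unfolding Y_def[symmetric] by (simp add: field_simps)
        qed simp
        have upper_all: "npow p (r1 + r2) (mat_vec n (F \<omega>) (mat_vec d A x)) \<le> Cu * X * npow p n (mat_vec d A x)" for x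
        proof -
          let ?y = "mat_vec d A x"
          obtain z where z: "\<forall>i<n. ?y i = mat_vec d V z i"
            "sqrt (\<Sum>j<d. (z j)\<^sup>2) powr p \<le> 2 * npow p n ?y" using rep by blast
          have "0 \<le> (\<Sum>i<n. (if i \<in> ?H then 0 else ?y i)\<^sup>2)" by (intro sum_nonneg) auto
          then have sq: "(\<Sum>b<r1. (sketch n h1 \<epsilon>1 (\<lambda>i. if i \<in> ?H then 0 else ?y i) b)\<^sup>2)
              \<le> 2 * (\<Sum>i<n. (if i \<in> ?H then 0 else ?y i)\<^sup>2)"
            using l2'[unfolded l2_embeds_def, rule_format, of x] unfolding A' by linarith
          have S: "npow p r1 (sketch n h1 \<epsilon>1 ?y) \<le> 300000 * real d powr (p / 2) * npow p n ?y"
            by (rule light_part_bound[OF p d h1 \<epsilon>1 r1_def \<rho> _ z(2) sq]) (use z in auto)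
          have "npow p r2 (sketch n h2 w2 ?y) = npow p r2 (sketch n h2 w2 (mat_vec d V z))"
            using z by (intro npow_cong sketch_cong) auto
          also have "\<dots> \<le> sqrt (\<Sum>j<d. (z j)\<^sup>2) powr p * frame_pow p r2 n d V h2 w2"
            using p by (intro npow_sketch_le_frame_pow) auto
          also have "\<dots> \<le> 2 * npow p n ?y * L"
            using z(2) frame by (intro mult_mono) (auto simp: frame_pow_def intro: sum_nonneg)
          finally have T: "npow p r2 (sketch n h2 w2 ?y) \<le> 2 * L * npow p n ?y" by (simp add: ac_simps)
          have "npow p (r1 + r2) (mat_vec n (F \<omega>) ?y)
              \<le> (1 / \<beta>) powr p * (300000 * real d powr (p / 2) * npow p n ?y) + 2 * L * npow p n ?y"
            unfolding P by (intro add_mono mult_left_mono S T) auto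
          also have "\<dots> = ((1 / \<beta>) powr p * (300000 * real d powr (p / 2)) + 2 * L) * npow p n ?y"
            by (simp add: distrib_right)
          also have "\<dots> \<le> Cu * X * npow p n ?y" using upper by (intro mult_right_mono) auto
          finally show ?thesis .
        qed
        show ?thesis unfolding E_def using lower_all upper_all by blast
      qed
      have prob: "0.99 \<le> measure M E"
        using prob_map_pmf_of_set_ge[OF \<Omega> bad good_E] unfolding M_def by simp
      have norms: "c * lp_norm p n y \<le> lp_norm p r y' \<and> lp_norm p r y' \<le> C * X powr (1 / p) * lp_norm p n y"
        if "1 / 8000 * npow p n y \<le> npow p r y'" "npow p r y' \<le> Cu * X * npow p n y" for y y' r
      proof
        have lp: "lp_norm p m v = npow p m v powr (1 / p)" for m v by (simp add: lp_norm_def npow_def)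
        have "(1 / 8000 * npow p n y) powr (1 / p) \<le> npow p r y' powr (1 / p)"
          using that p by (intro powr_mono2) auto
        then show "c * lp_norm p n y \<le> lp_norm p r y'"
          unfolding lp c_def by (simp only: powr_mult)
        have "npow p r y' powr (1 / p) \<le> (Cu * X * npow p n y) powr (1 / p)"
          using that p by (intro powr_mono2) auto
        also have "\<dots> = Cu powr (1 / p) * X powr (1 / p) * npow p n y powr (1 / p)"
          by (simp only: powr_mult)
        also have "\<dots> \<le> C * X powr (1 / p) * npow p n y powr (1 / p)"
          using C by (intro mult_right_mono) auto
        finally show "lp_norm p r y' \<le> C * X powr (1 / p) * lp_norm p n y" unfolding lp .
      qed
      show ?thesis
      proof (rule bexI[of _ E])
        show "E \<in> sets M" by (simp add: M_def)
        show "0.99 \<le> measure M E \<and> (\<forall>P\<in>E. \<forall>x. c * lp_norm p n (mat_vec d A x)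
             \<le> lp_norm p (r1 + r2) (mat_vec n P (mat_vec d A x)) \<and>
            lp_norm p (r1 + r2) (mat_vec n P (mat_vec d A x))
             \<le> C * X powr (1 / p) * lp_norm p n (mat_vec d A x))"
        proof (intro conjI[OF prob] ballI allI norms)
          fix P x assume "P \<in> E"
          then show "1 / 8000 * npow p n (mat_vec d A x) \<le> npow p (r1 + r2) (mat_vec n P (mat_vec d A x))"
            "npow p (r1 + r2) (mat_vec n P (mat_vec d A x)) \<le> Cu * X * npow p n (mat_vec d A x)"
            unfolding E_def by blast+
        qed
      qed
    qed
    have "prob_space M" unfolding M_def by (rule measure_pmf.prob_space_axioms)
    then show ?thesis
      using rows sparse embed unfolding X_def[symmetric]
      by (intro exI[of _ "r1 + r2"] exI[of _ M] conjI allI)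
  qed
  have "0 < c" by (simp add: c_def)
  show ?thesis
    by (intro exI[of _ c] exI[of _ C] conjI allI impI \<open>0 < c\<close> \<open>0 < C\<close> main)
qed

end
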